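(* There exist positive constants $R$, $\tau_0$, $r$ and $C$ such that, if $\psi_0 \in \mathcal{S} \cap \mathcal{U}(R)$, then for all $0<\tau \leq \tau_0$ the sequence $(\psi_n)_{n\ge 0}$ defined from $\psi_0$ by the linearly implicit normalized gradient scheme $$\psi_n^* = \psi_n + \tau\Big(\tfrac12 \Delta \psi_n^* + |\psi_n|^2\psi_n^*\Big), \qquad \psi_{n+1} = \frac{\psi_n^*}{\|\psi_n^*\|_{L^2}},$$ satisfies $$\forall\, n \in\mathbb{N}, \qquad \|\psi_n - \eta\|_{H^1} \leq C e^{-r n \tau}.$$
   Context: Everything is set on $\mathbb{R}$, $\Delta=\partial_{xx}$, and $\|\phi\|_{H^1}^2=\|\phi\|_{L^2}^2+\|\partial_x\phi\|_{L^2}^2$. Let $V=\{\phi\in H^1(\mathbb{R},\mathbb{R}) : \phi(-x)=\phi(x)\}$ be the space of real even $H^1$ functions and $\mathcal{S}=\{\psi\in V : \|\psi\|_{L^2}=1\}$. The ground state is $\eta(x)=\frac12\,\mathrm{sech}(x/2)$; it has $\|\eta\|_{L^2}=1$, it is the unique real symmetric minimizer in $H^1$ of $H(\psi)=\frac14\int_{\mathbb{R}}(|\partial_x\psi|^2-|\psi|^4)\,dx$ under the constraint $\|\psi\|_{L^2}=1$, and it satisfies $-\frac12\Delta\eta-\eta^3=-\lambda\eta$ with $\lambda$ the associated Lagrange multiplier ($\lambda = 1/8$). For $R>0$, $\mathcal{U}(R)=\{\phi\in V : \|\phi-\eta\|_{H^1}<R\}$. The number $\tau>0$ is the time step. *)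

theory Defs
  imports "HOL-Analysis.Analysis"
begin

text \<open>
  Elements of \<open>L\<^sup>2(\<real>)\<close> and \<open>H\<^sup>1(\<real>)\<close> are represented by Borel functions \<open>real \<Rightarrow> real\<close>; two
  representatives denote the same element iff they agree almost everywhere. Up to the choice of
  Borel representatives, all notions below depend on equivalence classes only.
\<close>

definition L2 :: "(real \<Rightarrow> real) set" where
  "L2 = {f. f \<in> borel_measurable lborel \<and> integrable lborel (\<lambda>x. (f x)\<^sup>2)}"

definition l2_norm :: "(real \<Rightarrow> real) \<Rightarrow> real" where
  "l2_norm f = sqrt (LINT x|lborel. (f x)\<^sup>2)"

text \<open>Test functions: \<open>C\<^sup>\<infinity>\<close> with compact support.\<close>

definition test_fun :: "(real \<Rightarrow> real) \<Rightarrow> bool" where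
  "test_fun \<phi> \<longleftrightarrow>
     (\<forall>k x. (deriv ^^ k) \<phi> field_differentiable (at x)) \<and> (\<exists>B. \<forall>x. \<bar>x\<bar> > B \<longrightarrow> \<phi> x = 0)"

definition locally_integrable :: "(real \<Rightarrow> real) \<Rightarrow> bool" where
  "locally_integrable f \<longleftrightarrow> (\<forall>a b. set_integrable lborel {a..b} f)"

definition has_weak_deriv :: "(real \<Rightarrow> real) \<Rightarrow> (real \<Rightarrow> real) \<Rightarrow> bool" where
  "has_weak_deriv f g \<longleftrightarrow> locally_integrable f \<and> locally_integrable g \<and>
     (\<forall>\<phi>. test_fun \<phi> \<longrightarrow> (LINT x|lborel. f x * deriv \<phi> x) = - (LINT x|lborel. g x * \<phi> x))"

definition H1 :: "(real \<Rightarrow> real) set" where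
  "H1 = {f \<in> L2. \<exists>g \<in> L2. has_weak_deriv f g}"

text \<open>The weak derivative is unique up to null sets, so the choice does not affect \<open>h1_norm\<close>.\<close>

definition weak_deriv :: "(real \<Rightarrow> real) \<Rightarrow> real \<Rightarrow> real" where
  "weak_deriv f = (SOME g. g \<in> L2 \<and> has_weak_deriv f g)"

definition h1_norm :: "(real \<Rightarrow> real) \<Rightarrow> real" where
  "h1_norm f = sqrt ((l2_norm f)\<^sup>2 + (l2_norm (weak_deriv f))\<^sup>2)"

definition has_weak_laplacian :: "(real \<Rightarrow> real) \<Rightarrow> (real \<Rightarrow> real) \<Rightarrow> bool" where
  "has_weak_laplacian f h \<longleftrightarrow> (\<exists>g. has_weak_deriv f g \<and> has_weak_deriv g h)"

definition V :: "(real \<Rightarrow> real) set" where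
  "V = {f \<in> H1. AE x in lborel. f (- x) = f x}"

definition S :: "(real \<Rightarrow> real) set" where
  "S = {f \<in> V. l2_norm f = 1}"

definition eta :: "real \<Rightarrow> real" where
  "eta x = 1 / 2 * (1 / cosh (x / 2))"

definition U :: "real \<Rightarrow> (real \<Rightarrow> real) set" where
  "U R = {f \<in> V. h1_norm (\<lambda>x. f x - eta x) < R}"

text \<open>
  \<open>implicit_step \<tau> \<psi> \<psi>s\<close>: the function \<open>\<psi>s\<close> is an \<open>H\<^sup>1\<close> solution of
  \<open>\<psi>s = \<psi> + \<tau> (\<Delta>\<psi>s / 2 + \<bar>\<psi>\<bar>\<^sup>2 \<psi>s)\<close>. The Laplacian is a weak one; the equation
  itself forces it to be a locally integrable function, here \<open>w\<close>. Evenness of \<open>\<psi>s\<close> is not imposed.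
\<close>

definition implicit_step :: "real \<Rightarrow> (real \<Rightarrow> real) \<Rightarrow> (real \<Rightarrow> real) \<Rightarrow> bool" where
  "implicit_step \<tau> \<psi> \<psi>s \<longleftrightarrow> \<psi>s \<in> H1 \<and>
     (\<exists>w. has_weak_laplacian \<psi>s w \<and>
          (AE x in lborel. \<psi>s x = \<psi> x + \<tau> * (1 / 2 * w x + \<bar>\<psi> x\<bar>\<^sup>2 * \<psi>s x)))"

text \<open>
  Since \<open>\<psi>s\<close> is any representative of the solution, the pointwise equation for
  \<open>\<psi> (Suc n)\<close> leaves its representative free.
\<close>

definition gradient_scheme ::
    "real \<Rightarrow> (real \<Rightarrow> real) \<Rightarrow> (nat \<Rightarrow> real \<Rightarrow> real) \<Rightarrow> bool" where
  "gradient_scheme \<tau> \<psi>0 \<psi> \<longleftrightarrow> \<psi> 0 = \<psi>0 \<and>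
     (\<forall>n. \<exists>\<psi>s. implicit_step \<tau> (\<psi> n) \<psi>s \<and> l2_norm \<psi>s \<noteq> 0 \<and>
               \<psi> (Suc n) = (\<lambda>x. \<psi>s x / l2_norm \<psi>s))"

end

theory Submission
  imports Defs "HOL-Computational_Algebra.Polynomial"
begin

text \<open>
  Two elementary mechanisms replace spectral theory and compactness.

  For a unit vector \<open>f\<close> put \<open>F(x) = \<integral>\<^sub>0\<^sup>x f\<^sup>2\<close>. For even \<open>f\<close> the energy gap is a perfect square,
  \<open>4 (H(f) - H(\<eta>)) = \<parallel>f' + F f\<parallel>\<^sup>2\<close>. So a small gap means that \<open>(f, F)\<close> nearly solves the first order
  system \<open>f' = - F f, F' = f\<^sup>2\<close>, whose solution with \<open>F(0) = 0\<close> and \<open>F(\<infinity>) = 1/2\<close> is the ground state;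
  weighted energy estimates on the half line turn this into the coercivity bound
  \<open>\<parallel>f - \<eta>\<parallel>\<^sub>H\<^sub>1\<^sup>2 \<le> C (H(f) - H(\<eta>))\<close> near \<open>\<eta>\<close>. Evenness, through \<open>F(0) = 0\<close>, removes the translations.

  A step of the scheme is one inverse iteration for \<open>- 1/2 \<Delta> - \<psi>\<^sub>n\<^sup>2\<close>. The Rayleigh quotient identity shows
  that the energy decreases by at least \<open>c \<parallel>\<psi>\<^sub>n\<^sub>+\<^sub>1 - \<psi>\<^sub>n\<parallel>\<^sup>2 / \<tau>\<close>. The residual of the stationary equation at
  \<open>\<psi>\<^sub>n\<^sub>+\<^sub>1\<close> is of size \<open>\<parallel>\<psi>\<^sub>n\<^sub>+\<^sub>1 - \<psi>\<^sub>n\<parallel> / \<tau>\<close>, and by coercivity its square dominates the energy gap. Hence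
  the gap contracts by a factor \<open>1 + c \<tau>\<close> in every step.
\<close>

section \<open>Square integrable functions\<close>

text \<open>A step visibly decreases the energy, not the distance to \<open>eta\<close>, and the
  gradient inequality holds only in a ball around \<open>eta\<close>. So the invariant combines a
  ball with a far smaller bound on the gap: coercivity puts the iterate deep inside the ball, and
  the dissipated energy bounds the displacement, so the next iterate cannot leave. The Lagrange
  multiplier at an iterate is not known beforehand; the scheme supplies a candidate, (1 - \<kappa>)
  / \<tau>, which is compared with 1/8 by testing the residual with \<open>eta\<close>. Coercivity
  is proved on the half line because the damping in the equations for the errors has a sign only for
  x >= 0; evenness doubles the result. Constants: 80000 is the coercivity constant; the radius
  1/640000 = 1/(8 * 80000) lets half the gap absorb the higher order terms; \<open>gap0\<close>
  keeps a step inside that radius; 200000000 rounds up 36 * 64 * 80000. Weak derivatives are traded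
  at once for absolutely continuous representatives, so pointwise calculus applies. Evenness of the
  implicit solution is not imposed; it follows from uniqueness and reflection.\<close>

lemmas lint_cong = Bochner_Integration.integral_cong

lemma L2D: "f \<in> L2 \<Longrightarrow> f \<in> borel_measurable borel" "f \<in> L2 \<Longrightarrow> integrable lborel (\<lambda>x. (f x)\<^sup>2)"
  by (auto simp: L2_def)

lemma L2I: "f \<in> borel_measurable borel \<Longrightarrow> integrable lborel (\<lambda>x. (f x)\<^sup>2) \<Longrightarrow> f \<in> L2"
  by (auto simp: L2_def)

lemma integrable_L2_mult:
  assumes "f \<in> L2" "g \<in> L2"
  shows "integrable lborel (\<lambda>x. f x * g x)"
proof (rule Bochner_Integration.integrable_bound)
  show "integrable lborel (\<lambda>x. (f x)\<^sup>2 + (g x)\<^sup>2)"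
    using assms by (auto dest: L2D)
  show "(\<lambda>x. f x * g x) \<in> borel_measurable lborel"
    using assms[THEN L2D(1)] by measurable
  have "\<bar>a * b\<bar> \<le> a\<^sup>2 + b\<^sup>2" for a b :: real
    using sum_squares_bound[of "\<bar>a\<bar>" "\<bar>b\<bar>"] mult_nonneg_nonneg[of "\<bar>a\<bar>" "\<bar>b\<bar>"]
    unfolding abs_mult power2_abs by linarith
  then show "AE x in lborel. norm (f x * g x) \<le> norm ((f x)\<^sup>2 + (g x)\<^sup>2)"
    by auto
qed

lemma L2_cmult: "f \<in> L2 \<Longrightarrow> (\<lambda>x. c * f x) \<in> L2"
  by (auto simp: L2_def power_mult_distrib)

lemma L2_add:
  assumes "f \<in> L2" "g \<in> L2"
  shows "(\<lambda>x. f x + g x) \<in> L2"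
proof (rule L2I)
  show "integrable lborel (\<lambda>x. (f x + g x)\<^sup>2)"
    using L2D(2)[OF assms(1)] L2D(2)[OF assms(2)] integrable_L2_mult[OF assms]
    by (simp add: power2_sum mult.assoc)
qed (use assms[THEN L2D(1)] in measurable)

lemma L2_uminus: "f \<in> L2 \<Longrightarrow> (\<lambda>x. - f x) \<in> L2"
  by (auto simp: L2_def)

lemma L2_diff: "f \<in> L2 \<Longrightarrow> g \<in> L2 \<Longrightarrow> (\<lambda>x. f x - g x) \<in> L2"
  using L2_add[of f "\<lambda>x. - g x"] L2_uminus[of g] by simp

lemma L2_dominated:
  assumes "f \<in> L2" and [measurable]: "g \<in> borel_measurable borel"
    and "\<And>x. \<bar>g x\<bar> \<le> B * \<bar>f x\<bar>"
  shows "g \<in> L2"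
proof (rule L2I)
  have "(g x)\<^sup>2 \<le> B\<^sup>2 * (f x)\<^sup>2" for x
    using power_mono[OF assms(3)[of x], of 2] by (simp add: power_mult_distrib)
  then show "integrable lborel (\<lambda>x. (g x)\<^sup>2)"
    by (intro Bochner_Integration.integrable_bound[OF integrable_mult_right[OF L2D(2)[OF assms(1)], of "B\<^sup>2"]]) auto
qed simp

lemma L2_bounded_mult:
  assumes "f \<in> L2" and [measurable]: "g \<in> borel_measurable borel"
    and "\<And>x. \<bar>g x\<bar> \<le> B"
  shows "(\<lambda>x. g x * f x) \<in> L2"
  using L2D(1)[OF assms(1)]
  by (intro L2_dominated[OF assms(1), of _ B]) (auto simp: abs_mult intro!: mult_right_mono assms(3))

lemma L2_indicator:
  assumes "f \<in> L2" "A \<in> sets borel"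
  shows "(\<lambda>x. indicator A x * f x) \<in> L2"
  using assms by (intro L2_bounded_mult[of _ _ 1]) (auto split: split_indicator)

lemma L2_reflect: "f \<in> L2 \<Longrightarrow> (\<lambda>x. f (- x)) \<in> L2"
  using lborel_integrable_real_affine[of "\<lambda>x. (f x)\<^sup>2" "-1" 0]
  by (auto simp: L2_def)

lemma L2_cong_AE:
  assumes "f \<in> L2" "g \<in> borel_measurable borel" "AE x in lborel. f x = g x"
  shows "g \<in> L2"
proof (rule L2I)
  show "integrable lborel (\<lambda>x. (g x)\<^sup>2)"
    using L2D[OF assms(1)] assms(2,3)
    by (intro integrable_cong_AE_imp[OF L2D(2)[OF assms(1)]]) auto
qed fact

lemma l2_norm_sq: "(l2_norm f)\<^sup>2 = (LINT x|lborel. (f x)\<^sup>2)"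
  by (simp add: l2_norm_def)

lemma l2_norm_nonneg [simp]: "0 \<le> l2_norm f"
  by (simp add: l2_norm_def)

lemma l2_norm_cong_AE:
  assumes "f \<in> borel_measurable borel" "g \<in> borel_measurable borel" "AE x in lborel. f x = g x"
  shows "l2_norm f = l2_norm g"
  unfolding l2_norm_def using assms by (intro arg_cong[where f=sqrt] integral_cong_AE) auto

lemma l2_norm_cmult: "l2_norm (\<lambda>x. c * f x) = \<bar>c\<bar> * l2_norm f"
  by (simp add: l2_norm_def power_mult_distrib real_sqrt_mult)

lemma l2_norm_eq_0_AE:
  assumes "f \<in> L2" "l2_norm f = 0"
  shows "AE x in lborel. f x = 0"
  using assms integral_nonneg_eq_0_iff_AE[of lborel "\<lambda>x. (f x)\<^sup>2"]
  by (auto simp: l2_norm_def L2_def)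

abbreviation ip :: "(real \<Rightarrow> real) \<Rightarrow> (real \<Rightarrow> real) \<Rightarrow> real" where
  "ip f g \<equiv> LINT x|lborel. f x * g x"

lemma cauchy_schwarz:
  assumes "f \<in> L2" "g \<in> L2"
  shows "\<bar>ip f g\<bar> \<le> l2_norm f * l2_norm g"
proof (cases "l2_norm f = 0 \<or> l2_norm g = 0")
  case True
  then have "AE x in lborel. f x * g x = 0"
    using l2_norm_eq_0_AE[OF assms(1)] l2_norm_eq_0_AE[OF assms(2)] by (elim disjE) (fastforce elim: eventually_mono)+
  then have "ip f g = 0" by (rule integral_eq_zero_AE)
  then show ?thesis by simp
next
  case False
  define s t where "s = l2_norm f" and "t = l2_norm g"
  have pos: "s > 0" "t > 0" using False by (auto simp: s_def t_def less_le)
  \<comment> \<open>Here \<open>k\<close> is a sign. Scaling each function by the norm of the other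
    balances the square, after which 2 s t cancels.\<close>
  have *: "k * ip f g \<le> s * t" if k: "k\<^sup>2 = 1" for k :: real
  proof -
    have "0 \<le> (LINT x|lborel. (t * f x - k * s * g x)\<^sup>2)" by simp
    also have "\<dots> = (LINT x|lborel. t\<^sup>2 * (f x)\<^sup>2 + s\<^sup>2 * (g x)\<^sup>2 - 2 * t * k * s * (f x * g x))"
      using k by (intro lint_cong) (auto simp: power2_diff power_mult_distrib)
    also have "\<dots> = t\<^sup>2 * s\<^sup>2 + s\<^sup>2 * t\<^sup>2 - 2 * t * k * s * ip f g"
      using L2D(2)[OF assms(1)] L2D(2)[OF assms(2)] integrable_L2_mult[OF assms]
      by (simp add: s_def t_def l2_norm_sq)
    finally have "(2 * (s * t)) * (k * ip f g) \<le> (2 * (s * t)) * (s * t)"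
      by (simp add: algebra_simps power2_eq_square)
    then show ?thesis using pos by simp
  qed
  from *[of 1] *[of "-1"] show ?thesis by (auto simp: s_def t_def)
qed

lemma l2_norm_triangle:
  assumes "f \<in> L2" "g \<in> L2"
  shows "l2_norm (\<lambda>x. f x + g x) \<le> l2_norm f + l2_norm g"
proof (rule power2_le_imp_le)
  have "(l2_norm (\<lambda>x. f x + g x))\<^sup>2 = (LINT x|lborel. (f x)\<^sup>2 + (g x)\<^sup>2 + 2 * (f x * g x))"
    unfolding l2_norm_sq by (intro lint_cong) (auto simp: power2_sum)
  also have "\<dots> = (l2_norm f)\<^sup>2 + (l2_norm g)\<^sup>2 + 2 * ip f g"
    using L2D(2)[OF assms(1)] L2D(2)[OF assms(2)] integrable_L2_mult[OF assms]
    by (simp add: l2_norm_sq)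
  also have "\<dots> \<le> (l2_norm f + l2_norm g)\<^sup>2"
    using cauchy_schwarz[OF assms] by (simp add: power2_sum)
  finally show "(l2_norm (\<lambda>x. f x + g x))\<^sup>2 \<le> (l2_norm f + l2_norm g)\<^sup>2" .
qed simp

lemma l2_norm_mono:
  assumes "f \<in> L2" "g \<in> borel_measurable borel" "\<And>x. \<bar>g x\<bar> \<le> B * \<bar>f x\<bar>" "B \<ge> 0"
  shows "l2_norm g \<le> B * l2_norm f"
proof (rule power2_le_imp_le)
  have "(g x)\<^sup>2 \<le> B\<^sup>2 * (f x)\<^sup>2" for x
    using power_mono[OF assms(3)[of x], of 2] by (simp add: power_mult_distrib)
  then have "(LINT x|lborel. (g x)\<^sup>2) \<le> (LINT x|lborel. B\<^sup>2 * (f x)\<^sup>2)"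
    using L2D(2)[OF assms(1)] L2D(2)[OF L2_dominated[OF assms(1-3)]] by (intro integral_mono) auto
  then show "(l2_norm g)\<^sup>2 \<le> (B * l2_norm f)\<^sup>2"
    by (simp add: power_mult_distrib l2_norm_sq)
qed (use assms in simp)

section \<open>Absolutely continuous functions\<close>

text \<open>Local absolute continuity in its integral form. The derivative is an explicit second
  argument, fixed only up to null sets, so no pointwise differentiability is ever needed.\<close>

definition ac :: "(real \<Rightarrow> real) \<Rightarrow> (real \<Rightarrow> real) \<Rightarrow> bool" where
  "ac f f' \<longleftrightarrow> locally_integrable f' \<and>
     (\<forall>a b. a \<le> b \<longrightarrow> f b - f a = (LINT x:{a..b}|lborel. f' x))"

lemma locally_integrableD: "locally_integrable f \<Longrightarrow> set_integrable lborel {a..b} f"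
  by (simp add: locally_integrable_def)

lemma locally_integrable_borel:
  assumes "locally_integrable f"
  shows "f \<in> borel_measurable borel"
proof (rule borel_measurable_LIMSEQ_real)
  show "(\<lambda>n. indicator {-real n..real n} x * f x) \<longlonglongrightarrow> f x" for x
  proof (rule tendsto_eventually)
    obtain N where "\<bar>x\<bar> \<le> real N" using real_arch_simple by blast
    then show "\<forall>\<^sub>F n in sequentially. indicator {- real n..real n} x * f x = f x"
      by (intro eventually_sequentiallyI[of N]) (auto split: split_indicator)
  qed
  show "(\<lambda>x. indicator {-real n..real n} x * f x) \<in> borel_measurable borel" for n
    using locally_integrableD[OF assms, of "-real n" "real n"]
    by (auto simp: set_integrable_def dest: borel_measurable_integrable)
qed

lemma locally_integrable_add:
  "locally_integrable f \<Longrightarrow> locally_integrable g \<Longrightarrow> locally_integrable (\<lambda>x. f x + g x)"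
  by (auto simp: locally_integrable_def)

lemma locally_integrable_cmult: "locally_integrable f \<Longrightarrow> locally_integrable (\<lambda>x. c * f x)"
  by (auto simp: locally_integrable_def)

lemma locally_integrable_diff:
  "locally_integrable f \<Longrightarrow> locally_integrable g \<Longrightarrow> locally_integrable (\<lambda>x. f x - g x)"
  by (auto simp: locally_integrable_def)

lemma locally_integrable_reflect:
  assumes "locally_integrable f"
  shows "locally_integrable (\<lambda>x. f (- x))"
  unfolding locally_integrable_def set_integrable_def
proof (intro allI)
  fix a b :: real
  have "integrable lborel (\<lambda>x. indicator {-b..-a} x *\<^sub>R f x)"
    using locally_integrableD[OF assms] by (simp add: set_integrable_def)
  from lborel_integrable_real_affine[OF this, of "-1" 0]
  show "integrable lborel (\<lambda>x. indicator {a..b} x *\<^sub>R f (- x))"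
    by (rule back_subst[of "integrable lborel"]) (auto split: split_indicator)
qed

lemma locally_integrable_cont_mult:
  assumes "locally_integrable f" "continuous_on UNIV g"
  shows "locally_integrable (\<lambda>x. g x * f x)"
  unfolding locally_integrable_def set_integrable_def
proof (intro allI)
  fix a b :: real
  have [measurable]: "g \<in> borel_measurable borel" "f \<in> borel_measurable borel"
    using assms by (auto intro: borel_measurable_continuous_onI locally_integrable_borel)
  have "compact (g ` {a..b})"
    using assms(2) by (intro compact_continuous_image) (auto intro: continuous_on_subset)
  then obtain B where "\<forall>y\<in>g ` {a..b}. \<bar>y\<bar> \<le> B"
    by (auto dest!: compact_imp_bounded simp: bounded_iff)
  then have B: "\<And>x. x \<in> {a..b} \<Longrightarrow> \<bar>g x\<bar> \<le> B" by blast
  show "integrable lborel (\<lambda>x. indicator {a..b} x *\<^sub>R (g x * f x))"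
  proof (rule Bochner_Integration.integrable_bound)
    show "integrable lborel (\<lambda>x. B * (indicator {a..b} x *\<^sub>R f x))"
      using locally_integrableD[OF assms(1)] by (simp add: set_integrable_def)
    show "AE x in lborel. norm (indicator {a..b} x *\<^sub>R (g x * f x)) \<le> norm (B * (indicator {a..b} x *\<^sub>R f x))"
    proof (rule AE_I2)
      fix x
      show "norm (indicator {a..b} x *\<^sub>R (g x * f x)) \<le> norm (B * (indicator {a..b} x *\<^sub>R f x))"
      proof (cases "x \<in> {a..b}")
        case True
        with B[OF True] show ?thesis by (auto simp: abs_mult intro!: mult_right_mono)
      qed simp
    qed
  qed measurable
qed

lemma locally_integrable_continuous: "continuous_on UNIV f \<Longrightarrow> locally_integrable f"
  unfolding locally_integrable_def
  by (auto intro!: borel_integrable_atLeastAtMost' intro: continuous_on_subset)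

lemma acD:
  assumes "ac f f'"
  shows "locally_integrable f'" "a \<le> b \<Longrightarrow> f b - f a = (LINT x:{a..b}|lborel. f' x)"
  using assms by (auto simp: ac_def)

lemma ac_continuous:
  assumes "ac f f'"
  shows "continuous_on UNIV f"
proof -
  have "isCont f x" for x
  proof -
    have si: "set_integrable lborel {x-1..y} f'" for y
      using acD(1)[OF assms] by (rule locally_integrableD)
    have "continuous_on {x-1..x+1} (\<lambda>y. f (x-1) + integral {x-1..y} f')"
      by (intro continuous_intros indefinite_integral_continuous_1 set_borel_integral_eq_integral(1)[OF si])
    moreover have "f (x-1) + integral {x-1..y} f' = f y" if "y \<in> {x-1..x+1}" for y
      using acD(2)[OF assms, of "x-1" y] set_borel_integral_eq_integral(2)[OF si, of y] that by simp
    ultimately have "continuous_on {x-1..x+1} f"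
      by (rule continuous_on_eq)
    then show ?thesis
      by (rule continuous_on_interior) auto
  qed
  then show ?thesis by (simp add: continuous_at_imp_continuous_on)
qed

lemma ac_borel: "ac f f' \<Longrightarrow> f \<in> borel_measurable borel"
  by (intro borel_measurable_continuous_onI ac_continuous)

lemma ac_deriv_borel: "ac f f' \<Longrightarrow> f' \<in> borel_measurable borel"
  by (intro locally_integrable_borel acD)

lemma ac_const: "ac (\<lambda>_. c) (\<lambda>_. 0)"
  by (auto simp: ac_def locally_integrable_def set_integrable_def set_lebesgue_integral_def)

lemma ac_add:
  assumes "ac f f'" "ac g g'"
  shows "ac (\<lambda>x. f x + g x) (\<lambda>x. f' x + g' x)"
  unfolding ac_def
proof (intro conjI allI impI)
  fix a b :: real assume "a \<le> b"
  then show "f b + g b - (f a + g a) = (LINT x:{a..b}|lborel. f' x + g' x)"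
    using acD[OF assms(1)] acD[OF assms(2)]
    by (subst set_integral_add) (auto simp: locally_integrable_def algebra_simps)
qed (intro locally_integrable_add acD[OF assms(1)] acD[OF assms(2)])

lemma ac_cmult:
  assumes "ac f f'"
  shows "ac (\<lambda>x. c * f x) (\<lambda>x. c * f' x)"
  using acD[OF assms] by (auto simp: ac_def right_diff_distrib[symmetric] intro!: locally_integrable_cmult)

lemma ac_diff: "ac f f' \<Longrightarrow> ac g g' \<Longrightarrow> ac (\<lambda>x. f x - g x) (\<lambda>x. f' x - g' x)"
  using ac_add[of f f' "\<lambda>x. -1 * g x" "\<lambda>x. -1 * g' x"] ac_cmult[of g g' "-1"] by simp

lemma ac_reflect:
  assumes "ac f f'"
  shows "ac (\<lambda>x. f (- x)) (\<lambda>x. - f' (- x))"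
  unfolding ac_def
proof (intro conjI allI impI)
  show "locally_integrable (\<lambda>x. - f' (- x))"
    using locally_integrable_cmult[OF locally_integrable_reflect[OF acD(1)[OF assms]], of "-1"] by simp
  fix a b :: real assume "a \<le> b"
  have "(LINT x:{a..b}|lborel. - f' (- x)) = - (LINT x|lborel. indicator {-b..-a} (0 + (-1) * x) *\<^sub>R f' (0 + (-1) * x))"
    unfolding set_lebesgue_integral_def 
    by (subst integral_minus[symmetric], rule lint_cong) (auto split: split_indicator)
  also have "\<dots> = - (LINT x:{-b..-a}|lborel. f' x)"
    unfolding set_lebesgue_integral_def by (subst (2) lborel_integral_real_affine[of "-1" _ 0]) auto
  also have "\<dots> = f (- b) - f (- a)" using acD(2)[OF assms, of "-b" "-a"] \<open>a \<le> b\<close> by simp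
  finally show "f (- b) - f (- a) = (LINT x:{a..b}|lborel. - f' (- x))" by simp
qed

lemma ac_cong_AE:
  assumes "ac f f'" "g' \<in> borel_measurable borel" "AE x in lborel. f' x = g' x"
  shows "ac f g'"
proof -
  note [measurable] = assms(2) ac_deriv_borel[OF assms(1)]
  have "set_integrable lborel {a..b} g'" for a b
    using locally_integrableD[OF acD(1)[OF assms(1)], of a b] unfolding set_integrable_def
    by (rule integrable_cong_AE_imp) (use assms(3) in auto)
  moreover have "(LINT x:{a..b}|lborel. g' x) = (LINT x:{a..b}|lborel. f' x)" for a b
    unfolding set_lebesgue_integral_def by (intro integral_cong_AE) (use assms(3) in auto)
  ultimately show ?thesis
    using acD(2)[OF assms(1)] by (auto simp: ac_def locally_integrable_def)
qed

lemma ac_of_deriv: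
  assumes "\<And>x. (f has_real_derivative f' x) (at x)" "continuous_on UNIV f'"
  shows "ac f f'"
  unfolding ac_def
proof (intro conjI allI impI)
  fix a b :: real assume "a \<le> b"
  then show "f b - f a = (LINT x:{a..b}|lborel. f' x)"
    unfolding set_lebesgue_integral_def using assms
    by (subst integral_FTC_atLeastAtMost[of a b f])
       (auto intro: continuous_on_subset has_field_derivative_at_within simp: has_real_derivative_iff_has_vector_derivative[symmetric])
qed (intro locally_integrable_continuous assms)

text \<open>After truncation to a bounded interval, the positive and negative parts are densities of
  two finite measures that agree on all half lines, hence are equal. Equal densities mean that both
  parts coincide, which forces them to vanish.\<close>

lemma AE_zero_if_interval_integrals_zero:
  assumes "locally_integrable f" "\<And>a b. a \<le> b \<Longrightarrow> (LINT x:{a..b}|lborel. f x) = 0"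
  shows "AE x in lborel. f x = 0"
proof -
  note [measurable] = locally_integrable_borel[OF assms(1)]
  have *: "AE x in lborel. x \<in> {-real n..real n} \<longrightarrow> f x = 0" for n
  proof -
    define g where "g x = indicator {-real n..real n} x * f x" for x
    have g: "integrable lborel g"
      using locally_integrableD[OF assms(1), of "-real n" "real n"] by (simp add: g_def[abs_def] set_integrable_def)
    note [measurable] = borel_measurable_integrable[OF g]
    define M where "M = density lborel (\<lambda>x. ennreal (max 0 (g x)))"
    define N where "N = density lborel (\<lambda>x. ennreal (max 0 (- g x)))"
    have pos: "integrable lborel (\<lambda>x. indicator {t<..} x * max 0 (g x))"
         "integrable lborel (\<lambda>x. indicator {t<..} x * max 0 (- g x))" for t :: real
      by (intro Bochner_Integration.integrable_bound[OF g]; auto split: split_indicator)+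
    have M: "emeasure M {t<..} = ennreal (LINT x|lborel. indicator {t<..} x * max 0 (g x))" for t
      unfolding M_def using pos
      by (subst emeasure_density) (auto simp: nn_integral_eq_integral[symmetric] ennreal_mult' ennreal_indicator mult.commute intro!: nn_integral_cong split: split_indicator)
    have N: "emeasure N {t<..} = ennreal (LINT x|lborel. indicator {t<..} x * max 0 (- g x))" for t
      unfolding N_def using pos
      by (subst emeasure_density) (auto simp: nn_integral_eq_integral[symmetric] ennreal_mult' ennreal_indicator mult.commute intro!: nn_integral_cong split: split_indicator)
    have eq: "(LINT x|lborel. indicator {t<..} x * max 0 (g x)) = (LINT x|lborel. indicator {t<..} x * max 0 (- g x))" for t
    proof -
      have "(LINT x|lborel. indicator {t<..} x * max 0 (g x)) - (LINT x|lborel. indicator {t<..} x * max 0 (- g x))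
          = (LINT x|lborel. indicator {t<..} x * max 0 (g x) - indicator {t<..} x * max 0 (- g x))"
        by (rule Bochner_Integration.integral_diff[OF pos, symmetric])
      also have "\<dots> = (LINT x|lborel. indicator {t<..} x * g x)"
        by (intro lint_cong) (auto split: split_indicator)
      also have "\<dots> = (LINT x:{max t (-real n)..real n}|lborel. f x)"
        unfolding set_lebesgue_integral_def g_def
        by (intro integral_cong_AE) (use AE_lborel_singleton[of t] in \<open>auto elim!: eventually_mono split: split_indicator\<close>)
      also have "\<dots> = 0"
        using assms(2)[of "max t (-real n)" "real n"] by (cases "max t (-real n) \<le> real n") (auto simp: set_lebesgue_integral_def)
      finally show ?thesis by simp
    qed
    have "M = N"
      by (rule measure_eqI_lessThan) (auto simp: M N eq, auto simp: M_def N_def)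
    then have "AE x in lborel. ennreal (max 0 (g x)) = ennreal (max 0 (- g x))"
      unfolding M_def N_def by (intro sigma_finite_measure.density_unique[OF lborel.sigma_finite_measure_axioms]) auto
    then show ?thesis by eventually_elim (auto simp: g_def max_def split: if_splits)
  qed
  have "AE x in lborel. \<forall>n::nat. x \<in> {-real n..real n} \<longrightarrow> f x = 0"
    using * by (subst AE_all_countable) auto
  then show ?thesis
  proof eventually_elim
    case (elim x)
    obtain N where "\<bar>x\<bar> \<le> real N" using real_arch_simple by blast
    then show ?case using elim[rule_format, of N] by (auto simp: abs_le_iff)
  qed
qed

lemma ac_unique:
  assumes "ac f f'" "ac f g'"
  shows "AE x in lborel. f' x = g' x"
proof -
  have "AE x in lborel. f' x - g' x = 0"
    using acD[OF ac_diff[OF assms]] by (intro AE_zero_if_interval_integrals_zero) auto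
  then show ?thesis by simp
qed

text \<open>By Fubini. The product of the increments of \<open>f\<close> and \<open>g\<close> is the
  integral of f'(x) g'(y) over the square; splitting it along the diagonal into y <= x and x < y,
  and integrating the inner variable, gives the two terms of the product rule.\<close>

lemma ac_mult:
  assumes "ac f f'" "ac g g'"
  shows "ac (\<lambda>x. f x * g x) (\<lambda>x. f' x * g x + f x * g' x)"
  unfolding ac_def
proof (intro conjI allI impI)
  have li: "locally_integrable (\<lambda>x. f' x * g x)" "locally_integrable (\<lambda>x. f x * g' x)"
    using locally_integrable_cont_mult[OF acD(1)[OF assms(1)] ac_continuous[OF assms(2)]]
      locally_integrable_cont_mult[OF acD(1)[OF assms(2)] ac_continuous[OF assms(1)]]
    by (auto simp: mult.commute)
  then show "locally_integrable (\<lambda>x. f' x * g x + f x * g' x)" by (rule locally_integrable_add)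
  note [measurable] = ac_borel[OF assms(1)] ac_borel[OF assms(2)] ac_deriv_borel[OF assms(1)] ac_deriv_borel[OF assms(2)]
  fix a b :: real assume ab: "a \<le> b"
  define A where "A x = indicator {a..b} x * f' x" for x
  define B where "B x = indicator {a..b} x * g' x" for x
  have [measurable]: "A \<in> borel_measurable borel" "B \<in> borel_measurable borel"
    unfolding A_def B_def by measurable
  have A: "integrable lborel A" and B: "integrable lborel B"
    using locally_integrableD[OF acD(1)[OF assms(1)], of a b] locally_integrableD[OF acD(1)[OF assms(2)], of a b]
    by (simp_all add: A_def[abs_def] B_def[abs_def] set_integrable_def)
  have AB: "integrable (lborel \<Otimes>\<^sub>M lborel) (\<lambda>(x, y). A x * B y)"
  proof (rule lborel_pair.Fubini_integrable)
    show "integrable lborel (\<lambda>x. LINT y|lborel. norm (case (x, y) of (x, y) \<Rightarrow> A x * B y))"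
      using A by (simp add: abs_mult)
  qed (use B in auto)
  have AB1: "integrable (lborel \<Otimes>\<^sub>M lborel) (\<lambda>(x, y). A x * (indicator {..x} y * B y))"
    by (rule Bochner_Integration.integrable_bound[OF AB]) 
      (auto simp: case_prod_beta' indicator_def intro!: AE_I2)
  have AB2: "integrable (lborel \<Otimes>\<^sub>M lborel) (\<lambda>(x, y). (indicator {..<y} x * A x) * B y)"
    by (rule Bochner_Integration.integrable_bound[OF AB]) 
      (auto simp: case_prod_beta' indicator_def intro!: AE_I2)
  have fa: "(LINT x|lborel. indicator {..<y} x * A x) = f y - f a" if "y \<in> {a..b}" for y
  proof -
    have "(LINT x|lborel. indicator {..<y} x * A x) = (LINT x:{a..y}|lborel. f' x)"
      unfolding set_lebesgue_integral_def A_def using that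
      by (intro integral_cong_AE) (use AE_lborel_singleton[of y] in \<open>auto elim!: eventually_mono split: split_indicator\<close>)
    then show ?thesis using acD(2)[OF assms(1), of a y] that by simp
  qed
  have ga: "(LINT y|lborel. indicator {..x} y * B y) = g x - g a" if "x \<in> {a..b}" for x
  proof -
    have "(LINT y|lborel. indicator {..x} y * B y) = (LINT y:{a..x}|lborel. g' y)"
      unfolding set_lebesgue_integral_def B_def using that
      by (intro lint_cong) (auto split: split_indicator)
    then show ?thesis using acD(2)[OF assms(2), of a x] that by simp
  qed
  have i: "integrable lborel (\<lambda>x. indicator {a..b} x * (f' x * g x))" "integrable lborel (\<lambda>x. indicator {a..b} x * (f x * g' x))"
    using locally_integrableD[OF li(1), of a b] locally_integrableD[OF li(2), of a b] by (auto simp: set_integrable_def)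
  have IA: "(LINT x|lborel. A x) = f b - f a" and IB: "(LINT x|lborel. B x) = g b - g a"
    using acD(2)[OF assms(1) ab] acD(2)[OF assms(2) ab] by (auto simp: A_def B_def set_lebesgue_integral_def)
  have "(f b - f a) * (g b - g a) = (LINT x|lborel. LINT y|lborel. A x * B y)"
    by (simp add: IA IB)
  also have "\<dots> = (LINT z|(lborel \<Otimes>\<^sub>M lborel). (case z of (x, y) \<Rightarrow> A x * B y))"
    by (rule lborel_pair.integral_fst[OF AB])
  also have "\<dots> = (LINT z|(lborel \<Otimes>\<^sub>M lborel). (case z of (x, y) \<Rightarrow> A x * (indicator {..x} y * B y))
       + (case z of (x, y) \<Rightarrow> (indicator {..<y} x * A x) * B y))"
    by (intro lint_cong) (auto split: split_indicator)
  also have "\<dots> = (LINT z|(lborel \<Otimes>\<^sub>M lborel). (case z of (x, y) \<Rightarrow> A x * (indicator {..x} y * B y)))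
       + (LINT z|(lborel \<Otimes>\<^sub>M lborel). (case z of (x, y) \<Rightarrow> (indicator {..<y} x * A x) * B y))"
    by (rule Bochner_Integration.integral_add[OF AB1 AB2])
  also have "(LINT z|(lborel \<Otimes>\<^sub>M lborel). (case z of (x, y) \<Rightarrow> A x * (indicator {..x} y * B y)))
     = (LINT x|lborel. LINT y|lborel. A x * (indicator {..x} y * B y))"
    by (rule lborel_pair.integral_fst[OF AB1, symmetric])
  also have "\<dots> = (LINT x|lborel. A x * (g x - g a))"
  proof (rule lint_cong[OF refl])
    show "(LINT y|lborel. A x * (indicator {..x} y * B y)) = A x * (g x - g a)" for x
      using ga[of x] by (cases "x \<in> {a..b}") (auto simp: A_def)
  qed
  also have "(LINT z|(lborel \<Otimes>\<^sub>M lborel). (case z of (x, y) \<Rightarrow> (indicator {..<y} x * A x) * B y))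
     = (LINT y|lborel. LINT x|lborel. (indicator {..<y} x * A x) * B y)"
    by (rule lborel_pair.integral_snd[OF AB2, symmetric])
  also have "\<dots> = (LINT y|lborel. (f y - f a) * B y)"
  proof (rule lint_cong[OF refl])
    show "(LINT x|lborel. (indicator {..<y} x * A x) * B y) = (f y - f a) * B y" for y
      using fa[of y] by (cases "y \<in> {a..b}") (auto simp: B_def)
  qed
  also have "(LINT x|lborel. A x * (g x - g a)) = (LINT x|lborel. indicator {a..b} x * (f' x * g x) - g a * A x)"
    by (intro lint_cong) (auto simp: A_def algebra_simps)
  also have "\<dots> = (LINT x|lborel. indicator {a..b} x * (f' x * g x)) - g a * (f b - f a)"
    using A by (subst Bochner_Integration.integral_diff[OF i(1)]) (auto simp: IA)
  also have "(LINT y|lborel. (f y - f a) * B y) = (LINT x|lborel. indicator {a..b} x * (f x * g' x) - f a * B x)"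
    by (intro lint_cong) (auto simp: B_def algebra_simps)
  also have "\<dots> = (LINT x|lborel. indicator {a..b} x * (f x * g' x)) - f a * (g b - g a)"
    using B by (subst Bochner_Integration.integral_diff[OF i(2)]) (auto simp: IB)
  finally have "f b * g b - f a * g a = (LINT x|lborel. indicator {a..b} x * (f' x * g x)) + (LINT x|lborel. indicator {a..b} x * (f x * g' x))"
    by (simp add: algebra_simps)
  also have "\<dots> = (LINT x|lborel. indicator {a..b} x * (f' x * g x + f x * g' x))"
    using i by (subst Bochner_Integration.integral_add[symmetric]) (auto simp: algebra_simps)
  finally show "f b * g b - f a * g a = (LINT x:{a..b}|lborel. f' x * g x + f x * g' x)"
    by (simp add: set_lebesgue_integral_def)
qed

section \<open>The fundamental theorem of calculus on unbounded intervals\<close>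

lemma ac_integral_atLeast:
  assumes "ac q q'" "set_integrable lborel {a..} q'" "(q \<longlongrightarrow> l) at_top"
  shows "(LINT x:{a..}|lborel. q' x) = l - q a"
proof (rule tendsto_unique[of at_top])
  show "((\<lambda>b. LINT x:{a..b}|lborel. q' x) \<longlongrightarrow> (LINT x:{a..}|lborel. q' x)) at_top"
    by (rule tendsto_set_lebesgue_integral_at_top) (use assms in auto)
  have "((\<lambda>b. q b - q a) \<longlongrightarrow> l - q a) at_top" by (intro tendsto_intros assms)
  moreover have "\<forall>\<^sub>F b in at_top. q b - q a = (LINT x:{a..b}|lborel. q' x)"
    using acD(2)[OF assms(1)] by (intro eventually_at_top_linorderI[of a]) blast
  ultimately show "((\<lambda>b. LINT x:{a..b}|lborel. q' x) \<longlongrightarrow> l - q a) at_top"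
    by (rule Lim_transform_eventually)
qed simp

lemma ac_integral_UNIV:
  assumes "ac q q'" "integrable lborel q'" "(q \<longlongrightarrow> l) at_top" "(q \<longlongrightarrow> m) at_bot"
  shows "(LINT x|lborel. q' x) = l - m"
proof -
  have si: "set_integrable lborel A q'" if "A \<in> sets borel" for A
    using assms(2) that unfolding set_integrable_def by (intro integrable_mult_indicator) auto
  have 1: "(LINT x:{0..}|lborel. q' x) = l - q 0"
    by (rule ac_integral_atLeast[OF assms(1) si assms(3)]) auto
  have "(LINT x:{..0}|lborel. q' x) = q 0 - m"
  proof (rule tendsto_unique[of at_bot])
    show "((\<lambda>b. LINT x:{b..0}|lborel. q' x) \<longlongrightarrow> (LINT x:{..0}|lborel. q' x)) at_bot"
      by (rule tendsto_set_lebesgue_integral_at_bot) (use si in auto)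
    have "((\<lambda>b. q 0 - q b) \<longlongrightarrow> q 0 - m) at_bot" by (intro tendsto_intros assms)
    moreover have "\<forall>\<^sub>F b in at_bot. q 0 - q b = (LINT x:{b..0}|lborel. q' x)"
      using acD(2)[OF assms(1)] by (intro eventually_at_bot_linorderI[of 0]) blast
    ultimately show "((\<lambda>b. LINT x:{b..0}|lborel. q' x) \<longlongrightarrow> q 0 - m) at_bot"
      by (rule Lim_transform_eventually)
  qed simp
  moreover have "(LINT x|lborel. q' x) = (LINT x:{..0}|lborel. q' x) + (LINT x:{0..}|lborel. q' x)"
  proof -
    have "(LINT x|lborel. q' x) = (LINT x|lborel. indicator {..0} x * q' x + indicator {0..} x * q' x)"
    proof (rule integral_cong_AE)
      show "AE x in lborel. q' x = indicator {..0} x * q' x + indicator {0..} x * q' x"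
        using AE_lborel_singleton[of 0] by eventually_elim (auto split: split_indicator)
    qed (use borel_measurable_integrable[OF assms(2)] in measurable)
    also have "\<dots> = (LINT x:{..0}|lborel. q' x) + (LINT x:{0..}|lborel. q' x)"
      using si[of "{..0}"] si[of "{0..}"] by (simp add: set_integrable_def set_lebesgue_integral_def)
    finally show ?thesis .
  qed
  ultimately show ?thesis using 1 by simp
qed

text \<open>Integrability of the derivative makes the limit exist; a nonzero limit would contradict
  integrability of the function itself.\<close>

lemma ac_tendsto_0_at_top:
  assumes "ac q q'" "integrable lborel q'" "integrable lborel q"
  shows "(q \<longlongrightarrow> 0) at_top"
proof -
  have si: "set_integrable lborel A q'" if "A \<in> sets borel" for A
    using assms(2) that unfolding set_integrable_def by (intro integrable_mult_indicator) auto
  define l where "l = q 0 + (LINT x:{0..}|lborel. q' x)"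
  have "((\<lambda>b. q 0 + (LINT x:{0..b}|lborel. q' x)) \<longlongrightarrow> l) at_top"
    unfolding l_def by (intro tendsto_intros tendsto_set_lebesgue_integral_at_top si) auto
  moreover have "\<forall>\<^sub>F b in at_top. q 0 + (LINT x:{0..b}|lborel. q' x) = q b"
  proof (rule eventually_at_top_linorderI[of 0])
    show "q 0 + (LINT x:{0..b}|lborel. q' x) = q b" if "0 \<le> b" for b
      using acD(2)[OF assms(1) that] by simp
  qed
  ultimately have lim: "(q \<longlongrightarrow> l) at_top"
    by (rule Lim_transform_eventually)
  have "l = 0"
  proof (rule ccontr)
    assume "l \<noteq> 0"
    then have "\<forall>\<^sub>F x in at_top. dist (q x) l < \<bar>l\<bar> / 2"
      using lim by (auto dest!: tendstoD[of _ _ _ "\<bar>l\<bar>/2"])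
    then obtain c where c: "\<And>x. x \<ge> c \<Longrightarrow> dist (q x) l < \<bar>l\<bar> / 2"
      by (auto simp: eventually_at_top_linorder)
    have big: "\<bar>l\<bar> / 2 \<le> \<bar>q x\<bar>" if "x \<ge> c" for x
      using c[OF that] unfolding dist_real_def by linarith
    have bnd: "\<bar>l\<bar> / 2 * real n \<le> (LINT x|lborel. \<bar>q x\<bar>)" for n
    proof -
      have "\<bar>l\<bar> / 2 * real n = (LINT x|lborel. \<bar>l\<bar> / 2 * indicator {c..c+real n} x)"
        by simp
      also have "\<dots> \<le> (LINT x|lborel. \<bar>q x\<bar>)"
        using big assms(3) by (intro integral_mono) (auto split: split_indicator simp: integrable_real_indicator)
      finally show ?thesis .
    qed
    obtain n where "real n > (LINT x|lborel. \<bar>q x\<bar>) / (\<bar>l\<bar> / 2)"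
      using reals_Archimedean2 by blast
    then show False using bnd[of n] \<open>l \<noteq> 0\<close> by (simp add: field_simps)
  qed
  with lim show ?thesis by simp
qed

lemma ac_tendsto_0_at_bot:
  assumes "ac q q'" "integrable lborel q'" "integrable lborel q"
  shows "(q \<longlongrightarrow> 0) at_bot"
proof -
  have "((\<lambda>x. q (- x)) \<longlongrightarrow> 0) at_top"
    using assms lborel_integrable_real_affine[of q' "-1" 0] lborel_integrable_real_affine[of q "-1" 0]
    by (intro ac_tendsto_0_at_top[OF ac_reflect[OF assms(1)]]) auto
  then show ?thesis by (simp add: filterlim_at_bot_mirror)
qed

section \<open>Test functions and weak derivatives\<close>

definition smooth :: "(real \<Rightarrow> real) \<Rightarrow> bool" where
  "smooth f \<longleftrightarrow> (\<forall>k x. (deriv ^^ k) f field_differentiable (at x))"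

lemma test_fun_iff: "test_fun f \<longleftrightarrow> smooth f \<and> (\<exists>B. \<forall>x. \<bar>x\<bar> > B \<longrightarrow> f x = 0)"
  by (simp add: test_fun_def smooth_def)

text \<open>Smoothness by coinduction: in a family closed under differentiation every iterated
  derivative stays in the family, so no higher derivative has to be computed.\<close>

lemma smooth_coinduct:
  assumes "f \<in> F" and step: "\<And>f. f \<in> F \<Longrightarrow> \<exists>f'\<in>F. \<forall>x. (f has_real_derivative f' x) (at x)"
  shows "smooth f"
proof -
  have F: "(deriv ^^ k) f \<in> F" for k
  proof (induction k)
    case (Suc k)
    obtain f' where f': "f' \<in> F" "\<And>x. ((deriv ^^ k) f has_real_derivative f' x) (at x)"
      using step[OF Suc] by blast
    then have "deriv ((deriv ^^ k) f) = f'" by (intro ext DERIV_imp_deriv f'(2))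
    with f' show ?case by simp
  qed (simp add: assms)
  show ?thesis
    unfolding smooth_def field_differentiable_def using step[OF F] by blast
qed

lemma smooth_has_deriv: "smooth f \<Longrightarrow> (f has_real_derivative deriv f x) (at x)"
  unfolding smooth_def by (metis funpow_0 field_differentiable_derivI)

lemma smooth_deriv:
  assumes "smooth f"
  shows "smooth (deriv f)"
  unfolding smooth_def
proof (intro allI)
  fix k x
  show "(deriv ^^ k) (deriv f) field_differentiable at x"
    using assms[unfolded smooth_def, rule_format, of "Suc k" x] by (simp only: funpow_Suc_right o_apply)
qed

lemma smooth_continuous: "smooth f \<Longrightarrow> continuous_on UNIV f"
  using smooth_has_deriv by (auto intro!: continuous_at_imp_continuous_on DERIV_isCont)

lemma smooth_lincomb:
  assumes "smooth f" "smooth g"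
  shows "smooth (\<lambda>x. f x - c * g x)"
proof (rule smooth_coinduct[of _ "{\<lambda>x. f x - c * g x |f g. smooth f \<and> smooth g}"])
  fix h :: "real \<Rightarrow> real" assume "h \<in> {\<lambda>x. f x - c * g x |f g. smooth f \<and> smooth g}"
  then obtain f g where h: "h = (\<lambda>x. f x - c * g x)" "smooth f" "smooth g" by blast
  then have "\<forall>x. (h has_real_derivative deriv f x - c * deriv g x) (at x)"
    by (auto intro!: derivative_eq_intros smooth_has_deriv)
  then show "\<exists>h'\<in>{\<lambda>x. f x - c * g x |f g. smooth f \<and> smooth g}. \<forall>x. (h has_real_derivative h' x) (at x)"
    using h smooth_deriv by (intro bexI[of _ "\<lambda>x. deriv f x - c * deriv g x"]) auto
qed (use assms in auto)

lemma smooth_antiderivative: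
  assumes "smooth f" "\<And>x. (F has_real_derivative f x) (at x)"
  shows "smooth F"
  by (rule smooth_coinduct[of _ "insert F (Collect smooth)"])
    (use assms in \<open>auto intro: smooth_deriv smooth_has_deriv\<close>)

section \<open>Smooth compactly supported approximations of interval indicators\<close>

definition flat :: "real poly \<Rightarrow> real \<Rightarrow> real" where
  "flat p t = (if t > 0 then poly p (1 / t) * exp (- 1 / t) else 0)"

lemma poly_exp_tendsto_0: "((\<lambda>s. poly p s * exp (- s)) \<longlongrightarrow> 0) at_top" for p :: "real poly"
proof -
  have "((\<lambda>s. \<Sum>i\<le>degree p. coeff p i * (s ^ i / exp s)) \<longlongrightarrow> (\<Sum>i\<le>degree p. coeff p i * 0)) at_top"
    by (intro tendsto_intros tendsto_power_div_exp_0)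
  then show ?thesis
    by (simp add: poly_altdef exp_minus sum_distrib_right divide_inverse mult.assoc)
qed

text \<open>With s = 1/t, differentiating p(s) exp(-s) in t multiplies by s^2 and replaces p by p -
  p', so the family is closed under differentiation. At t = 0 the exponential beats every polynomial
  in 1/t.\<close>

lemma flat_has_deriv: "(flat p has_real_derivative flat ([:0, 0, 1:] * (p - pderiv p)) t) (at t)"
proof -
  consider "t > 0" | "t < 0" | "t = 0" by linarith
  then show ?thesis
  proof cases
    case 1
    have "((\<lambda>t. poly p (1 / t) * exp (- 1 / t)) has_real_derivative flat ([:0, 0, 1:] * (p - pderiv p)) t) (at t)"
      using 1 by (auto intro!: derivative_eq_intros DERIV_chain2[OF poly_DERIV] simp: flat_def field_simps power2_eq_square)
    then show ?thesis
      by (rule has_field_derivative_transform_within_open[of _ _ _ "{0<..}"]) (use 1 in \<open>auto simp: flat_def\<close>)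
  next
    case 2
    have "((\<lambda>t. 0) has_real_derivative flat ([:0, 0, 1:] * (p - pderiv p)) t) (at t)"
      using 2 by (auto simp: flat_def)
    then show ?thesis
      by (rule has_field_derivative_transform_within_open[of _ _ _ "{..<0}"]) (use 2 in \<open>auto simp: flat_def\<close>)
  next
    case 3
    have "((\<lambda>h. poly ([:0, 1:] * p) (inverse h) * exp (- inverse h)) \<longlongrightarrow> 0) (at_right 0)"
      by (rule filterlim_compose[OF poly_exp_tendsto_0 filterlim_inverse_at_top_right])
    then have "((\<lambda>h. (flat p (0 + h) - flat p 0) / h) \<longlongrightarrow> 0) (at_right 0)"
      by (rule Lim_transform_eventually)
         (auto simp: flat_def field_simps eventually_at_right_less intro!: eventually_mono[OF eventually_at_right_less])
    moreover have "((\<lambda>h. (flat p (0 + h) - flat p 0) / h) \<longlongrightarrow> 0) (at_left 0)"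
    proof (rule Lim_transform_eventually[of "\<lambda>_. 0"])
      show "\<forall>\<^sub>F h in at_left 0. 0 = (flat p (0 + h) - flat p 0) / h"
        by (auto simp: flat_def eventually_at_left_field intro: exI[of _ "-1"])
    qed simp
    ultimately have "((\<lambda>h. (flat p (0 + h) - flat p 0) / h) \<longlongrightarrow> 0) (at 0)"
      by (simp add: filterlim_at_split)
    then show ?thesis using 3 by (simp add: DERIV_def flat_def)
  qed
qed

text \<open>The closure under sums and products that makes \<open>smooth_coinduct\<close> applicable
  to products of two flat functions, since the product rule stays inside.\<close>

inductive_set flat_alg :: "(real \<Rightarrow> real) set" where
  flat: "(\<lambda>x. flat p (a + c * x)) \<in> flat_alg"
| add: "f \<in> flat_alg \<Longrightarrow> g \<in> flat_alg \<Longrightarrow> (\<lambda>x. f x + g x) \<in> flat_alg"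
| mult: "f \<in> flat_alg \<Longrightarrow> g \<in> flat_alg \<Longrightarrow> (\<lambda>x. f x * g x) \<in> flat_alg"

lemma flat_smult: "flat (smult c p) t = c * flat p t"
  by (simp add: flat_def)

lemma smooth_flat_alg: "f \<in> flat_alg \<Longrightarrow> smooth f"
proof (erule smooth_coinduct)
  fix f assume "f \<in> flat_alg"
  then show "\<exists>f'\<in>flat_alg. \<forall>x. (f has_real_derivative f' x) (at x)"
  proof induction
    case (flat p a c)
    have "((\<lambda>x. flat p (a + c * x)) has_real_derivative flat (smult c ([:0, 0, 1:] * (p - pderiv p))) (a + c * x)) (at x)" for x
      unfolding flat_smult mult.commute[of c] by (rule DERIV_chain2[OF flat_has_deriv]) (auto intro!: derivative_eq_intros)
    with flat_alg.flat[of _ a c] show ?case by (intro bexI) auto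
  next
    case (add f g)
    then obtain f' g' where "f' \<in> flat_alg" "g' \<in> flat_alg"
      "\<And>x. (f has_real_derivative f' x) (at x)" "\<And>x. (g has_real_derivative g' x) (at x)" by blast
    then show ?case
      by (intro bexI[of _ "\<lambda>x. f' x + g' x"]) (auto intro!: DERIV_add flat_alg.add)
  next
    case (mult f g)
    then obtain f' g' where "f' \<in> flat_alg" "g' \<in> flat_alg"
      "\<And>x. (f has_real_derivative f' x) (at x)" "\<And>x. (g has_real_derivative g' x) (at x)" by blast
    with mult show ?case
      by (intro bexI[of _ "\<lambda>x. f' x * g x + g' x * f x"]) (auto intro!: DERIV_mult flat_alg.intros)
  qed
qed

text \<open>The factor \<open>n\<close> steepens both edges: as n grows the bump tends to 1 inside
  the interval while staying below its indicator, which suits dominated convergence.\<close>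

definition bump :: "real \<Rightarrow> real \<Rightarrow> nat \<Rightarrow> real \<Rightarrow> real" where
  "bump a b n x = flat 1 (real n * (x - a)) * flat 1 (real n * (b - x))"

lemma test_fun_bump: "test_fun (bump a b n)"
proof -
  have "(\<lambda>x. flat 1 (- real n * a + real n * x) * flat 1 (real n * b + (- real n) * x)) \<in> flat_alg"
    by (intro flat_alg.intros)
  also have "(\<lambda>x. flat 1 (- real n * a + real n * x) * flat 1 (real n * b + (- real n) * x)) = bump a b n"
    by (simp add: bump_def[abs_def] algebra_simps)
  finally have "smooth (bump a b n)" by (rule smooth_flat_alg)
  moreover have "bump a b n x = 0" if "\<bar>x\<bar> > max \<bar>a\<bar> \<bar>b\<bar>" for x
  proof -
    have "x - a \<le> 0 \<or> b - x \<le> 0" using that by linarith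
    then show ?thesis
      by (auto simp: bump_def flat_def mult_nonneg_nonpos zero_less_mult_iff)
  qed
  ultimately show ?thesis unfolding test_fun_iff by blast
qed

lemma bump_bounds: "0 \<le> bump a b n x" "bump a b n x \<le> indicator {a..b} x"
proof -
  have *: "0 \<le> flat 1 t" "flat 1 t \<le> 1" for t by (auto simp: flat_def)
  then show "0 \<le> bump a b n x" by (simp add: bump_def)
  show "bump a b n x \<le> indicator {a..b} x"
  proof (cases "x \<in> {a..b}")
    case True
    then show ?thesis using mult_le_one[OF *(2) *(1) *(2)] by (simp add: bump_def)
  next
    case False
    then show ?thesis by (auto simp: bump_def flat_def zero_less_mult_iff)
  qed
qed

lemma bump_tendsto:
  assumes "a < x" "x < b"
  shows "(\<lambda>n. bump a b n x) \<longlonglongrightarrow> 1"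
proof -
  have *: "(\<lambda>n. flat 1 (real n * t)) \<longlonglongrightarrow> 1" if "t > 0" for t
  proof -
    have "(\<lambda>n. exp (- (1 / t) * (1 / real n))) \<longlonglongrightarrow> exp (- (1 / t) * 0)"
      by (intro tendsto_intros lim_1_over_n)
    then have "(\<lambda>n. exp (- (1 / t) * (1 / real n))) \<longlonglongrightarrow> 1" by simp
    moreover have "\<forall>\<^sub>F n in sequentially. exp (- (1 / t) * (1 / real n)) = flat 1 (real n * t)"
      using that by (intro eventually_sequentiallyI[of 1]) (auto simp: flat_def zero_less_mult_iff field_simps)
    ultimately show ?thesis by (rule Lim_transform_eventually)
  qed
  have "(\<lambda>n. bump a b n x) \<longlonglongrightarrow> 1 * 1"
    unfolding bump_def using assms by (intro tendsto_mult *) auto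
  then show ?thesis by simp
qed

lemma bump_integral_tendsto:
  assumes "locally_integrable F"
  shows "(\<lambda>n. LINT x|lborel. F x * bump a b n x) \<longlonglongrightarrow> (LINT x:{a..b}|lborel. F x)"
  unfolding set_lebesgue_integral_def
proof (rule integral_dominated_convergence)
  note [measurable] = locally_integrable_borel[OF assms]
  have [measurable]: "bump a b n \<in> borel_measurable borel" for n
    using test_fun_bump[of a b n] by (auto simp: test_fun_iff intro: borel_measurable_continuous_onI smooth_continuous)
  show "(\<lambda>x. indicator {a..b} x *\<^sub>R F x) \<in> borel_measurable lborel" by measurable
  show "(\<lambda>x. F x * bump a b n x) \<in> borel_measurable lborel" for n by measurable
  show "integrable lborel (\<lambda>x. \<bar>indicator {a..b} x *\<^sub>R F x\<bar>)"
    using locally_integrableD[OF assms] by (intro integrable_abs) (simp add: set_integrable_def)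
  show "AE x in lborel. (\<lambda>n. F x * bump a b n x) \<longlonglongrightarrow> indicator {a..b} x *\<^sub>R F x"
    using AE_lborel_singleton[of a] AE_lborel_singleton[of b]
  proof eventually_elim
    case (elim x)
    show ?case
    proof (cases "a < x \<and> x < b")
      case True
      then have "(\<lambda>n. F x * bump a b n x) \<longlonglongrightarrow> F x * 1" by (intro tendsto_intros bump_tendsto) auto
      with True show ?thesis by simp
    next
      case False
      with elim have "x \<notin> {a..b}" by auto
      then have "bump a b n x = 0" for n using bump_bounds[of a b n x] by simp
      with \<open>x \<notin> {a..b}\<close> show ?thesis by simp
    qed
  qed
  show "AE x in lborel. norm (F x * bump a b n x) \<le> \<bar>indicator {a..b} x *\<^sub>R F x\<bar>" for n
  proof (rule AE_I2)
    fix x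
    have "\<bar>F x\<bar> * bump a b n x \<le> \<bar>F x\<bar> * indicator {a..b} x"
      using bump_bounds[of a b n x] by (intro mult_left_mono) auto
    then show "norm (F x * bump a b n x) \<le> \<bar>indicator {a..b} x *\<^sub>R F x\<bar>"
      using bump_bounds(1)[of a b n x] by (simp add: abs_mult mult.commute)
  qed
qed

section \<open>Weak derivatives and absolutely continuous primitives\<close>

lemma fundamental_lemma:
  assumes "locally_integrable F" "\<And>\<phi>. test_fun \<phi> \<Longrightarrow> ip F \<phi> = 0"
  shows "AE x in lborel. F x = 0"
proof (rule AE_zero_if_interval_integrals_zero[OF assms(1)])
  show "(LINT x:{a..b}|lborel. F x) = 0" for a b
    using bump_integral_tendsto[OF assms(1), of a b] assms(2)[OF test_fun_bump] by (simp add: LIMSEQ_const_iff)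
qed

lemma integrable_loc_int_compact:
  assumes "locally_integrable F" "continuous_on UNIV \<phi>" "\<And>x. \<bar>x\<bar> > B \<Longrightarrow> \<phi> x = 0"
  shows "integrable lborel (\<lambda>x. F x * \<phi> x)"
    "(LINT x:{-B..B}|lborel. F x * \<phi> x) = ip F \<phi>"
proof -
  have eq: "indicator {-B..B} x *\<^sub>R (\<phi> x * F x) = F x * \<phi> x" for x
    using assms(3)[of x] by (auto split: split_indicator simp: abs_if)
  show "integrable lborel (\<lambda>x. F x * \<phi> x)"
    using locally_integrableD[OF locally_integrable_cont_mult[OF assms(1,2)], of "-B" B]
    by (simp only: eq set_integrable_def)
  show "(LINT x:{-B..B}|lborel. F x * \<phi> x) = ip F \<phi>"
    using eq unfolding set_lebesgue_integral_def by (simp only: mult.commute)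
qed

lemma test_fun_deriv:
  assumes "test_fun \<phi>"
  shows "test_fun (deriv \<phi>)"
proof -
  obtain B where B: "\<And>x. \<bar>x\<bar> > B \<Longrightarrow> \<phi> x = 0" using assms by (auto simp: test_fun_def)
  have "deriv \<phi> x = 0" if "\<bar>x\<bar> > B" for x
  proof -
    have "((\<lambda>_. 0) has_real_derivative deriv \<phi> x) (at x)"
      by (rule has_field_derivative_transform_within_open[of \<phi> _ _ "{x. \<bar>x\<bar> > B}"])
        (use assms B that in \<open>auto intro!: smooth_has_deriv open_Collect_less continuous_intros simp: test_fun_iff\<close>)
    then show ?thesis using DERIV_const DERIV_unique by blast
  qed
  with assms show ?thesis by (auto simp: test_fun_iff intro: smooth_deriv)
qed

lemma ac_has_weak_deriv:
  assumes "ac f g"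
  shows "has_weak_deriv f g"
  unfolding has_weak_deriv_def
proof (intro conjI allI impI)
  show f: "locally_integrable f" by (intro locally_integrable_continuous ac_continuous[OF assms])
  show g: "locally_integrable g" by (rule acD[OF assms])
  fix \<phi> assume "test_fun \<phi>"
  then obtain B0 where sm: "smooth \<phi>" and B0: "\<And>x. \<bar>x\<bar> > B0 \<Longrightarrow> \<phi> x = 0" by (auto simp: test_fun_iff)
  obtain B1 where sm': "smooth (deriv \<phi>)" and B1: "\<And>x. \<bar>x\<bar> > B1 \<Longrightarrow> deriv \<phi> x = 0"
    using test_fun_deriv[OF \<open>test_fun \<phi>\<close>] by (auto simp: test_fun_iff)
  define B where "B = max 0 (max B0 B1) + 1"
  have B: "\<phi> x = 0" "deriv \<phi> x = 0" if "\<bar>x\<bar> \<ge> B" for x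
    using B0[of x] B1[of x] that by (auto simp: B_def)
  note i1 = integrable_loc_int_compact[OF g smooth_continuous[OF sm], of B]
  note i2 = integrable_loc_int_compact[OF f smooth_continuous[OF sm'], of B]
  have "ac \<phi> (deriv \<phi>)" by (intro ac_of_deriv smooth_has_deriv sm smooth_continuous sm')
  moreover have "B \<ge> 0" by (simp add: B_def)
  ultimately have "0 = (LINT x:{-B..B}|lborel. g x * \<phi> x + f x * deriv \<phi> x)"
    using acD(2)[OF ac_mult[OF assms], of \<phi> "deriv \<phi>" "-B" B] B(1)[of B] B(1)[of "-B"] by simp
  also have "\<dots> = (LINT x|lborel. g x * \<phi> x + f x * deriv \<phi> x)"
    unfolding set_lebesgue_integral_def
  proof (intro lint_cong refl)
    fix x
    have "x \<notin> {-B..B} \<Longrightarrow> \<bar>x\<bar> \<ge> B" by auto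
    then show "indicator {-B..B} x *\<^sub>R (g x * \<phi> x + f x * deriv \<phi> x) = g x * \<phi> x + f x * deriv \<phi> x"
      using B[of x] by (cases "x \<in> {-B..B}") auto
  qed
  also have "\<dots> = ip g \<phi> + (LINT x|lborel. f x * deriv \<phi> x)"
    by (intro Bochner_Integration.integral_add i1(1) i2(1) B) simp_all
  finally show "(LINT x|lborel. f x * deriv \<phi> x) = - ip g \<phi>" by simp
qed

text \<open>A test function of mean zero is the derivative of a test function. Subtracting the right
  multiple of one fixed bump \<open>\<theta>\<close> gives any \<phi> mean zero, and the price of
  this correction is the constant c.\<close>

lemma du_bois_reymond:
  assumes F: "locally_integrable F" and zero: "\<And>\<phi>. test_fun \<phi> \<Longrightarrow> (LINT x|lborel. F x * deriv \<phi> x) = 0"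
  shows "\<exists>c. AE x in lborel. F x = c"
proof -
  have one: "locally_integrable (\<lambda>_. 1)" by (intro locally_integrable_continuous continuous_intros)
  have "(\<lambda>n. LINT x|lborel. 1 * bump 0 1 n x) \<longlonglongrightarrow> (LINT x:{0..1::real}|lborel. 1 :: real)"
    by (rule bump_integral_tendsto[OF one])
  also have "(LINT x:{0..1::real}|lborel. 1 :: real) = 1" by (simp add: set_lebesgue_integral_def)
  finally have "\<forall>\<^sub>F n in sequentially. (LINT x|lborel. 1 * bump 0 1 n x) > 0"
    by (rule order_tendstoD) simp
  then obtain n where n: "(LINT x|lborel. bump 0 1 n x) > 0" by (auto simp: eventually_sequentially)
  define \<theta> where "\<theta> = bump 0 1 n"
  define k where "k = (LINT x|lborel. \<theta> x)"
  have k: "k > 0" using n by (simp add: k_def \<theta>_def)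
  define c where "c = ip F \<theta> / k"
  have \<theta>: "test_fun \<theta>" by (simp add: \<theta>_def test_fun_bump)
  have int: "integrable lborel (\<lambda>x. G x * \<phi> x)" if "locally_integrable G" "test_fun \<phi>" for G \<phi>
    using that integrable_loc_int_compact(1)[OF that(1) smooth_continuous] by (auto simp: test_fun_iff)
  have int1: "integrable lborel \<phi>" if "test_fun \<phi>" for \<phi>
    using int[OF one that] by simp
  have "AE x in lborel. F x - c = 0"
  proof (rule fundamental_lemma)
    show Fc: "locally_integrable (\<lambda>x. F x - c)"
      using locally_integrable_diff[OF F locally_integrable_cmult[OF one, of c]] by simp
    fix \<phi> assume \<phi>: "test_fun \<phi>"
    define m where "m = (LINT x|lborel. \<phi> x) / k"
    define \<zeta> where "\<zeta> x = \<phi> x - m * \<theta> x" for x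
    obtain B1 B2 where sm: "smooth \<phi>" "smooth \<theta>" and B: "\<And>x. \<bar>x\<bar> > B1 \<Longrightarrow> \<phi> x = 0" "\<And>x. \<bar>x\<bar> > B2 \<Longrightarrow> \<theta> x = 0"
      using \<phi> \<theta> by (auto simp: test_fun_iff)
    have sm\<zeta>: "smooth \<zeta>" unfolding \<zeta>_def[abs_def] by (rule smooth_lincomb[OF sm])
    define B where "B = max 0 (max B1 B2)"
    have B\<zeta>: "\<zeta> x = 0" if "\<bar>x\<bar> > B" for x using B that by (auto simp: \<zeta>_def B_def)
    have \<zeta>0: "(LINT x|lborel. \<zeta> x) = 0"
      unfolding \<zeta>_def using int1[OF \<phi>] int1[OF \<theta>] k by (simp add: m_def k_def[symmetric])
    obtain G where G: "\<And>x. (G has_vector_derivative \<zeta> x) (at x)"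
      using einterval_antiderivative[of "-\<infinity>" "\<infinity>" \<zeta>] smooth_continuous[OF sm\<zeta>]
      by (auto simp: continuous_on_eq_continuous_at)
    define H where "H x = G x - G (- B - 1)" for x
    have H: "(H has_real_derivative \<zeta> x) (at x)" for x
      unfolding H_def has_real_derivative_iff_has_vector_derivative
      using G[of x] by (auto intro!: derivative_eq_intros)
    have acH: "ac H \<zeta>" by (intro ac_of_deriv H smooth_continuous sm\<zeta>)
    \<comment> \<open>To the left of the support this is the normalization of \<open>H\<close>; to
      the right it is the vanishing mean of \<zeta>.\<close>
    have "H x = 0" if x: "\<bar>x\<bar> > B + 1" for x
    proof (cases "x < 0")
      case True
      have "H (- B - 1) - H x = (LINT y:{x..-B-1}|lborel. \<zeta> y)"
        using acD(2)[OF acH, of x "-B-1"] x True by simp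
      also have "\<dots> = (LINT y::real|lborel. 0)"
        unfolding set_lebesgue_integral_def
      proof (intro lint_cong refl)
        fix y
        have "y \<in> {x..-B-1} \<Longrightarrow> \<bar>y\<bar> > B" by auto
        then show "indicator {x..-B-1} y *\<^sub>R \<zeta> y = 0" using B\<zeta>[of y] by (auto split: split_indicator)
      qed
      finally show ?thesis by (simp add: H_def)
    next
      case False
      have "H x - H (- B - 1) = (LINT y:{-B-1..x}|lborel. \<zeta> y)"
        using acD(2)[OF acH, of "-B-1" x] x False by (simp add: B_def)
      also have "\<dots> = (LINT y|lborel. \<zeta> y)"
        unfolding set_lebesgue_integral_def
      proof (intro lint_cong refl)
        fix y
        have "y \<notin> {-B-1..x} \<Longrightarrow> \<bar>y\<bar> > B" using x False by auto
        then show "indicator {-B-1..x} y *\<^sub>R \<zeta> y = \<zeta> y" using B\<zeta>[of y] by (auto split: split_indicator)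
      qed
      finally show ?thesis by (simp add: H_def \<zeta>0)
    qed
    then have "test_fun H"
      using smooth_antiderivative[OF sm\<zeta> H] by (auto simp: test_fun_iff)
    moreover have "deriv H = \<zeta>" by (intro ext DERIV_imp_deriv H)
    ultimately have "ip F \<zeta> = 0" using zero by auto
    also have "ip F \<zeta> = (LINT x|lborel. F x * \<phi> x - m * (F x * \<theta> x))"
      by (simp add: \<zeta>_def algebra_simps)
    also have "\<dots> = ip F \<phi> - m * ip F \<theta>"
      using int[OF F \<phi>] int[OF F \<theta>] by simp
    finally have "ip F \<phi> = c * (LINT x|lborel. \<phi> x)"
      by (simp add: m_def c_def)
    moreover have "(LINT x|lborel. (F x - c) * \<phi> x) = ip F \<phi> - c * (LINT x|lborel. \<phi> x)"
      using int[OF F \<phi>] int1[OF \<phi>] by (simp add: left_diff_distrib)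
    ultimately show "(LINT x|lborel. (F x - c) * \<phi> x) = 0" by simp
  qed
  then show ?thesis by auto
qed

lemma ac_exists:
  assumes "locally_integrable g"
  shows "\<exists>f. ac f g"
proof -
  define f where "f x = (if x \<ge> 0 then LINT y:{0..x}|lborel. g y else - (LINT y:{x..0}|lborel. g y))" for x
  note si = locally_integrableD[OF assms]
  have comb: "(LINT y:{a..c}|lborel. g y) = (LINT y:{a..b}|lborel. g y) + (LINT y:{b..c}|lborel. g y)"
    if "a \<le> b" "b \<le> c" for a b c
    using Henstock_Kurzweil_Integration.integral_combine[OF that set_borel_integral_eq_integral(1)[OF si]]
    by (simp add: set_borel_integral_eq_integral(2)[OF si])
  have "ac f g"
    unfolding ac_def
  proof (intro conjI allI impI assms)
    fix a b :: real assume "a \<le> b"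
    then show "f b - f a = (LINT x:{a..b}|lborel. g x)"
      using comb[of 0 a b] comb[of a 0 b] comb[of a b 0] by (auto simp: f_def)
  qed
  then show ?thesis by blast
qed

text \<open>A primitive \<open>f1\<close> of \<open>g\<close> exists, and f - f1 has weak derivative
  zero, so it is almost everywhere a constant. This is the passage from distributions to pointwise
  calculus.\<close>

lemma has_weak_deriv_ac:
  assumes "has_weak_deriv f g"
  shows "\<exists>f0. ac f0 g \<and> (AE x in lborel. f x = f0 x)"
proof -
  have f: "locally_integrable f" and g: "locally_integrable g" using assms by (auto simp: has_weak_deriv_def)
  obtain f1 where f1: "ac f1 g" using ac_exists[OF g] by blast
  have f1l: "locally_integrable f1" by (intro locally_integrable_continuous ac_continuous[OF f1])
  have "\<exists>c. AE x in lborel. f x - f1 x = c"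
  proof (rule du_bois_reymond)
    show "locally_integrable (\<lambda>x. f x - f1 x)" by (rule locally_integrable_diff[OF f f1l])
    fix \<phi> assume \<phi>: "test_fun \<phi>"
    have int: "integrable lborel (\<lambda>x. G x * deriv \<phi> x)" if "locally_integrable G" for G
      using integrable_loc_int_compact(1)[OF that smooth_continuous] test_fun_deriv[OF \<phi>] by (auto simp: test_fun_iff)
    have "(LINT x|lborel. (f x - f1 x) * deriv \<phi> x) = (LINT x|lborel. f x * deriv \<phi> x) - (LINT x|lborel. f1 x * deriv \<phi> x)"
      using int[OF f] int[OF f1l] by (simp add: left_diff_distrib)
    then show "(LINT x|lborel. (f x - f1 x) * deriv \<phi> x) = 0"
      using assms ac_has_weak_deriv[OF f1] \<phi> by (auto simp: has_weak_deriv_def)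
  qed
  then obtain c where "AE x in lborel. f x = f1 x + c" by (auto simp: algebra_simps)
  moreover have "ac (\<lambda>x. f1 x + c) g" using ac_add[OF f1 ac_const[of c]] by simp
  ultimately show ?thesis by blast
qed

lemma AE_eq_continuous:
  fixes f g :: "real \<Rightarrow> real"
  assumes "continuous_on UNIV f" "continuous_on UNIV g" "AE x in lborel. f x = g x"
  shows "f = g"
proof (rule ccontr)
  assume "f \<noteq> g"
  then obtain x where x: "f x \<noteq> g x" by auto
  have "open {x. f x \<noteq> g x}" using assms by (intro open_Collect_neq)
  then obtain e where e: "e > 0" "ball x e \<subseteq> {x. f x \<noteq> g x}" using x by (auto simp: open_contains_ball)
  have "AE y in lborel. y \<notin> ball x e" using assms(3) by eventually_elim (use e in auto)
  then have "emeasure lborel (ball x e) = 0" by (subst (asm) AE_iff_measurable[of "ball x e"]) auto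
  then show False using e by (simp add: ball_eq_greaterThanLessThan)
qed

lemma ac_cong_has_weak_deriv:
  assumes "ac f0 g" "f \<in> borel_measurable borel" "AE x in lborel. f x = f0 x"
  shows "has_weak_deriv f g"
proof -
  note [measurable] = assms(2) ac_borel[OF assms(1)]
  have w: "has_weak_deriv f0 g" by (rule ac_has_weak_deriv[OF assms(1)])
  have "set_integrable lborel {a..b} f" for a b
  proof -
    have "integrable lborel (\<lambda>x. indicator {a..b} x *\<^sub>R f0 x)"
      using w locally_integrableD[of f0 a b] by (auto simp: has_weak_deriv_def set_integrable_def)
    then show ?thesis
      unfolding set_integrable_def by (rule integrable_cong_AE_imp) (use assms(3) in auto)
  qed
  moreover have "(LINT x|lborel. f x * deriv \<phi> x) = (LINT x|lborel. f0 x * deriv \<phi> x)" if "test_fun \<phi>" for \<phi>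
  proof -
    have [measurable]: "deriv \<phi> \<in> borel_measurable borel"
      using test_fun_deriv[OF that] by (auto simp: test_fun_iff intro: borel_measurable_continuous_onI smooth_continuous)
    show ?thesis by (rule integral_cong_AE) (use assms(3) in auto)
  qed
  ultimately show ?thesis using w by (auto simp: has_weak_deriv_def locally_integrable_def)
qed

lemma has_weak_deriv_unique:
  assumes "has_weak_deriv f g" "has_weak_deriv f h"
  shows "AE x in lborel. g x = h x"
proof -
  obtain f0 f1 where f: "ac f0 g" "AE x in lborel. f x = f0 x" "ac f1 h" "AE x in lborel. f x = f1 x"
    using assms[THEN has_weak_deriv_ac] by blast
  have "AE x in lborel. f0 x = f1 x" using f(2,4) by eventually_elim simp
  then have "f0 = f1" by (intro AE_eq_continuous ac_continuous[OF f(1)] ac_continuous[OF f(3)])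
  with f show ?thesis using ac_unique by blast
qed

section \<open>The Sobolev space in terms of absolutely continuous representatives\<close>

text \<open>An element of H^1 as its continuous representative together with a chosen derivative.
  This avoids the choice operator in \<open>weak_deriv\<close>; \<open>H1_representative\<close> and
  \<open>h1p_imp_H1\<close> translate back and forth.\<close>

definition h1p :: "(real \<Rightarrow> real) \<Rightarrow> (real \<Rightarrow> real) \<Rightarrow> bool" where
  "h1p f f' \<longleftrightarrow> f \<in> L2 \<and> f' \<in> L2 \<and> ac f f'"

lemma h1pD: "h1p f f' \<Longrightarrow> f \<in> L2" "h1p f f' \<Longrightarrow> f' \<in> L2" "h1p f f' \<Longrightarrow> ac f f'"
  by (auto simp: h1p_def)

lemma h1p_diff: "h1p f f' \<Longrightarrow> h1p g g' \<Longrightarrow> h1p (\<lambda>x. f x - g x) (\<lambda>x. f' x - g' x)"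
  by (auto simp: h1p_def intro: L2_diff ac_diff)

lemma h1p_cmult: "h1p f f' \<Longrightarrow> h1p (\<lambda>x. c * f x) (\<lambda>x. c * f' x)"
  by (auto simp: h1p_def intro: L2_cmult ac_cmult)

lemma h1p_reflect: "h1p f f' \<Longrightarrow> h1p (\<lambda>x. f (- x)) (\<lambda>x. - f' (- x))"
  by (auto simp: h1p_def intro: L2_reflect ac_reflect L2_uminus)

lemma H1_representative:
  assumes "f \<in> H1"
  obtains f0 f' where "h1p f0 f'" "AE x in lborel. f x = f0 x"
proof -
  obtain g where g: "f \<in> L2" "g \<in> L2" "has_weak_deriv f g" using assms by (auto simp: H1_def)
  obtain f0 where f0: "ac f0 g" "AE x in lborel. f x = f0 x" using has_weak_deriv_ac[OF g(3)] by blast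
  have "f0 \<in> L2" using f0 by (intro L2_cong_AE[OF g(1)] ac_borel)
  with g f0 that show ?thesis by (auto simp: h1p_def)
qed

lemma h1p_imp_H1:
  assumes "h1p f0 f'" "f \<in> borel_measurable borel" "AE x in lborel. f x = f0 x"
  shows "f \<in> H1" "(h1_norm f)\<^sup>2 = (l2_norm f0)\<^sup>2 + (l2_norm f')\<^sup>2"
proof -
  have w: "has_weak_deriv f f'" by (rule ac_cong_has_weak_deriv[OF h1pD(3)[OF assms(1)] assms(2,3)])
  have eq: "AE x in lborel. f0 x = f x" using assms(3) by eventually_elim simp
  have "f \<in> L2" by (rule L2_cong_AE[OF h1pD(1)[OF assms(1)] assms(2) eq])
  with w h1pD(2)[OF assms(1)] show "f \<in> H1" by (auto simp: H1_def)
  have wd: "weak_deriv f \<in> L2 \<and> has_weak_deriv f (weak_deriv f)"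
    unfolding weak_deriv_def by (rule someI[of _ f']) (use w h1pD(2)[OF assms(1)] in auto)
  have "l2_norm (weak_deriv f) = l2_norm f'"
    using wd w h1pD(2)[OF assms(1)] has_weak_deriv_unique by (intro l2_norm_cong_AE) (auto dest: L2D)
  moreover have "l2_norm f = l2_norm f0"
    using assms h1pD(1)[OF assms(1)] by (intro l2_norm_cong_AE) (auto dest: L2D)
  ultimately show "(h1_norm f)\<^sup>2 = (l2_norm f0)\<^sup>2 + (l2_norm f')\<^sup>2"
    by (simp add: h1_norm_def)
qed

lemma integrable_set_integrable: "integrable lborel f \<Longrightarrow> A \<in> sets borel \<Longrightarrow> set_integrable lborel A f"
  for f :: "real \<Rightarrow> real"
  unfolding set_integrable_def by (intro integrable_mult_indicator) auto

lemma h1p_mult_limits: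
  assumes "h1p f f'" "h1p g g'"
  shows "ac (\<lambda>x. f x * g x) (\<lambda>x. f' x * g x + f x * g' x)"
    "integrable lborel (\<lambda>x. f' x * g x + f x * g' x)"
    "((\<lambda>x. f x * g x) \<longlongrightarrow> 0) at_top" "((\<lambda>x. f x * g x) \<longlongrightarrow> 0) at_bot"
proof -
  note L = h1pD[OF assms(1)] h1pD[OF assms(2)]
  show ac: "ac (\<lambda>x. f x * g x) (\<lambda>x. f' x * g x + f x * g' x)" by (rule ac_mult[OF L(3,6)])
  show int: "integrable lborel (\<lambda>x. f' x * g x + f x * g' x)"
    by (intro Bochner_Integration.integrable_add integrable_L2_mult L)
  have "integrable lborel (\<lambda>x. f x * g x)" by (intro integrable_L2_mult L)
  from ac_tendsto_0_at_top[OF ac int this] ac_tendsto_0_at_bot[OF ac int this]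
  show "((\<lambda>x. f x * g x) \<longlongrightarrow> 0) at_top" "((\<lambda>x. f x * g x) \<longlongrightarrow> 0) at_bot" .
qed

lemma h1p_integration_by_parts:
  assumes "h1p f f'" "h1p g g'"
  shows "ip f' g = - ip f g'"
proof -
  note L = h1pD[OF assms(1)] h1pD[OF assms(2)]
  have "(LINT x|lborel. f' x * g x + f x * g' x) = 0 - 0"
    by (rule ac_integral_UNIV[OF h1p_mult_limits[OF assms]])
  then show ?thesis
    using integrable_L2_mult[OF L(2,4)] integrable_L2_mult[OF L(1,5)] by simp
qed

text \<open>The Sobolev embedding with constant 1: f(x)^2 is minus the integral of 2 f f' over [x,
  \<infinity>), and -2 f f' <= f^2 + f'^2.\<close>

lemma h1p_sup:
  assumes "h1p f f'"
  shows "(f x)\<^sup>2 \<le> (l2_norm f)\<^sup>2 + (l2_norm f')\<^sup>2"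
proof -
  note L = h1pD[OF assms] and q = h1p_mult_limits[OF assms assms]
  have "(LINT y:{x..}|lborel. f' y * f y + f y * f' y) = 0 - f x * f x"
    by (rule ac_integral_atLeast[OF q(1) integrable_set_integrable[OF q(2)] q(3)]) simp
  then have "(f x)\<^sup>2 = - (LINT y:{x..}|lborel. f' y * f y + f y * f' y)" by (simp add: power2_eq_square)
  also have "\<dots> = (LINT y:{x..}|lborel. - (f' y * f y + f y * f' y))"
    by (rule set_integral_uminus[OF integrable_set_integrable[OF q(2)], symmetric]) simp
  also have "\<dots> \<le> (LINT y|lborel. (f y)\<^sup>2 + (f' y)\<^sup>2)"
    unfolding set_lebesgue_integral_def
  proof (rule integral_mono)
    show "integrable lborel (\<lambda>y. indicator {x..} y *\<^sub>R (- (f' y * f y + f y * f' y)))"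
      using integrable_set_integrable[OF integrable_minus[OF q(2)], of "{x..}"] by (simp add: set_integrable_def)
    show "integrable lborel (\<lambda>y. (f y)\<^sup>2 + (f' y)\<^sup>2)" using L(1,2) by (auto dest: L2D)
    show "indicator {x..} y *\<^sub>R (- (f' y * f y + f y * f' y)) \<le> (f y)\<^sup>2 + (f' y)\<^sup>2" for y
    proof -
      have "- (f' y * f y + f y * f' y) \<le> (f y)\<^sup>2 + (f' y)\<^sup>2"
        using zero_le_power2[of "f y + f' y"] unfolding power2_sum by (simp add: mult.commute mult.left_commute)
      then show ?thesis by (auto split: split_indicator)
    qed
  qed
  also have "\<dots> = (l2_norm f)\<^sup>2 + (l2_norm f')\<^sup>2"
    using L(1,2) by (simp add: l2_norm_sq L2D)
  finally show ?thesis .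
qed

lemma h1p_bounded:
  assumes "h1p f f'"
  obtains B where "B > 0" "\<And>x. \<bar>f x\<bar> \<le> B"
proof
  let ?C = "(l2_norm f)\<^sup>2 + (l2_norm f')\<^sup>2"
  show "sqrt ?C + 1 > 0" using real_sqrt_ge_zero[of ?C] by (simp add: add_nonneg_pos)
  show "\<bar>f x\<bar> \<le> sqrt ?C + 1" for x
    using real_sqrt_le_mono[OF h1p_sup[OF assms, of x]] by simp
qed

lemma h1p_L2_mult:
  assumes "h1p f f'" "g \<in> L2"
  shows "(\<lambda>x. f x * g x) \<in> L2"
proof -
  obtain B where "\<And>x. \<bar>f x\<bar> \<le> B" using h1p_bounded[OF assms(1)] by blast
  then show ?thesis by (rule L2_bounded_mult[OF assms(2) ac_borel[OF h1pD(3)[OF assms(1)]]])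
qed

lemma h1p_L2_power: "h1p f f' \<Longrightarrow> (\<lambda>x. f x ^ Suc n) \<in> L2"
proof (induction n)
  case (Suc n)
  then show ?case using h1p_L2_mult[OF Suc.prems Suc.IH[OF Suc.prems]] by simp
qed (auto dest: h1pD)

text \<open>Monotone convergence. It serves where only a uniform bound on the integrals over [-n, n]
  is at hand, for \<open>eta\<close> and for bounded solutions of first order equations.\<close>

lemma integrable_if_bounded_integrals:
  assumes "locally_integrable g" "\<And>x. 0 \<le> g x" "\<And>n::nat. (LINT x:{-real n..real n}|lborel. g x) \<le> B"
  shows "integrable lborel g"
proof -
  let ?f = "\<lambda>(n::nat) x. indicator {-real n..real n} x * g x"
  have int: "integrable lborel (?f n)" for n
    using locally_integrableD[OF assms(1), of "-real n" "real n"] by (simp add: set_integrable_def)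
  have mono: "?f m x \<le> ?f n x" if "m \<le> n" for m n x
    using that assms(2)[of x] by (auto split: split_indicator)
  have "incseq (\<lambda>n. LINT x|lborel. ?f n x)"
    unfolding incseq_def using mono by (auto intro!: integral_mono int)
  moreover have "bdd_above (range (\<lambda>n. LINT x|lborel. ?f n x))"
    using assms(3) by (auto simp: bdd_above_def set_lebesgue_integral_def)
  ultimately have lim: "(\<lambda>n. LINT x|lborel. ?f n x) \<longlonglongrightarrow> (SUP n. LINT x|lborel. ?f n x)"
    by (rule LIMSEQ_incseq_SUP[rotated])
  show ?thesis
  proof (rule integrable_monotone_convergence[OF int _ _ lim])
    show "AE x in lborel. mono (\<lambda>n. ?f n x)" using mono by (auto simp: mono_def)
    show "AE x in lborel. (\<lambda>n. ?f n x) \<longlonglongrightarrow> g x"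
    proof (rule AE_I2, rule tendsto_eventually)
      fix x :: real
      obtain N where "\<bar>x\<bar> \<le> real N" using real_arch_simple by blast
      then show "\<forall>\<^sub>F n in sequentially. ?f n x = g x"
        by (intro eventually_sequentiallyI[of N]) (auto split: split_indicator)
    qed
    show "g \<in> borel_measurable lborel" using locally_integrable_borel[OF assms(1)] by simp
  qed
qed

section \<open>The ground state\<close>

text \<open>The function F of the overview for the ground state, the integral of
  \<open>eta\<close>^2 from 0 to x. With it \<open>deta\<close> is the equation f' = - F f.\<close>

definition mass_eta :: "real \<Rightarrow> real" where
  "mass_eta x = tanh (x / 2) / 2"

definition deta :: "real \<Rightarrow> real" where
  "deta x = - mass_eta x * eta x"

lemma eta_pos [simp]: "0 < eta x"
  by (simp add: eta_def cosh_real_pos)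

lemma eta_le: "eta x \<le> 1 / 2"
  using cosh_real_ge_1[of "x / 2"] by (simp add: eta_def field_simps)

lemma eta_even [simp]: "eta (- x) = eta x"
  by (simp add: eta_def)

lemma eta_0: "eta 0 = 1 / 2"
  by (simp add: eta_def)

lemma mass_eta_0: "mass_eta 0 = 0"
  by (simp add: mass_eta_def)

text \<open>For \<open>eta\<close> the quantity f^2 + F^2 is exactly 1/4; coercivity measures how
  far a nearby state violates this.\<close>

lemma eta_sq: "(eta x)\<^sup>2 = 1 / 4 - (mass_eta x)\<^sup>2"
proof -
  define c s where "c = cosh (x / 2)" and "s = sinh (x / 2)"
  have "c \<noteq> 0" using cosh_real_pos[of "x / 2"] by (simp add: c_def)
  have "c\<^sup>2 - s\<^sup>2 = 1" by (simp add: c_def s_def cosh_square_eq)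
  then have "(1 / 2 * (1 / c))\<^sup>2 = (c\<^sup>2 - s\<^sup>2) / (4 * c\<^sup>2)"
    by (simp add: power_divide power_mult_distrib)
  also have "\<dots> = 1 / 4 - (s / c / 2)\<^sup>2"
    using \<open>c \<noteq> 0\<close> by (simp add: diff_divide_distrib power_divide)
  finally show ?thesis by (simp add: eta_def mass_eta_def tanh_def c_def s_def)
qed

lemma abs_mass_eta: "\<bar>mass_eta x\<bar> \<le> 1 / 2"
  using abs_le_square_iff[of "mass_eta x" "1/2"] eta_sq[of x] zero_le_power2[of "eta x"]
  by (simp add: power2_eq_square)

lemma mass_eta_nonneg: "0 \<le> x \<Longrightarrow> 0 \<le> mass_eta x"
  by (simp add: mass_eta_def)

lemma eta_deriv: "(eta has_real_derivative deta x) (at x)"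
proof -
  have "cosh (x / 2) \<noteq> 0" using cosh_real_pos[of "x / 2"] by simp
  then show ?thesis
    unfolding eta_def[abs_def] deta_def mass_eta_def eta_def tanh_def
    by (auto intro!: derivative_eq_intros simp: power2_eq_square field_simps)
qed

lemma mass_eta_deriv: "(mass_eta has_real_derivative (eta x)\<^sup>2) (at x)"
proof -
  have "cosh (x / 2) \<noteq> 0" using cosh_real_pos[of "x / 2"] by simp
  then have "(mass_eta has_real_derivative (1 - (tanh (x/2))\<^sup>2) / 4) (at x)"
    unfolding mass_eta_def[abs_def]
    by (auto intro!: derivative_eq_intros simp: field_simps)
  also have "(1 - (tanh (x/2))\<^sup>2) / 4 = (eta x)\<^sup>2"
    unfolding eta_sq by (simp add: mass_eta_def power_divide field_simps)
  finally show ?thesis .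
qed

text \<open>The stationary equation with multiplier 1/8, solved for the second derivative.\<close>

lemma deta_deriv: "(deta has_real_derivative (eta x / 4 - 2 * eta x ^ 3)) (at x)"
proof -
  have "(deta has_real_derivative - (eta x)\<^sup>2 * eta x + deta x * - mass_eta x) (at x)"
    unfolding deta_def[abs_def] by (intro DERIV_mult DERIV_minus mass_eta_deriv eta_deriv[unfolded deta_def[abs_def]])
  also have "- (eta x)\<^sup>2 * eta x + deta x * - mass_eta x = - (eta x)\<^sup>2 * eta x + (mass_eta x)\<^sup>2 * eta x"
    by (simp add: deta_def power2_eq_square)
  also have "\<dots> = eta x / 4 - 2 * eta x ^ 3"
    using eta_sq[of x] by (simp add: power3_eq_cube power2_eq_square algebra_simps) (simp add: eq_diff_eq[symmetric] distrib_left[symmetric])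
  finally show ?thesis .
qed

lemma continuous_eta: "continuous_on A eta"
  using eta_deriv by (auto intro!: continuous_at_imp_continuous_on DERIV_isCont)

lemma continuous_mass_eta: "continuous_on A mass_eta"
  using mass_eta_deriv by (auto intro!: continuous_at_imp_continuous_on DERIV_isCont)

lemma continuous_deta: "continuous_on A deta"
  using deta_deriv by (auto intro!: continuous_at_imp_continuous_on DERIV_isCont)

lemma ac_mass_eta: "ac mass_eta (\<lambda>x. (eta x)\<^sup>2)"
  by (intro ac_of_deriv mass_eta_deriv continuous_intros continuous_eta)

lemma mass_eta_at_top: "(mass_eta \<longlongrightarrow> 1 / 2) at_top"
proof -
  have "((\<lambda>x::real. tanh (x / 2)) \<longlongrightarrow> 1) at_top"
    by (rule filterlim_compose[OF tanh_real_at_top])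
      (auto intro!: filterlim_tendsto_pos_mult_at_top[of "\<lambda>_. 1/2", simplified] filterlim_ident)
  then show ?thesis unfolding mass_eta_def[abs_def] by (intro tendsto_intros) auto
qed

lemma mass_eta_at_bot: "(mass_eta \<longlongrightarrow> - (1 / 2)) at_bot"
proof -
  have "((\<lambda>x. - mass_eta x) \<longlongrightarrow> - (1 / 2)) at_top" by (intro tendsto_intros mass_eta_at_top)
  then show ?thesis by (simp add: filterlim_at_bot_mirror mass_eta_def)
qed

lemma eta_L2: "eta \<in> L2"
proof (rule L2I)
  show "eta \<in> borel_measurable borel" by (intro borel_measurable_continuous_onI continuous_eta)
  show "integrable lborel (\<lambda>x. (eta x)\<^sup>2)"
  proof (rule integrable_if_bounded_integrals)
    show "locally_integrable (\<lambda>x. (eta x)\<^sup>2)" by (rule acD[OF ac_mass_eta])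
    show "(LINT x:{-real n..real n}|lborel. (eta x)\<^sup>2) \<le> 1" for n
      using acD(2)[OF ac_mass_eta, of "-real n" "real n"] abs_mass_eta[of "real n"] abs_mass_eta[of "- real n"] by simp
  qed simp
qed

lemma eta_norm: "l2_norm eta = 1"
proof -
  have "(LINT x|lborel. (eta x)\<^sup>2) = 1 / 2 - - (1 / 2)"
    by (rule ac_integral_UNIV[OF ac_mass_eta L2D(2)[OF eta_L2] mass_eta_at_top mass_eta_at_bot])
  then show ?thesis by (simp add: l2_norm_def)
qed

lemma deta_L2: "deta \<in> L2"
  unfolding deta_def[abs_def] using abs_mass_eta
  by (intro L2_bounded_mult[OF eta_L2, of _ "1/2"] borel_measurable_continuous_onI continuous_intros continuous_mass_eta) auto

lemma h1p_eta: "h1p eta deta"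
  unfolding h1p_def by (intro conjI eta_L2 deta_L2 ac_of_deriv eta_deriv continuous_deta)

lemma h1p_deta: "h1p deta (\<lambda>x. eta x / 4 - 2 * eta x ^ 3)"
  unfolding h1p_def
proof (intro conjI deta_L2 ac_of_deriv deta_deriv)
  show "(\<lambda>x. eta x / 4 - 2 * eta x ^ 3) \<in> L2"
    using L2_diff[OF L2_cmult[OF eta_L2, of "1/4"] L2_cmult[OF h1p_L2_power[OF h1p_eta, of 2], of 2]]
    by (simp add: eval_nat_numeral)
qed (auto intro!: continuous_intros continuous_eta)

text \<open>Matches the decay of \<open>eta\<close> to the weight exp(-x) in which the mass error
  \<open>G\<close> is controlled on the half line.\<close>

lemma eta_sq_le_exp: "(eta x)\<^sup>2 \<le> exp (- x)"
proof -
  have "eta x = 1 / (exp (x/2) + exp (-(x/2)))"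
    by (simp add: eta_def cosh_def field_simps)
  also have "\<dots> \<le> 1 / exp (x / 2)" by (intro divide_left_mono) (auto intro!: mult_pos_pos add_pos_pos)
  finally have "(eta x)\<^sup>2 \<le> (1 / exp (x / 2))\<^sup>2" by (intro power_mono) (auto intro: less_imp_le)
  also have "\<dots> = exp (- x)" by (simp add: power_divide exp_minus inverse_eq_divide flip: exp_double)
  finally show ?thesis .
qed

section \<open>The energy gap as a perfect square\<close>

text \<open>
  For unit vectors this is \<open>4 (H(f) - H(\<eta>))\<close>, since \<open>H(\<eta>) = -1/48\<close>.
\<close>

definition energy_gap :: "(real \<Rightarrow> real) \<Rightarrow> (real \<Rightarrow> real) \<Rightarrow> real" where
  "energy_gap f f' = (LINT x|lborel. (f' x)\<^sup>2) - (LINT x|lborel. f x ^ 4) + 1 / 12"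

text \<open>The symmetric limits encode unit mass and at the same time fix the additive constant of
  \<open>F\<close>. The bound 1/2 on \<open>F\<close> and the constant 1/12 in the energy gap both
  come from them.\<close>

locale mass_function =
  fixes f f' F :: "real \<Rightarrow> real"
  assumes h1p: "h1p f f'" and acF: "ac F (\<lambda>x. (f x)\<^sup>2)"
    and F_top: "(F \<longlongrightarrow> 1 / 2) at_top" and F_bot: "(F \<longlongrightarrow> - (1 / 2)) at_bot"
begin

lemma F_mono: "a \<le> b \<Longrightarrow> F a \<le> F b"
proof -
  have "0 \<le> (LINT x:{a..b}|lborel. (f x)\<^sup>2)"
    unfolding set_lebesgue_integral_def by (intro integral_nonneg_AE) auto
  then show "a \<le> b \<Longrightarrow> F a \<le> F b" using acD(2)[OF acF, of a b] by simp
qed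

lemma abs_F: "\<bar>F x\<bar> \<le> 1 / 2"
proof -
  have "F x \<le> 1 / 2"
    by (rule tendsto_lowerbound[OF F_top]) (auto intro!: eventually_at_top_linorderI[of x] F_mono)
  moreover have "- (1 / 2) \<le> F x"
    by (rule tendsto_upperbound[OF F_bot]) (auto intro!: eventually_at_bot_linorderI[of x] F_mono)
  ultimately show ?thesis by (simp add: abs_le_iff)
qed

definition p :: "real \<Rightarrow> real" where "p x = f' x + F x * f x"

lemma F_f_L2: "(\<lambda>x. F x * f x) \<in> L2"
  by (rule L2_bounded_mult[OF h1pD(1)[OF h1p] ac_borel[OF acF] abs_F])

lemma p_L2: "p \<in> L2"
  unfolding p_def[abs_def] by (intro L2_add h1pD[OF h1p] F_f_L2)

text \<open>
  The cross term of the square is integrated by parts, \<open>(F f\<^sup>2)' = 2 F f f' + f\<^sup>4\<close>, and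
  \<open>F\<^sup>2 f\<^sup>2 = (F\<^sup>3 / 3)'\<close> contributes the constant.
\<close>

lemma energy_gap_eq: "energy_gap f f' = (l2_norm p)\<^sup>2"
proof -
  note L = h1pD[OF h1p]
  have i1: "integrable lborel (\<lambda>x. (F x * f x) * f' x)" by (rule integrable_L2_mult[OF F_f_L2 L(2)])
  have i2: "integrable lborel (\<lambda>x. f x ^ 4)"
    using integrable_L2_mult[OF h1p_L2_power[OF h1p, of 1] h1p_L2_power[OF h1p, of 1]]
    by (simp add: power_numeral_reduce mult.assoc)
  have i3: "integrable lborel (\<lambda>x. (F x * f x) * (F x * f x))" by (rule integrable_L2_mult[OF F_f_L2 F_f_L2])
  have i4: "integrable lborel (\<lambda>x. (f' x)\<^sup>2)" by (rule L2D[OF L(2)])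
  have a1: "ac (\<lambda>x. F x * (f x * f x)) (\<lambda>x. (f x)\<^sup>2 * (f x * f x) + F x * (f' x * f x + f x * f' x))"
    by (intro ac_mult acF L(3))
  have e1: "(\<lambda>x. (f x)\<^sup>2 * (f x * f x) + F x * (f' x * f x + f x * f' x)) = (\<lambda>x. f x ^ 4 + 2 * ((F x * f x) * f' x))"
    by (auto simp: fun_eq_iff algebra_simps power2_eq_square power4_eq_xxxx)
  have "(LINT x|lborel. f x ^ 4 + 2 * ((F x * f x) * f' x)) = 1 / 2 * 0 - - (1 / 2) * 0"
  proof (rule ac_integral_UNIV[OF a1[unfolded e1]])
    show "((\<lambda>x. F x * (f x * f x)) \<longlongrightarrow> 1 / 2 * 0) at_top"
      by (intro tendsto_mult F_top h1p_mult_limits[OF h1p h1p])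
    show "((\<lambda>x. F x * (f x * f x)) \<longlongrightarrow> - (1 / 2) * 0) at_bot"
      by (intro tendsto_mult F_bot h1p_mult_limits[OF h1p h1p])
  qed (use i1 i2 in auto)
  then have I1: "(LINT x|lborel. f x ^ 4) + 2 * (LINT x|lborel. (F x * f x) * f' x) = 0"
    using i1 i2 by simp
  have a2: "ac (\<lambda>x. F x * (F x * F x)) (\<lambda>x. (f x)\<^sup>2 * (F x * F x) + F x * ((f x)\<^sup>2 * F x + F x * (f x)\<^sup>2))"
    by (intro ac_mult acF)
  have e2: "(\<lambda>x. (f x)\<^sup>2 * (F x * F x) + F x * ((f x)\<^sup>2 * F x + F x * (f x)\<^sup>2)) = (\<lambda>x. 3 * ((F x * f x) * (F x * f x)))"
    by (auto simp: fun_eq_iff algebra_simps power2_eq_square)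
  have "(LINT x|lborel. 3 * ((F x * f x) * (F x * f x))) = 1/2 * (1/2 * (1/2)) - - (1/2) * (- (1/2) * - (1/2))"
    by (rule ac_integral_UNIV[OF a2[unfolded e2] integrable_mult_right[OF i3]]; intro tendsto_mult F_top F_bot)
  then have I2: "(LINT x|lborel. (F x * f x) * (F x * f x)) = 1 / 12"
    by simp
  have "(l2_norm p)\<^sup>2 = (LINT x|lborel. (f' x)\<^sup>2 + 2 * ((F x * f x) * f' x) + (F x * f x) * (F x * f x))"
    unfolding l2_norm_sq p_def
    by (intro lint_cong) (auto simp: power2_eq_square algebra_simps)
  also have "\<dots> = (LINT x|lborel. (f' x)\<^sup>2) + 2 * (LINT x|lborel. (F x * f x) * f' x) + 1 / 12"
    using i1 i3 i4 I2 by simp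
  finally show ?thesis using I1 by (simp add: energy_gap_def)
qed

end

lemma energy_gap_eta: "energy_gap eta deta = 0"
proof -
  interpret mass_function eta deta mass_eta
    by unfold_locales (fact h1p_eta ac_mass_eta mass_eta_at_top mass_eta_at_bot)+
  have "p = (\<lambda>_. 0)" by (simp add: p_def fun_eq_iff deta_def)
  then show ?thesis by (simp add: energy_gap_eq l2_norm_def)
qed

text \<open>For even \<open>f\<close> the primitive vanishing at 0 is odd, so its two limits are
  opposite and unit mass makes them 1/2 and -1/2. Thus the normalization at 0 and the one at
  infinity agree.\<close>

lemma even_mass_function:
  assumes "h1p f f'" "\<And>x. f (- x) = f x" "l2_norm f = 1"
  obtains F where "mass_function f f' F" "F 0 = 0"
proof -
  have int: "integrable lborel (\<lambda>x. (f x)\<^sup>2)" using h1pD(1)[OF assms(1)] by (rule L2D)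
  have one: "(LINT x|lborel. (f x)\<^sup>2) = 1" using assms(3) by (simp add: l2_norm_def)
  obtain F1 where F1: "ac F1 (\<lambda>x. (f x)\<^sup>2)"
    using ac_exists[of "\<lambda>x. (f x)\<^sup>2"] integrable_set_integrable[OF int] by (auto simp: locally_integrable_def)
  define F where "F x = F1 x - F1 0" for x
  have F: "ac F (\<lambda>x. (f x)\<^sup>2)"
    using ac_diff[OF F1 ac_const[of "F1 0"]] by (simp add: F_def[abs_def])
  have F0: "F 0 = 0" by (simp add: F_def)
  have odd: "F (- x) = - F x" for x
  proof -
    have acR: "ac (\<lambda>x. F (- x)) (\<lambda>x. - (f x)\<^sup>2)" using ac_reflect[OF F] by (simp add: assms(2))
    have acS: "ac (\<lambda>x. F (- x) + F x) (\<lambda>x. - (f x)\<^sup>2 + (f x)\<^sup>2)" by (rule ac_add[OF acR F])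
    have "F (- x) + F x = F (- 0) + F 0"
    proof (cases "x \<le> 0")
      case True
      then show ?thesis using acD(2)[OF acS True] by (simp add: set_lebesgue_integral_def)
    next
      case False
      then have "0 \<le> x" by simp
      then show ?thesis using acD(2)[OF acS \<open>0 \<le> x\<close>] by (simp add: set_lebesgue_integral_def)
    qed
    then show ?thesis using F0 by simp
  qed
  define l where "l = (LINT x:{0..}|lborel. (f x)\<^sup>2)"
  have "((\<lambda>b. LINT x:{0..b}|lborel. (f x)\<^sup>2) \<longlongrightarrow> l) at_top"
    unfolding l_def by (intro tendsto_set_lebesgue_integral_at_top integrable_set_integrable int) auto
  moreover have "\<forall>\<^sub>F b in at_top. (LINT x:{0..b}|lborel. (f x)\<^sup>2) = F b"
  proof (rule eventually_at_top_linorderI[of 0])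
    show "(LINT x:{0..b}|lborel. (f x)\<^sup>2) = F b" if "0 \<le> b" for b using acD(2)[OF F that] F0 by simp
  qed
  ultimately have top: "(F \<longlongrightarrow> l) at_top" by (rule Lim_transform_eventually)
  have bot: "(F \<longlongrightarrow> - l) at_bot"
    using tendsto_minus[OF top] by (simp add: filterlim_at_bot_mirror odd)
  have "(LINT x|lborel. (f x)\<^sup>2) = l - - l" by (rule ac_integral_UNIV[OF F int top bot])
  then have "l = 1 / 2" using one by simp
  with top bot assms(1) F F0 that show ?thesis by (simp add: mass_function_def)
qed

section \<open>Coercivity of the energy gap\<close>

lemma remainder_integrable:
  assumes "h1p e e'"
  shows "integrable lborel (\<lambda>x. 6 * (eta x)\<^sup>2 * (e x)\<^sup>2 + 4 * eta x * e x ^ 3 + e x ^ 4)"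
proof -
  note P = h1p_L2_power[OF assms, of 1, simplified] h1p_L2_power[OF assms, of 2, simplified]
  have HE: "(\<lambda>x. eta x * e x) \<in> L2" by (rule h1p_L2_mult[OF h1p_eta h1pD(1)[OF assms]])
  have "integrable lborel (\<lambda>x. 6 * (eta x)\<^sup>2 * (e x)\<^sup>2)" "integrable lborel (\<lambda>x. 4 * eta x * e x ^ 3)" "integrable lborel (\<lambda>x. e x ^ 4)"
    using integrable_mult_right[OF integrable_L2_mult[OF HE HE], of 6] integrable_mult_right[OF integrable_L2_mult[OF P(2) eta_L2], of 4] integrable_L2_mult[OF P(1,1)]
    by (auto simp: eval_nat_numeral ac_simps)
  then show ?thesis by auto
qed

text \<open>By the equation for \<open>eta\<close> the linear part of the expansion reduces to a
  multiple of the inner product of \<open>eta\<close> and \<open>e\<close>. Both states being unit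
  vectors, that product is itself quadratic in \<open>e\<close>, which is the source of the term
  with 1/4.\<close>

lemma energy_gap_expand:
  assumes "h1p f f'" "l2_norm f = 1" "h1p e e'" and e: "\<And>x. f x = eta x + e x" "\<And>x. f' x = deta x + e' x"
  shows "energy_gap f f' = (l2_norm e')\<^sup>2 + (l2_norm e)\<^sup>2 / 4
    - (LINT x|lborel. 6 * (eta x)\<^sup>2 * (e x)\<^sup>2 + 4 * eta x * e x ^ 3 + e x ^ 4)"
    "ip eta e = - (l2_norm e)\<^sup>2 / 2"
    "ip deta e' = - (LINT x|lborel. (eta x / 4 - 2 * eta x ^ 3) * e x)"
proof -
  note L = h1pD[OF assms(1)] and E = h1pD[OF assms(3)] and H = h1pD[OF h1p_eta]
  note P = h1p_L2_power[OF h1p_eta, of 1, simplified] h1p_L2_power[OF h1p_eta, of 2, simplified]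
  have i: "integrable lborel (\<lambda>x. (eta x)\<^sup>2)" "integrable lborel (\<lambda>x. (e x)\<^sup>2)"
    "integrable lborel (\<lambda>x. (deta x)\<^sup>2)" "integrable lborel (\<lambda>x. (e' x)\<^sup>2)"
    "integrable lborel (\<lambda>x. eta x * e x)" "integrable lborel (\<lambda>x. deta x * e' x)"
    by (intro L2D(2) integrable_L2_mult H E)+
  have i': "integrable lborel (\<lambda>x. eta x ^ 3 * e x)" "integrable lborel (\<lambda>x. eta x ^ 4)"
    using integrable_L2_mult[OF P(2) E(1)] integrable_L2_mult[OF P(1,1)]
    by (auto simp: eval_nat_numeral mult.assoc)
  note i = i i'
  define K where "K x = 6 * (eta x)\<^sup>2 * (e x)\<^sup>2 + 4 * eta x * e x ^ 3 + e x ^ 4" for x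
  have K: "integrable lborel K" unfolding K_def[abs_def] by (rule remainder_integrable[OF assms(3)])
  have "1 = (LINT x|lborel. (f x)\<^sup>2)" using assms(2) by (simp add: l2_norm_def)
  also have "\<dots> = (LINT x|lborel. (eta x)\<^sup>2 + 2 * (eta x * e x) + (e x)\<^sup>2)"
    by (simp add: e power2_sum algebra_simps)
  also have "\<dots> = 1 + 2 * ip eta e + (l2_norm e)\<^sup>2"
    using i eta_norm by (simp add: l2_norm_sq) (simp add: l2_norm_def)
  finally show 1: "ip eta e = - (l2_norm e)\<^sup>2 / 2" by simp
  show 2: "ip deta e' = - (LINT x|lborel. (eta x / 4 - 2 * eta x ^ 3) * e x)"
    using h1p_integration_by_parts[OF h1p_deta assms(3)] by simp
  have 3: "(LINT x|lborel. (eta x / 4 - 2 * eta x ^ 3) * e x) = ip eta e / 4 - 2 * (LINT x|lborel. eta x ^ 3 * e x)"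
  proof -
    have "(LINT x|lborel. (eta x / 4 - 2 * eta x ^ 3) * e x) = (LINT x|lborel. 1/4 * (eta x * e x) - 2 * (eta x ^ 3 * e x))"
      by (intro lint_cong) (auto simp: algebra_simps)
    then show ?thesis using i by simp
  qed
  have "(LINT x|lborel. (f' x)\<^sup>2) = (LINT x|lborel. (deta x)\<^sup>2 + 2 * (deta x * e' x) + (e' x)\<^sup>2)"
    by (simp add: e power2_sum algebra_simps)
  also have "\<dots> = (LINT x|lborel. (deta x)\<^sup>2) + 2 * ip deta e' + (l2_norm e')\<^sup>2"
    using i by (simp add: l2_norm_sq)
  finally have 4: "(LINT x|lborel. (f' x)\<^sup>2) = (LINT x|lborel. (deta x)\<^sup>2) + 2 * ip deta e' + (l2_norm e')\<^sup>2" .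
  have "(LINT x|lborel. f x ^ 4) = (LINT x|lborel. eta x ^ 4 + 4 * (eta x ^ 3 * e x) + K x)"
    by (intro lint_cong) (auto simp: e K_def power2_eq_square power3_eq_cube power4_eq_xxxx algebra_simps)
  also have "\<dots> = (LINT x|lborel. eta x ^ 4) + 4 * (LINT x|lborel. eta x ^ 3 * e x) + (LINT x|lborel. K x)"
    using i K by simp
  finally have 5: "(LINT x|lborel. f x ^ 4) = (LINT x|lborel. eta x ^ 4) + 4 * (LINT x|lborel. eta x ^ 3 * e x) + (LINT x|lborel. K x)" .
  show "energy_gap f f' = (l2_norm e')\<^sup>2 + (l2_norm e)\<^sup>2 / 4
    - (LINT x|lborel. 6 * (eta x)\<^sup>2 * (e x)\<^sup>2 + 4 * eta x * e x ^ 3 + e x ^ 4)"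
    using energy_gap_eta 1 2 3 4 5 unfolding energy_gap_def K_def[symmetric] by simp
qed

lemma integral_mult_le_norms:
  assumes "f \<in> L2" "g \<in> L2" "A \<in> sets borel"
  shows "\<bar>LINT x:A|lborel. f x * g x\<bar> \<le> l2_norm f * l2_norm g"
proof -
  have "(LINT x:A|lborel. f x * g x) = (LINT x|lborel. (indicator A x * f x) * g x)"
    by (simp add: set_lebesgue_integral_def mult.assoc)
  also have "\<bar>\<dots>\<bar> \<le> l2_norm (\<lambda>x. indicator A x * f x) * l2_norm g"
    by (rule cauchy_schwarz[OF L2_indicator[OF assms(1,3)] assms(2)])
  also have "l2_norm (\<lambda>x. indicator A x * f x) \<le> 1 * l2_norm f"
    by (rule l2_norm_mono[OF assms(1) L2D(1)[OF L2_indicator[OF assms(1,3)]]]) (auto split: split_indicator)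
  finally show ?thesis by (simp add: mult_right_mono)
qed

section \<open>Weighted energy estimates on the half line\<close>

lemma set_integrable_exp: "set_integrable lborel {0..} (\<lambda>x::real. exp (- x))" (is ?A)
  and set_integral_exp: "(LINT x:{0..}|lborel. exp (- x :: real)) = 1" (is ?B)
proof -
  have nn: "(\<integral>\<^sup>+x. ennreal (exp (- x)) * indicator {0 ..} x \<partial>lborel) = 0 - - exp (- 0::real)"
  proof (rule nn_integral_FTC_atLeast)
    show "((\<lambda>a. - exp (- a)) has_real_derivative exp (- x)) (at x)" for x :: real
      by (auto intro!: derivative_eq_intros)
    show "((\<lambda>a. - exp (- a)) \<longlongrightarrow> (0::real)) at_top"
      using tendsto_minus[OF filterlim_compose[OF exp_at_bot filterlim_uminus_at_bot_at_top]] by simp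
  qed auto
  have "has_bochner_integral lborel (\<lambda>x::real. indicator {0..} x * exp (- x)) 1"
  proof (rule has_bochner_integral_nn_integral)
    have "(\<integral>\<^sup>+x. ennreal (indicator {0..} x * exp (- x)) \<partial>lborel) = (\<integral>\<^sup>+x. ennreal (exp (- x)) * indicator {0 ..} x \<partial>lborel)"
      by (intro nn_integral_cong) (auto split: split_indicator)
    then show "(\<integral>\<^sup>+x. ennreal (indicator {0..} x * exp (- x)) \<partial>lborel) = ennreal 1" using nn by simp
  qed auto
  then show ?A ?B
    by (auto simp: set_integrable_def set_lebesgue_integral_def has_bochner_integral_iff)
qed

text \<open>The form in which the energy estimates are used: q is a weight times a squared error,
  and a differential inequality for q bounds an integral by the boundary value at 0.\<close>

lemma half_line_mono:
  assumes "ac q q'" "set_integrable lborel {0..} q'" "(q \<longlongrightarrow> 0) at_top"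
    "set_integrable lborel {0..} g" "\<And>x. x \<ge> 0 \<Longrightarrow> q' x \<le> g x"
  shows "- q 0 \<le> (LINT x:{0..}|lborel. g x)"
proof -
  have "- q 0 = (LINT x:{0..}|lborel. q' x)" using ac_integral_atLeast[OF assms(1-3)] by simp
  also have "\<dots> \<le> (LINT x:{0..}|lborel. g x)"
    by (rule set_integral_mono[OF assms(2,4)]) (use assms(5) in auto)
  finally show ?thesis .
qed

lemma tendsto_0_abs_bound:
  fixes f g :: "real \<Rightarrow> real"
  assumes "(g \<longlongrightarrow> 0) F" "\<And>x. \<bar>f x\<bar> \<le> C * \<bar>g x\<bar>"
  shows "(f \<longlongrightarrow> 0) F"
proof (rule Lim_null_comparison)
  show "\<forall>\<^sub>F x in F. norm (f x) \<le> C * \<bar>g x\<bar>" using assms(2) by simp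
  show "((\<lambda>x. C * \<bar>g x\<bar>) \<longlongrightarrow> 0) F" using tendsto_mult[OF tendsto_const[of C] tendsto_rabs[OF assms(1)]] by simp
qed

text \<open>The distance 1/64 gives |G| <= 1/32, small enough to absorb the nonlinear term
  \<open>G * e\<close> later. The sign of f(0) separates \<open>eta\<close> from its negative, for
  which \<open>r\<close> would vanish as well.\<close>

locale near_ground_state = mass_function +
  assumes F0: "F 0 = 0" and unit: "l2_norm f = 1"
    and close: "l2_norm (\<lambda>x. f x - eta x) \<le> 1 / 64" and f0: "f 0 \<ge> 0"
begin

abbreviation "P \<equiv> l2_norm p"

definition e where "e x = f x - eta x"
definition e' where "e' x = f' x - deta x"
definition G where "G x = F x - mass_eta x"
definition r where "r x = (f x)\<^sup>2 + (F x)\<^sup>2 - 1 / 4"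

lemma F_nonneg: "0 \<le> x \<Longrightarrow> 0 \<le> F x"
  using F_mono[of 0 x] F0 by simp

lemma h1p_e: "h1p e e'"
  unfolding e_def[abs_def] e'_def[abs_def] by (rule h1p_diff[OF h1p h1p_eta])

text \<open>The first integral \<open>f\<^sup>2 + F\<^sup>2\<close> of the system \<open>f' = - F f, F' = f\<^sup>2\<close> is almost conserved.\<close>

lemma abs_r: "\<bar>r x\<bar> \<le> 2 * P"
proof -
  have "ac (\<lambda>x. f x * f x + F x * F x) (\<lambda>x. (f' x * f x + f x * f' x) + ((f x)\<^sup>2 * F x + F x * (f x)\<^sup>2))"
    by (intro ac_add ac_mult acF h1pD[OF h1p])
  also have "(\<lambda>x. (f' x * f x + f x * f' x) + ((f x)\<^sup>2 * F x + F x * (f x)\<^sup>2)) = (\<lambda>x. 2 * (f x * p x))"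
    by (auto simp: p_def fun_eq_iff algebra_simps power2_eq_square)
  finally have ac: "ac (\<lambda>x. f x * f x + F x * F x) (\<lambda>x. 2 * (f x * p x))" .
  have int: "integrable lborel (\<lambda>x. 2 * (f x * p x))"
    by (intro integrable_mult_right integrable_L2_mult h1pD(1)[OF h1p] p_L2)
  have lim: "((\<lambda>x. f x * f x + F x * F x) \<longlongrightarrow> 0 + 1/2 * (1/2)) at_top"
    by (intro tendsto_add tendsto_mult F_top h1p_mult_limits[OF h1p h1p])
  have "(LINT y:{x..}|lborel. 2 * (f y * p y)) = 0 + 1/2 * (1/2) - (f x * f x + F x * F x)"
    by (rule ac_integral_atLeast[OF ac integrable_set_integrable[OF int] lim]) simp
  then have "r x = - 2 * (LINT y:{x..}|lborel. f y * p y)"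
    by (simp add: r_def power2_eq_square)
  then show ?thesis
    using integral_mult_le_norms[OF h1pD(1)[OF h1p] p_L2, of "{x..}"] unit by (simp add: abs_mult)
qed

lemma acG: "ac G (\<lambda>x. (f x)\<^sup>2 - (eta x)\<^sup>2)"
  unfolding G_def[abs_def] by (rule ac_diff[OF acF ac_mass_eta])

lemma G0: "G 0 = 0"
  by (simp add: G_def F0 mass_eta_0)

text \<open>Both squares are expressed through f^2 + F^2, which is 1/4 + r for the state and 1/4 for
  \<open>eta\<close>. Hence \<open>G\<close> solves a linear equation with the small source
  \<open>r\<close>, and its coefficient F + mass_eta damps for x >= 0.\<close>

lemma G_deriv_eq: "(f x)\<^sup>2 - (eta x)\<^sup>2 = r x - (F x + mass_eta x) * G x"
  using eta_sq[of x] by (simp add: r_def G_def algebra_simps power2_eq_square)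

lemma abs_G_le_1: "\<bar>G x\<bar> \<le> 1"
  using abs_F[of x] abs_mass_eta[of x] by (simp add: G_def)

lemma abs_G: "0 \<le> x \<Longrightarrow> \<bar>G x\<bar> \<le> 1 / 32"
proof -
  assume "0 \<le> x"
  have L: "e \<in> L2" "(\<lambda>x. f x + eta x) \<in> L2"
    by (intro h1pD[OF h1p_e] L2_add h1pD(1)[OF h1p] eta_L2)+
  have "G x = (LINT y:{0..x}|lborel. e y * (f y + eta y))"
    using acD(2)[OF acG \<open>0 \<le> x\<close>] G0 by (simp add: e_def algebra_simps power2_eq_square)
  also have "\<bar>\<dots>\<bar> \<le> l2_norm e * l2_norm (\<lambda>x. f x + eta x)"
    by (rule integral_mult_le_norms[OF L]) simp
  also have "\<dots> \<le> 1 / 64 * 2"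
    using close l2_norm_triangle[OF h1pD(1)[OF h1p] eta_L2] unit eta_norm
    by (intro mult_mono) (auto simp: e_def[abs_def])
  finally show ?thesis by simp
qed

text \<open>Since \<open>r\<close> is controlled only in the sup norm, an integrable weight is
  needed. Differentiating exp(-x) G^2 produces -exp(-x) G^2 from the weight itself, the remaining
  damping has a good sign, and G(0) = 0 removes the boundary term.\<close>

lemma G_exp_L2:
  "set_integrable lborel {0..} (\<lambda>x. exp (- x) * (G x)\<^sup>2)" (is ?A)
  "(LINT x:{0..}|lborel. exp (- x) * (G x)\<^sup>2) \<le> 16 * P\<^sup>2" (is ?B)
proof -
  have P0: "P \<ge> 0" by simp
  have [measurable]: "G \<in> borel_measurable borel" "f \<in> borel_measurable borel" "eta \<in> borel_measurable borel"
    using ac_borel[OF acG] h1pD(1)[OF h1p] eta_L2 by (auto dest: L2D)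
  have bnd: "set_integrable lborel {0..} (\<lambda>x. h x)" if [measurable]: "h \<in> borel_measurable borel"
    and "\<And>x. x \<ge> 0 \<Longrightarrow> \<bar>h x\<bar> \<le> C * exp (- x)" for h :: "real \<Rightarrow> real" and C
    by (rule set_integrable_bound[OF set_integrable_mult_right[OF set_integrable_exp, of C]])
      (use that in \<open>auto simp: set_borel_measurable_def intro!: AE_I2 order_trans[OF _ abs_ge_self]\<close>)
  have G2: "(G x)\<^sup>2 \<le> 1" for x using abs_G_le_1[of x] by (simp add: abs_square_le_1)
  show ?A by (rule bnd[of _ 1]) (use G2 in auto)
  have aexp: "ac (\<lambda>x. exp (- x)) (\<lambda>x. - exp (- x))"
    by (rule ac_of_deriv) (auto intro!: derivative_eq_intros continuous_intros)
  define q' where "q' x = - exp (- x) * (G x * G x) + exp (- x) * (((f x)\<^sup>2 - (eta x)\<^sup>2) * G x + G x * ((f x)\<^sup>2 - (eta x)\<^sup>2))" for x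
  have acq: "ac (\<lambda>x. exp (- x) * (G x * G x)) q'"
    unfolding q'_def[abs_def] by (intro ac_mult aexp acG)
  have q'_eq: "q' x = exp (- x) * (- (G x)\<^sup>2 + 2 * (r x * G x) - 2 * ((F x + mass_eta x) * (G x)\<^sup>2))" for x
    unfolding q'_def G_deriv_eq by (simp add: algebra_simps power2_eq_square)
  \<comment> \<open>Half of the term gained from the weight is spent on the source, so the final
    constant is 2 * 8 = 16.\<close>
  have young: "4 * P * \<bar>G x\<bar> \<le> (G x)\<^sup>2 / 2 + 8 * P\<^sup>2" for x
    using zero_le_power2[of "\<bar>G x\<bar> - 4 * P"] by (simp add: power2_diff power_mult_distrib algebra_simps)
  have rG: "\<bar>r x * G x\<bar> \<le> 2 * P * \<bar>G x\<bar>" for x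
    unfolding abs_mult by (intro mult_right_mono abs_r) simp
  have "- (exp (- 0) * (G 0 * G 0)) \<le> (LINT x:{0..}|lborel. - 1 / 2 * (exp (- x) * (G x)\<^sup>2) + 8 * P\<^sup>2 * exp (- x))"
  proof (rule half_line_mono[OF acq])
    show "set_integrable lborel {0..} q'"
    proof (rule bnd[of _ "3 + 4 * P"])
      show "q' \<in> borel_measurable borel" unfolding q'_def[abs_def] by measurable
      fix x :: real assume "x \<ge> 0"
      have "\<bar>(F x + mass_eta x) * (G x)\<^sup>2\<bar> \<le> 1 * 1"
        unfolding abs_mult using abs_F[of x] abs_mass_eta[of x] G2[of x] by (intro mult_mono) auto
      moreover have "\<bar>r x * G x\<bar> \<le> 2 * P" using rG[of x] mult_left_mono[OF abs_G_le_1[of x], of "2 * P"] P0 by simp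
      ultimately have "\<bar>- (G x)\<^sup>2 + 2 * (r x * G x) - 2 * ((F x + mass_eta x) * (G x)\<^sup>2)\<bar> \<le> 3 + 4 * P"
        using G2[of x] zero_le_power2[of "G x"] by linarith
      then show "\<bar>q' x\<bar> \<le> (3 + 4 * P) * exp (- x)"
        unfolding q'_eq abs_mult by (simp add: mult.commute)
    qed
    show "((\<lambda>x. exp (- x) * (G x * G x)) \<longlongrightarrow> 0) at_top"
    proof (rule tendsto_0_abs_bound[of "\<lambda>x. exp (- x)" _ _ 1])
      show "((\<lambda>x. exp (- x)) \<longlongrightarrow> (0::real)) at_top"
        by (rule filterlim_compose[OF exp_at_bot filterlim_uminus_at_bot_at_top])
      show "\<bar>exp (- x) * (G x * G x)\<bar> \<le> 1 * \<bar>exp (- x)\<bar>" for x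
        using G2[of x] by (simp add: abs_mult power2_eq_square)
    qed
    show "set_integrable lborel {0..} (\<lambda>x. - 1 / 2 * (exp (- x) * (G x)\<^sup>2) + 8 * P\<^sup>2 * exp (- x))"
      by (intro set_integral_add set_integrable_mult_right \<open>?A\<close> set_integrable_exp)
    fix x :: real assume x: "x \<ge> 0"
    have "0 \<le> (F x + mass_eta x) * (G x)\<^sup>2"
      using F_nonneg[OF x] mass_eta_nonneg[OF x] by simp
    then have "- (G x)\<^sup>2 + 2 * (r x * G x) - 2 * ((F x + mass_eta x) * (G x)\<^sup>2) \<le> - 1 / 2 * (G x)\<^sup>2 + 8 * P\<^sup>2"
      using young[of x] rG[of x] by linarith
    then have "q' x \<le> exp (- x) * (- 1 / 2 * (G x)\<^sup>2 + 8 * P\<^sup>2)"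
      unfolding q'_eq by (intro mult_left_mono) auto
    then show "q' x \<le> - 1 / 2 * (exp (- x) * (G x)\<^sup>2) + 8 * P\<^sup>2 * exp (- x)"
      by (simp add: algebra_simps)
  qed
  also have "\<dots> = - 1 / 2 * (LINT x:{0..}|lborel. exp (- x) * (G x)\<^sup>2) + 8 * P\<^sup>2"
    using set_integral_add(2)[OF set_integrable_mult_right[OF \<open>?A\<close>, of "- 1 / 2"] set_integrable_mult_right[OF set_integrable_exp, of "8 * P\<^sup>2"]]
    by (simp only: set_integral_mult_right set_integral_exp mult_1_right)
  finally show ?B by (simp add: G0)
qed

text \<open>The error satisfies e' = s - mass_eta e with a source made of \<open>p\<close> and
  \<open>G\<close>. The damping \<open>mass_eta\<close> vanishes at 0, so e^2 is weighted with the
  decreasing function 2 - 2 mass_eta, whose derivative -2 eta^2 supplies the missing decay near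
  0.\<close>

lemma half_line_bound: "(LINT x:{0..}|lborel. (e x)\<^sup>2) \<le> 6656 * P\<^sup>2"
proof -
  define N where "N = (LINT x:{0..}|lborel. (e x)\<^sup>2)"
  define s where "s x = p x - G x * eta x - G x * e x" for x
  note L = h1pD[OF h1p_e]
  have e'_eq: "e' x = s x - mass_eta x * e x" for x
    by (simp add: e'_def e_def s_def p_def G_def deta_def algebra_simps)
  have Ge: "(\<lambda>x. G x * e x) \<in> L2" by (rule L2_bounded_mult[OF L(1) ac_borel[OF acG] abs_G_le_1])
  have Gt: "(\<lambda>x. G x * eta x) \<in> L2" by (rule L2_bounded_mult[OF eta_L2 ac_borel[OF acG] abs_G_le_1])
  have sL2: "s \<in> L2" unfolding s_def[abs_def] by (intro L2_diff p_L2 Ge Gt)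
  have si: "set_integrable lborel {0..} (\<lambda>x. (h x)\<^sup>2)" if "h \<in> L2" for h
    using that by (intro integrable_set_integrable) (auto dest: L2D)
  \<comment> \<open>51 = 3 + 3 * 16, from \<open>p\<close> and from the weighted bound on
    \<open>G\<close>; 3/1024 comes from |G| <= 1/32.\<close>
  have S: "(LINT x:{0..}|lborel. (s x)\<^sup>2) \<le> 51 * P\<^sup>2 + 3 / 1024 * N"
  proof -
    have "(LINT x:{0..}|lborel. (s x)\<^sup>2) \<le> (LINT x:{0..}|lborel. 3 * (p x)\<^sup>2 + 3 * (exp (- x) * (G x)\<^sup>2) + 3 / 1024 * (e x)\<^sup>2)"
    proof (rule set_integral_mono)
      show "set_integrable lborel {0..} (\<lambda>x. 3 * (p x)\<^sup>2 + 3 * (exp (- x) * (G x)\<^sup>2) + 3 / 1024 * (e x)\<^sup>2)"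
        by (intro set_integral_add set_integrable_mult_right si p_L2 G_exp_L2 L)
      fix x :: real assume "x \<in> {0..}"
      have three: "(a - b - c)\<^sup>2 \<le> 3 * a\<^sup>2 + 3 * b\<^sup>2 + 3 * c\<^sup>2" for a b c :: real
        using zero_le_power2[of "a + b"] zero_le_power2[of "a + c"] zero_le_power2[of "b - c"]
        by (simp add: power2_eq_square algebra_simps)
      have "(G x * eta x)\<^sup>2 \<le> exp (- x) * (G x)\<^sup>2"
        using mult_right_mono[OF eta_sq_le_exp[of x], of "(G x)\<^sup>2"] by (simp add: power_mult_distrib mult.commute)
      moreover have "(G x)\<^sup>2 \<le> (1/32)\<^sup>2" using abs_G[of x] \<open>x \<in> {0..}\<close> by (intro abs_le_square_iff[THEN iffD1]) auto
      then have "(G x * e x)\<^sup>2 \<le> 1 / 1024 * (e x)\<^sup>2"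
        using mult_right_mono[of "(G x)\<^sup>2" "1/1024" "(e x)\<^sup>2"] by (simp add: power_mult_distrib power_divide)
      ultimately show "(s x)\<^sup>2 \<le> 3 * (p x)\<^sup>2 + 3 * (exp (- x) * (G x)\<^sup>2) + 3 / 1024 * (e x)\<^sup>2"
        using three[of "p x" "G x * eta x" "G x * e x"] unfolding s_def by linarith
    qed (use si sL2 in auto)
    also have "\<dots> = 3 * (LINT x:{0..}|lborel. (p x)\<^sup>2) + 3 * (LINT x:{0..}|lborel. exp (- x) * (G x)\<^sup>2) + 3 / 1024 * N"
      unfolding N_def by (simp add: set_integral_add set_integrable_mult_right si p_L2 G_exp_L2 L)
    also have "(LINT x:{0..}|lborel. (p x)\<^sup>2) \<le> P\<^sup>2"
      unfolding l2_norm_sq set_lebesgue_integral_def using si[OF p_L2] L2D(2)[OF p_L2]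
      by (intro integral_mono) (auto simp: set_integrable_def split: split_indicator)
    finally show ?thesis using G_exp_L2(2) by linarith
  qed
  have achi: "ac (\<lambda>x. 2 - 2 * mass_eta x) (\<lambda>x. - 2 * (eta x)\<^sup>2)"
    using ac_diff[OF ac_const[of 2] ac_cmult[OF ac_mass_eta, of 2]] by simp
  define q' where "q' x = - 2 * (eta x)\<^sup>2 * (e x * e x) + (2 - 2 * mass_eta x) * (e' x * e x + e x * e' x)" for x
  have acq: "ac (\<lambda>x. (2 - 2 * mass_eta x) * (e x * e x)) q'"
    unfolding q'_def[abs_def] by (intro ac_mult achi L)
  \<comment> \<open>At 0 both mass functions vanish, so r(0) = f(0)^2 - 1/4 factors through e(0),
    and f(0) >= 0 keeps the other factor at least 1/2.\<close>
  have e0: "(e 0)\<^sup>2 \<le> 16 * P\<^sup>2"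
  proof -
    have "e 0 * (f 0 + 1 / 2) = r 0"
      by (simp add: e_def r_def F0 eta_0 power2_eq_square algebra_simps)
    then have "\<bar>e 0\<bar> * \<bar>f 0 + 1 / 2\<bar> \<le> 2 * P" using abs_r[of 0] by (simp add: abs_mult[symmetric])
    moreover have "\<bar>e 0\<bar> * (1 / 2) \<le> \<bar>e 0\<bar> * \<bar>f 0 + 1 / 2\<bar>" using f0 by (intro mult_left_mono) auto
    ultimately have "\<bar>e 0\<bar> \<le> \<bar>4 * P\<bar>" by simp
    then have "(e 0)\<^sup>2 \<le> (4 * P)\<^sup>2" by (rule abs_le_square_iff[THEN iffD1])
    then show ?thesis by (simp add: power_mult_distrib)
  qed
  have "- ((2 - 2 * mass_eta 0) * (e 0 * e 0)) \<le> (LINT x:{0..}|lborel. - 3 / 8 * (e x)\<^sup>2 + 32 * (s x)\<^sup>2)"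
  proof (rule half_line_mono[OF acq])
    have chi: "\<bar>2 - 2 * mass_eta x\<bar> \<le> 3" for x using abs_mass_eta[of x] by simp
    have [measurable]: "mass_eta \<in> borel_measurable borel" "eta \<in> borel_measurable borel"
      by (intro borel_measurable_continuous_onI continuous_mass_eta continuous_eta)+
    have "(\<lambda>x. eta x * e x) \<in> L2" by (rule h1p_L2_mult[OF h1p_eta L(1)])
    moreover have "(\<lambda>x. (2 - 2 * mass_eta x) * e x) \<in> L2"
      by (rule L2_bounded_mult[OF L(1) _ chi]) simp
    ultimately have "integrable lborel (\<lambda>x. - 2 * ((eta x * e x) * (eta x * e x)) + 2 * (((2 - 2 * mass_eta x) * e x) * e' x))"
      by (intro Bochner_Integration.integrable_add integrable_mult_right integrable_L2_mult L)
    also have "(\<lambda>x. - 2 * ((eta x * e x) * (eta x * e x)) + 2 * (((2 - 2 * mass_eta x) * e x) * e' x)) = q'"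
      by (auto simp: fun_eq_iff q'_def algebra_simps power2_eq_square)
    finally show "set_integrable lborel {0..} q'" by (rule integrable_set_integrable) simp
    show "((\<lambda>x. (2 - 2 * mass_eta x) * (e x * e x)) \<longlongrightarrow> 0) at_top"
      by (rule tendsto_0_abs_bound[OF h1p_mult_limits(3)[OF h1p_e h1p_e], of _ 3])
        (auto simp: abs_mult intro!: mult_right_mono chi)
    show "set_integrable lborel {0..} (\<lambda>x. - 3 / 8 * (e x)\<^sup>2 + 32 * (s x)\<^sup>2)"
      by (intro set_integral_add set_integrable_mult_right si sL2 L)
    fix x :: real assume x: "x \<ge> 0"
    \<comment> \<open>In terms of t in [0, 1] the coefficient of -e^2 becomes 1/2 + 2t - (3/2) t^2,
      which is at least 1/2; an eighth is then given up to Young's inequality.\<close>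
    define t where "t = 2 * mass_eta x"
    have t: "0 \<le> t" "t \<le> 1" using mass_eta_nonneg[OF x] abs_mass_eta[of x] by (auto simp: t_def)
    have q': "q' x = - (1 / 2 + 2 * t - 3 / 2 * t\<^sup>2) * (e x)\<^sup>2 + 2 * (2 - t) * (e x * s x)"
      unfolding q'_def e'_eq eta_sq t_def by (simp add: algebra_simps power2_eq_square)
    have "t\<^sup>2 \<le> t" using t by (simp add: power2_eq_square mult_left_le)
    then have "(1 / 2) * (e x)\<^sup>2 \<le> (1 / 2 + 2 * t - 3 / 2 * t\<^sup>2) * (e x)\<^sup>2"
      using t by (intro mult_right_mono) auto
    moreover have "2 * (2 - t) * (e x * s x) \<le> 4 * \<bar>e x * s x\<bar>"
    proof -
      have "2 * (2 - t) * (e x * s x) \<le> 2 * (2 - t) * \<bar>e x * s x\<bar>" using t by (intro mult_left_mono) auto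
      also have "\<dots> \<le> 4 * \<bar>e x * s x\<bar>" using t by (intro mult_right_mono) auto
      finally show ?thesis .
    qed
    moreover have "4 * \<bar>e x * s x\<bar> \<le> (e x)\<^sup>2 / 8 + 32 * (s x)\<^sup>2"
      using zero_le_power2[of "\<bar>e x\<bar> - 16 * \<bar>s x\<bar>"] by (simp add: power2_diff power_mult_distrib abs_mult)
    ultimately show "q' x \<le> - 3 / 8 * (e x)\<^sup>2 + 32 * (s x)\<^sup>2" unfolding q' by linarith
  qed
  also have "\<dots> = - 3 / 8 * N + 32 * (LINT x:{0..}|lborel. (s x)\<^sup>2)"
    unfolding N_def by (simp add: set_integral_add set_integrable_mult_right si sL2 L)
  finally have "- 2 * (e 0)\<^sup>2 \<le> - 3 / 8 * N + 32 * (LINT x:{0..}|lborel. (s x)\<^sup>2)"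
    by (simp add: mass_eta_0 power2_eq_square)
  \<comment> \<open>The part 32 * 3/1024 = 3/32 of N is absorbed into 3/8, leaving 9/32 >= 1/4; the
    right side collects 2 * 16 + 32 * 51 = 1664, and 6656 = 4 * 1664.\<close>
  then have "N \<le> 6656 * P\<^sup>2" using S e0 zero_le_power2[of P] by linarith
  then show ?thesis by (simp add: N_def)
qed

end

lemma even_integral_half:
  fixes g :: "real \<Rightarrow> real"
  assumes "integrable lborel g" "\<And>x. g (- x) = g x"
  shows "(LINT x|lborel. g x) = 2 * (LINT x:{0..}|lborel. g x)"
proof -
  have "has_bochner_integral lborel (\<lambda>x. indicator {0..} x *\<^sub>R g x) (LINT x:{0..}|lborel. g x)"
    using integrable_set_integrable[OF assms(1), of "{0..}"]
    by (simp add: has_bochner_integral_iff set_integrable_def set_lebesgue_integral_def)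
  from has_bochner_integral_even_function[OF this] assms(2)
  show ?thesis by (auto simp: has_bochner_integral_iff)
qed

abbreviation eta_dist_sq :: "(real \<Rightarrow> real) \<Rightarrow> (real \<Rightarrow> real) \<Rightarrow> real" where
  "eta_dist_sq f f' \<equiv> (l2_norm (\<lambda>x. f x - eta x))\<^sup>2 + (l2_norm (\<lambda>x. f' x - deta x))\<^sup>2"

lemma remainder_bounds:
  fixes a x :: real
  assumes "\<bar>a\<bar> \<le> 1"
  shows "6 * (eta x)\<^sup>2 * a\<^sup>2 + 4 * eta x * a ^ 3 + a ^ 4 \<le> 9 / 2 * a\<^sup>2"
    "- (6 * (eta x)\<^sup>2 * a\<^sup>2 + 4 * eta x * a ^ 3 + a ^ 4) \<le> 2 * a\<^sup>2"
proof -
  have "(eta x)\<^sup>2 \<le> (1 / 2)\<^sup>2" by (intro power_mono eta_le less_imp_le eta_pos)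
  then have 1: "(eta x)\<^sup>2 * a\<^sup>2 \<le> 1 / 4 * a\<^sup>2" by (intro mult_right_mono) (simp_all add: power_divide)
  have a3: "\<bar>a ^ 3\<bar> \<le> a\<^sup>2"
    using mult_right_mono[OF assms, of "a\<^sup>2"] by (simp add: power3_eq_cube power2_eq_square abs_mult)
  have 2: "\<bar>eta x * a ^ 3\<bar> \<le> 1 / 2 * a\<^sup>2"
  proof -
    have "\<bar>eta x\<bar> \<le> 1 / 2" using eta_le[of x] eta_pos[of x] by linarith
    from mult_mono[OF this a3] show ?thesis by (simp add: abs_mult)
  qed
  have "a\<^sup>2 \<le> 1" using assms by (simp add: abs_square_le_1)
  then have 3: "a ^ 4 \<le> a\<^sup>2"
    using mult_right_mono[of "a\<^sup>2" 1 "a\<^sup>2"] by (simp add: power4_eq_xxxx power2_eq_square mult.assoc)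
  have 4: "0 \<le> (eta x)\<^sup>2 * a\<^sup>2" "0 \<le> a ^ 4" by auto
  show "6 * (eta x)\<^sup>2 * a\<^sup>2 + 4 * eta x * a ^ 3 + a ^ 4 \<le> 9 / 2 * a\<^sup>2"
    "- (6 * (eta x)\<^sup>2 * a\<^sup>2 + 4 * eta x * a ^ 3 + a ^ 4) \<le> 2 * a\<^sup>2"
    using 1 abs_le_D1[OF 2] abs_le_D2[OF 2] 3 4 unfolding mult.assoc by (linarith+)
qed

text \<open>The half line bound, doubled by evenness, controls \<open>e\<close> in L^2. The
  derivative is then recovered from the expansion of the gap, whose potential terms cost at most 9/2
  times the square of the L^2 norm.\<close>

proposition energy_gap_coercive:
  assumes "h1p f f'" "\<And>x. f (- x) = f x" "l2_norm f = 1"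
    and small: "eta_dist_sq f f' \<le> (1 / 64)\<^sup>2"
  shows "eta_dist_sq f f' \<le> 80000 * energy_gap f f'"
proof -
  obtain F where F: "mass_function f f' F" "F 0 = 0"
    using even_mass_function[OF assms(1-3)] by blast
  interpret mass_function f f' F by (rule F)
  define e e' where "e x = f x - eta x" and "e' x = f' x - deta x" for x
  have he: "h1p e e'" unfolding e_def[abs_def] e'_def[abs_def] by (rule h1p_diff[OF assms(1) h1p_eta])
  have fold_e: "(\<lambda>x. f x - eta x) = e" "(\<lambda>x. f' x - deta x) = e'"
    by (auto simp: e_def e'_def)
  have e_add: "f x = eta x + e x" "f' x = deta x + e' x" for x by (simp_all add: e_def e'_def)
  note small' = small[unfolded fold_e]
  have e_le: "\<bar>e x\<bar> \<le> 1 / 64" for x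
  proof -
    have "(e x)\<^sup>2 \<le> (1/64)\<^sup>2" using h1p_sup[OF he, of x] small' by linarith
    then show ?thesis using abs_le_square_iff[of "e x" "1/64"] by simp
  qed
  have "(l2_norm e)\<^sup>2 \<le> (1 / 64)\<^sup>2"
    using small' zero_le_power2[of "l2_norm e'"] by linarith
  then have "l2_norm e \<le> 1 / 64" by (rule power2_le_imp_le) simp
  moreover have "f 0 \<ge> 0" using abs_le_D2[OF e_le[of 0]] by (simp add: e_def eta_0)
  ultimately interpret ngs: near_ground_state f f' F
    by unfold_locales (simp_all add: F(2) assms(3) fold_e)
  have "(l2_norm e)\<^sup>2 = 2 * (LINT x:{0..}|lborel. (e x)\<^sup>2)"
    unfolding l2_norm_sq by (rule even_integral_half) (use h1pD(1)[OF he] assms(2) in \<open>auto dest: L2D simp: e_def\<close>)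
  then have N: "(l2_norm e)\<^sup>2 \<le> 13312 * energy_gap f f'"
    using ngs.half_line_bound by (simp add: energy_gap_eq e_def ngs.e_def)
  have "(LINT x|lborel. 6 * (eta x)\<^sup>2 * (e x)\<^sup>2 + 4 * eta x * e x ^ 3 + e x ^ 4) \<le> (LINT x|lborel. 9 / 2 * (e x)\<^sup>2)"
  proof (intro integral_mono remainder_integrable[OF he] remainder_bounds(1))
    show "\<bar>e x\<bar> \<le> 1" for x using e_le[of x] by linarith
  qed (use h1pD(1)[OF he] in \<open>auto dest: L2D\<close>)
  also have "\<dots> = 9 / 2 * (l2_norm e)\<^sup>2" by (simp add: l2_norm_sq)
  also have "(LINT x|lborel. 6 * (eta x)\<^sup>2 * (e x)\<^sup>2 + 4 * eta x * e x ^ 3 + e x ^ 4)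
      = (l2_norm e')\<^sup>2 + (l2_norm e)\<^sup>2 / 4 - energy_gap f f'"
    using energy_gap_expand(1)[OF assms(1,3) he, OF e_add] by linarith
  finally have "(l2_norm e')\<^sup>2 \<le> energy_gap f f' + 9 / 2 * (l2_norm e)\<^sup>2"
    using zero_le_power2[of "l2_norm e"] by linarith
  moreover have "0 \<le> energy_gap f f'" by (simp add: energy_gap_eq)
  \<comment> \<open>The constant obtained is 1 + (11/2) * 13312 = 73217, rounded up to
    80000.\<close>
  ultimately show ?thesis using N unfolding fold_e by linarith
qed

lemma energy_gap_upper:
  assumes "h1p f f'" "l2_norm f = 1"
    and small: "eta_dist_sq f f' \<le> 1"
  shows "energy_gap f f' \<le> 3 * eta_dist_sq f f'"
proof -
  define e e' where "e x = f x - eta x" and "e' x = f' x - deta x" for x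
  have he: "h1p e e'" unfolding e_def[abs_def] e'_def[abs_def] by (rule h1p_diff[OF assms(1) h1p_eta])
  have fold_e: "(\<lambda>x. f x - eta x) = e" "(\<lambda>x. f' x - deta x) = e'"
    by (auto simp: e_def e'_def)
  have e_add: "f x = eta x + e x" "f' x = deta x + e' x" for x by (simp_all add: e_def e'_def)
  have e_le: "\<bar>e x\<bar> \<le> 1" for x
    using h1p_sup[OF he, of x] small unfolding abs_square_le_1[symmetric] fold_e by linarith
  have "- (LINT x|lborel. 6 * (eta x)\<^sup>2 * (e x)\<^sup>2 + 4 * eta x * e x ^ 3 + e x ^ 4)
      = (LINT x|lborel. - (6 * (eta x)\<^sup>2 * (e x)\<^sup>2 + 4 * eta x * e x ^ 3 + e x ^ 4))"
    by (rule Bochner_Integration.integral_minus[symmetric])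
  also have "\<dots> \<le> (LINT x|lborel. 2 * (e x)\<^sup>2)"
    by (intro integral_mono integrable_minus remainder_integrable[OF he] remainder_bounds(2)[OF e_le])
      (use h1pD(1)[OF he] in \<open>auto dest: L2D\<close>)
  also have "\<dots> = 2 * (l2_norm e)\<^sup>2" by (simp add: l2_norm_sq)
  finally have "energy_gap f f' \<le> (l2_norm e')\<^sup>2 + (l2_norm e)\<^sup>2 / 4 + 2 * (l2_norm e)\<^sup>2"
    using energy_gap_expand(1)[OF assms(1,2) he, OF e_add] by linarith
  then have "energy_gap f f' \<le> 3 * ((l2_norm e)\<^sup>2 + (l2_norm e')\<^sup>2)"
    using zero_le_power2[of "l2_norm e"] zero_le_power2[of "l2_norm e'"] unfolding distrib_left by linarith
  then show ?thesis unfolding fold_e .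
qed

section \<open>One step of the scheme in weak form\<close>

lemma abs_eta_le: "\<bar>eta x\<bar> \<le> 1 / 2"
  using eta_le[of x] eta_pos[of x] by linarith

text \<open>The parameter \<kappa> covers several uses of one linear equation: 1 for the
  unnormalized solution, the reciprocal of its norm after normalization, and 0 for the difference of
  two solutions.\<close>

definition weak_step :: "real \<Rightarrow> real \<Rightarrow> (real \<Rightarrow> real) \<Rightarrow> (real \<Rightarrow> real) \<Rightarrow> (real \<Rightarrow> real) \<Rightarrow> bool" where
  "weak_step \<tau> \<kappa> u w w' \<longleftrightarrow> (\<forall>\<phi> \<phi>'. h1p \<phi> \<phi>' \<longrightarrow>
     ip w \<phi>
       + \<tau> * (ip w' \<phi>' / 2 - (LINT x|lborel. (u x)\<^sup>2 * w x * \<phi> x))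
     = \<kappa> * ip u \<phi>)"

lemmas weak_stepD = weak_step_def[THEN iffD1, rule_format]

locale scheme_step =
  fixes u u' w w' :: "real \<Rightarrow> real" and \<tau> \<kappa> :: real
  assumes hu: "h1p u u'" and hw: "h1p w w'" and nu: "l2_norm u = 1" and nw: "l2_norm w = 1"
    and \<tau>: "0 < \<tau>" "\<tau> \<le> 1 / 2" and \<kappa>: "\<kappa> > 0" and weak: "weak_step \<tau> \<kappa> u w w'"
    and u_le: "\<And>x. \<bar>u x\<bar> \<le> 1"
begin

definition d where "d x = w x - u x"
definition d' where "d' x = w' x - u' x"

lemma hd: "h1p d d'"
  unfolding d_def[abs_def] d'_def[abs_def] by (rule h1p_diff[OF hw hu])

lemmas Lu = h1pD[OF hu] and Lw = h1pD[OF hw] and Ld = h1pD[OF hd]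

lemma uw_L2: "(\<lambda>x. (u x)\<^sup>2 * w x) \<in> L2"
  using h1p_L2_mult[OF hu h1p_L2_mult[OF hu Lw(1)]] by (simp add: power2_eq_square mult.assoc)

lemma ud: "ip u d = - (l2_norm d)\<^sup>2 / 2"
  and wd: "ip w d = (l2_norm d)\<^sup>2 / 2"
proof -
  have i: "integrable lborel (\<lambda>x. (u x)\<^sup>2)" "integrable lborel (\<lambda>x. (d x)\<^sup>2)" "integrable lborel (\<lambda>x. u x * d x)"
    by (intro L2D(2) integrable_L2_mult Lu Ld)+
  have "1 = (LINT x|lborel. (w x)\<^sup>2)" using nw by (simp add: l2_norm_def)
  also have "\<dots> = (LINT x|lborel. (u x)\<^sup>2 + 2 * (u x * d x) + (d x)\<^sup>2)"
    by (intro lint_cong) (auto simp: d_def power2_eq_square algebra_simps)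
  also have "\<dots> = (l2_norm u)\<^sup>2 + 2 * ip u d + (l2_norm d)\<^sup>2"
    using i by (simp add: l2_norm_sq)
  finally show ud: "ip u d = - (l2_norm d)\<^sup>2 / 2" using nu by simp
  have "ip w d = (LINT x|lborel. u x * d x + (d x)\<^sup>2)"
    by (intro lint_cong) (auto simp: d_def power2_eq_square algebra_simps)
  also have "\<dots> = ip u d + (l2_norm d)\<^sup>2"
    using i by (simp add: l2_norm_sq)
  finally show "ip w d = (l2_norm d)\<^sup>2 / 2" using ud by simp
qed

text \<open>The weak equation is tested with the increment \<open>d\<close>; on the unit sphere the
  products of u and w with d are multiples of the squared norm of \<open>d\<close>, which yields the
  dissipation term.\<close>

lemma energy_gap_diff:
  "energy_gap w w' - energy_gap u u' = - (2 / \<tau>) * (1 + \<kappa>) * (l2_norm d)\<^sup>2 - (l2_norm d')\<^sup>2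
    + 2 * (LINT x|lborel. (u x)\<^sup>2 * (d x)\<^sup>2) - (LINT x|lborel. ((w x)\<^sup>2 - (u x)\<^sup>2)\<^sup>2)"
proof -
  define A where "A = ip w' d' / 2 - (LINT x|lborel. (u x)\<^sup>2 * w x * d x)"
  have "(l2_norm d)\<^sup>2 / 2 + \<tau> * A = \<kappa> * (- (l2_norm d)\<^sup>2 / 2)"
    using weak_stepD[OF weak hd] ud wd by (simp add: A_def)
  then have A: "4 * A = - (2 / \<tau>) * (1 + \<kappa>) * (l2_norm d)\<^sup>2"
    using \<tau> by (simp add: field_simps)
  have i: "integrable lborel (\<lambda>x. (u' x)\<^sup>2)" "integrable lborel (\<lambda>x. (d' x)\<^sup>2)" "integrable lborel (\<lambda>x. w' x * d' x)"
    by (intro L2D(2) integrable_L2_mult Lu Ld Lw)+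
  have "(LINT x|lborel. (w' x)\<^sup>2) = (LINT x|lborel. (u' x)\<^sup>2 + 2 * (w' x * d' x) - (d' x)\<^sup>2)"
    by (intro lint_cong) (auto simp: d'_def power2_eq_square algebra_simps)
  also have "\<dots> = (LINT x|lborel. (u' x)\<^sup>2) + 2 * ip w' d' - (l2_norm d')\<^sup>2"
    using i by (simp add: l2_norm_sq)
  finally have 1: "(LINT x|lborel. (w' x)\<^sup>2) = (LINT x|lborel. (u' x)\<^sup>2) + 2 * ip w' d' - (l2_norm d')\<^sup>2" .
  have UD: "(\<lambda>x. u x * d x) \<in> L2" by (rule h1p_L2_mult[OF hu Ld(1)])
  have WU: "(\<lambda>x. (w x)\<^sup>2 - (u x)\<^sup>2) \<in> L2"
    using L2_diff[OF h1p_L2_power[OF hw, of 1] h1p_L2_power[OF hu, of 1]] by (simp add: numeral_2_eq_2)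
  have j: "integrable lborel (\<lambda>x. (u x)\<^sup>2 * w x * d x)" "integrable lborel (\<lambda>x. ((w x)\<^sup>2 - (u x)\<^sup>2)\<^sup>2)"
    by (intro L2D(2) integrable_L2_mult uw_L2 Ld WU)+
  have k: "integrable lborel (\<lambda>x. (u x)\<^sup>2 * (d x)\<^sup>2)" "integrable lborel (\<lambda>x. u x ^ 4)"
    using integrable_L2_mult[OF UD UD] integrable_L2_mult[OF h1p_L2_power[OF hu, of 1] h1p_L2_power[OF hu, of 1]]
    by (auto simp: eval_nat_numeral ac_simps)
  \<comment> \<open>Convexity of the quartic as a function of w^2, made exact: freezing the
    potential at u^2 leaves the square of w^2 - u^2, which enters the energy with a favourable
    sign.\<close>
  have "(LINT x|lborel. w x ^ 4) = (LINT x|lborel. u x ^ 4 + 4 * ((u x)\<^sup>2 * w x * d x) - 2 * ((u x)\<^sup>2 * (d x)\<^sup>2) + ((w x)\<^sup>2 - (u x)\<^sup>2)\<^sup>2)"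
    by (intro lint_cong) (auto simp: d_def power2_eq_square power4_eq_xxxx algebra_simps)
  also have "\<dots> = (LINT x|lborel. u x ^ 4) + 4 * (LINT x|lborel. (u x)\<^sup>2 * w x * d x) - 2 * (LINT x|lborel. (u x)\<^sup>2 * (d x)\<^sup>2)
      + (LINT x|lborel. ((w x)\<^sup>2 - (u x)\<^sup>2)\<^sup>2)"
    using j k by simp
  finally have 2: "(LINT x|lborel. w x ^ 4) = (LINT x|lborel. u x ^ 4) + 4 * (LINT x|lborel. (u x)\<^sup>2 * w x * d x) - 2 * (LINT x|lborel. (u x)\<^sup>2 * (d x)\<^sup>2)
      + (LINT x|lborel. ((w x)\<^sup>2 - (u x)\<^sup>2)\<^sup>2)" .
  show ?thesis
    unfolding A[symmetric] A_def energy_gap_def 1 2 by simp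
qed

lemma energy_decay:
  "energy_gap w w' + (l2_norm d)\<^sup>2 / \<tau> + (l2_norm d')\<^sup>2 \<le> energy_gap u u'"
proof -
  have "(LINT x|lborel. (u x)\<^sup>2 * (d x)\<^sup>2) \<le> (LINT x|lborel. (d x)\<^sup>2)"
  proof (rule integral_mono)
    have UD: "(\<lambda>x. u x * d x) \<in> L2" by (rule h1p_L2_mult[OF hu Ld(1)])
    show "integrable lborel (\<lambda>x. (u x)\<^sup>2 * (d x)\<^sup>2)"
      using integrable_L2_mult[OF UD UD] by (simp add: power2_eq_square ac_simps)
    show "(u x)\<^sup>2 * (d x)\<^sup>2 \<le> (d x)\<^sup>2" for x
      using u_le[of x] mult_right_mono[of "(u x)\<^sup>2" 1 "(d x)\<^sup>2"] by (simp add: abs_square_le_1)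
  qed (rule L2D(2)[OF Ld(1)])
  then have 1: "(LINT x|lborel. (u x)\<^sup>2 * (d x)\<^sup>2) \<le> (l2_norm d)\<^sup>2" by (simp add: l2_norm_sq)
  have 2: "0 \<le> (LINT x|lborel. ((w x)\<^sup>2 - (u x)\<^sup>2)\<^sup>2)" by simp
  \<comment> \<open>This is where \<tau> <= 1/2 enters: 2 pays for the potential term of the
    increment, and 1/\<tau> remains as dissipation.\<close>
  have "2 + 1 / \<tau> \<le> 2 / \<tau>" using \<tau> by (simp add: field_simps)
  also have "\<dots> \<le> 2 / \<tau> * (1 + \<kappa>)" using \<tau> \<kappa> by (simp add: field_simps)
  finally have "(2 + 1 / \<tau>) * (l2_norm d)\<^sup>2 \<le> 2 / \<tau> * (1 + \<kappa>) * (l2_norm d)\<^sup>2"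
    by (rule mult_right_mono) simp
  then have 3: "2 * (l2_norm d)\<^sup>2 + (l2_norm d)\<^sup>2 / \<tau> \<le> 2 / \<tau> * (1 + \<kappa>) * (l2_norm d)\<^sup>2"
    by (simp add: distrib_right)
  show ?thesis using energy_gap_diff 1 2 3 by linarith
qed

end

section \<open>The residual of the stationary equation and the contraction of the gap\<close>

locale near_step = scheme_step +
  assumes w_le: "\<And>x. \<bar>w x\<bar> \<le> 1" and nu': "l2_norm u' \<le> 2" and nw': "l2_norm w' \<le> 2"
    and w_even: "\<And>x. w (- x) = w x"
    and w_close: "eta_dist_sq w w' \<le> (1 / 640000)\<^sup>2"
begin

definition e where "e x = w x - eta x"
definition e' where "e' x = w' x - deta x"

lemma he: "h1p e e'"
  unfolding e_def[abs_def] e'_def[abs_def] by (rule h1p_diff[OF hw h1p_eta])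

lemmas Le = h1pD[OF he]

lemma e_add: "w x = eta x + e x" "w' x = deta x + e' x"
  by (simp_all add: e_def e'_def)

lemma e_close: "(l2_norm e)\<^sup>2 + (l2_norm e')\<^sup>2 \<le> (1 / 640000)\<^sup>2"
  using w_close by (simp only: e_def[abs_def] e'_def[abs_def])

lemma e_le: "\<bar>e x\<bar> \<le> 1 / 640000"
proof -
  have "(e x)\<^sup>2 \<le> (1 / 640000)\<^sup>2" using h1p_sup[OF he, of x] e_close by linarith
  then show ?thesis using abs_le_square_iff[of "e x" "1/640000"] by simp
qed

lemma norm_e_le: "l2_norm e \<le> 1 / 640000"
proof (rule power2_le_imp_le)
  show "(l2_norm e)\<^sup>2 \<le> (1 / 640000)\<^sup>2" using e_close zero_le_power2[of "l2_norm e'"] by linarith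
qed simp

text \<open>Testing with the unit vector \<open>u\<close> isolates \<kappa>; this amounts to a lower
  bound on the norm of the unnormalized solution.\<close>

lemma \<kappa>_le: "\<kappa> \<le> 4"
proof -
  have "(l2_norm u)\<^sup>2 = 1" using nu by simp
  then have "\<kappa> = ip w u + \<tau> * (ip w' u' / 2 - (LINT x|lborel. (u x)\<^sup>2 * w x * u x))"
    using weak_stepD[OF weak hu] unfolding l2_norm_sq by (simp add: power2_eq_square)
  moreover have "\<bar>ip w u\<bar> \<le> 1"
    using cauchy_schwarz[OF Lw(1) Lu(1)] nu nw by simp
  moreover have "\<bar>ip w' u'\<bar> \<le> 4"
    using cauchy_schwarz[OF Lw(2) Lu(2)] mult_mono[OF nw' nu'] by simp
  moreover have "\<bar>LINT x|lborel. (u x)\<^sup>2 * w x * u x\<bar> \<le> 1"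
  proof -
    have "l2_norm (\<lambda>x. (u x)\<^sup>2 * w x) \<le> 1 * l2_norm w"
    proof (rule l2_norm_mono[OF Lw(1) L2D(1)[OF uw_L2]])
      show "\<bar>(u x)\<^sup>2 * w x\<bar> \<le> 1 * \<bar>w x\<bar>" for x
        using u_le[of x] by (simp add: abs_mult mult_left_le_one_le abs_square_le_1)
    qed simp
    then show ?thesis using cauchy_schwarz[OF uw_L2 Lu(1)] nu nw by simp
  qed
  ultimately have "\<kappa> \<le> 1 + \<tau> * (4 / 2 + 1)"
    using \<tau> by (auto intro!: add_mono mult_left_mono)
  then show ?thesis using \<tau> by simp
qed

text \<open>The approximate Lagrange multiplier: since w - \<kappa> u = (1 - \<kappa>) w + \<kappa>
  d, dividing the scheme by \<tau> leaves \<Lambda> w plus a multiple of d / \<tau>. The functional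
  \<open>gradient\<close> below is then the weak residual of the stationary equation at
  \<open>w\<close>.\<close>

definition \<Lambda> where "\<Lambda> = (1 - \<kappa>) / \<tau>"

definition gradient where
  "gradient \<phi> \<phi>' = ip w' \<phi>' / 2 - (LINT x|lborel. w x ^ 3 * \<phi> x) + \<Lambda> * ip w \<phi>"

definition \<Gamma> where "\<Gamma> = 6 / \<tau> * l2_norm d"

lemma \<Gamma>_nonneg: "0 \<le> \<Gamma>"
  using \<tau> by (simp add: \<Gamma>_def)

lemma w3_L2: "(\<lambda>x. w x ^ 3) \<in> L2"
  using h1p_L2_power[OF hw, of 2] by simp

text \<open>The residual has two sources, the discrete time derivative and the potential frozen at
  u^2 instead of w^2. Both are multiples of \<open>d\<close>, so the bound needs only the L^2 norm
  of the test function; 4/\<tau> + 2 <= 6/\<tau> gives the constant in \<Gamma>.\<close>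

lemma abs_gradient:
  assumes "h1p \<phi> \<phi>'"
  shows "\<bar>gradient \<phi> \<phi>'\<bar> \<le> \<Gamma> * l2_norm \<phi>"
proof -
  note L = h1pD[OF assms]
  define X where "X x = (u x + w x) * w x * d x" for x
  have X_le: "\<bar>X x\<bar> \<le> 2 * \<bar>d x\<bar>" for x
  proof -
    have "\<bar>u x + w x\<bar> * \<bar>w x\<bar> \<le> 2 * 1" using u_le[of x] w_le[of x] by (intro mult_mono) auto
    then show ?thesis unfolding X_def abs_mult by (intro mult_right_mono) auto
  qed
  have [measurable]: "u \<in> borel_measurable borel" "w \<in> borel_measurable borel" "d \<in> borel_measurable borel"
    using Lu Lw Ld by (auto dest: L2D)
  have XL2: "X \<in> L2" by (rule L2_dominated[OF Ld(1) _ X_le]) (simp add: X_def[abs_def])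
  have nX: "l2_norm X \<le> 2 * l2_norm d" by (rule l2_norm_mono[OF Ld(1) _ X_le]) (simp_all add: X_def[abs_def])
  have i: "integrable lborel (\<lambda>x. w x * \<phi> x)" "integrable lborel (\<lambda>x. u x * \<phi> x)" "integrable lborel (\<lambda>x. d x * \<phi> x)"
     "integrable lborel (\<lambda>x. (u x)\<^sup>2 * w x * \<phi> x)" "integrable lborel (\<lambda>x. X x * \<phi> x)" "integrable lborel (\<lambda>x. w x ^ 3 * \<phi> x)"
    by (intro integrable_L2_mult L Lw Lu Ld uw_L2 XL2 w3_L2)+
  have w3: "(LINT x|lborel. w x ^ 3 * \<phi> x) = (LINT x|lborel. (u x)\<^sup>2 * w x * \<phi> x) + ip X \<phi>"
    using i by (subst Bochner_Integration.integral_add[symmetric])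
      (auto intro!: lint_cong simp: X_def d_def power2_eq_square power3_eq_cube algebra_simps)
  have wu: "ip w \<phi> = ip u \<phi> + ip d \<phi>"
    using i by (subst Bochner_Integration.integral_add[symmetric])
      (auto intro!: lint_cong simp: d_def algebra_simps)
  have "ip w' \<phi>' / 2 - (LINT x|lborel. (u x)\<^sup>2 * w x * \<phi> x)
      = (\<kappa> * ip u \<phi> - ip w \<phi>) / \<tau>"
    using weak_stepD[OF weak assms] \<tau> by (simp add: field_simps)
  then have "gradient \<phi> \<phi>' = - (\<kappa> / \<tau>) * ip d \<phi> - ip X \<phi>"
    unfolding gradient_def w3 \<Lambda>_def wu using \<tau> by (simp add: field_simps)
  also have "\<bar>\<dots>\<bar> \<le> \<kappa> / \<tau> * \<bar>ip d \<phi>\<bar> + \<bar>ip X \<phi>\<bar>"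
    using \<tau> \<kappa> abs_triangle_ineq4[of "- (\<kappa> / \<tau>) * ip d \<phi>" "LINT x|lborel. X x * \<phi> x"]
    by (simp add: abs_mult)
  also have "\<dots> \<le> 4 / \<tau> * (l2_norm d * l2_norm \<phi>) + 2 * l2_norm d * l2_norm \<phi>"
  proof (intro add_mono mult_mono)
    show "\<bar>ip X \<phi>\<bar> \<le> 2 * l2_norm d * l2_norm \<phi>"
      using cauchy_schwarz[OF XL2 L(1)] mult_right_mono[OF nX, of "l2_norm \<phi>"] by simp
  qed (use \<kappa>_le \<tau> cauchy_schwarz[OF Ld(1) L(1)] in \<open>auto simp: divide_right_mono\<close>)
  also have "\<dots> = (4 / \<tau> + 2) * (l2_norm d * l2_norm \<phi>)" by (simp add: algebra_simps)
  also have "\<dots> \<le> (6 / \<tau>) * (l2_norm d * l2_norm \<phi>)"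
    using \<tau> by (intro mult_right_mono) (auto simp: field_simps)
  finally show ?thesis by (simp add: \<Gamma>_def mult.assoc)
qed

text \<open>To leading order the gap is quadratic in \<open>e\<close>, so twice it equals its
  derivative in direction \<open>e\<close>, in the manner of Euler's identity. What remains is the
  error of the multiplier and terms of third and fourth order.\<close>

lemma gradient_e:
  "2 * gradient e e' = energy_gap w w' + (\<Lambda> - 1 / 8) * (l2_norm e)\<^sup>2
     - (LINT x|lborel. 2 * (eta x * e x ^ 3) + e x ^ 4)"
proof -
  note EX = energy_gap_expand[OF hw nw he e_add]
  note P = h1p_L2_power[OF he, of 1, simplified] h1p_L2_power[OF he, of 2, simplified]
    h1p_L2_power[OF h1p_eta, of 2, simplified]
  have HE: "(\<lambda>x. eta x * e x) \<in> L2" by (rule h1p_L2_mult[OF h1p_eta Le(1)])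
  have i: "integrable lborel (\<lambda>x. eta x * e x)" "integrable lborel (\<lambda>x. eta x ^ 3 * e x)" "integrable lborel (\<lambda>x. (e x)\<^sup>2)"
    "integrable lborel (\<lambda>x. (e' x)\<^sup>2)" "integrable lborel (\<lambda>x. deta x * e' x)" "integrable lborel (\<lambda>x. eta x * e x ^ 3)"
    "integrable lborel (\<lambda>x. (eta x * e x) * (eta x * e x))"
    by (intro integrable_L2_mult L2D(2) eta_L2 deta_L2 Le P HE)+
  have i4: "integrable lborel (\<lambda>x. e x ^ 4)"
    using integrable_L2_mult[OF P(1,1)] by (simp add: eval_nat_numeral ac_simps)
  define a b c q where "a = (LINT x|lborel. eta x ^ 3 * e x)" and "b = (LINT x|lborel. (eta x * e x) * (eta x * e x))"
    and "c = (LINT x|lborel. eta x * e x ^ 3)" and "q = (LINT x|lborel. e x ^ 4)"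
  have "(LINT x|lborel. (eta x / 4 - 2 * eta x ^ 3) * e x) = (LINT x|lborel. 1/4 * (eta x * e x) - 2 * (eta x ^ 3 * e x))"
    by (intro lint_cong) (auto simp: algebra_simps)
  also have "\<dots> = - (l2_norm e)\<^sup>2 / 8 - 2 * a" using i EX(2) by (simp add: a_def)
  finally have de: "ip deta e' = (l2_norm e)\<^sup>2 / 8 + 2 * a" using EX(3) by simp
  have "ip w' e' = (LINT x|lborel. deta x * e' x + (e' x)\<^sup>2)"
    by (simp add: e_add power2_eq_square algebra_simps)
  also have "\<dots> = (l2_norm e)\<^sup>2 / 8 + 2 * a + (l2_norm e')\<^sup>2" using i de by (simp add: l2_norm_sq)
  finally have 1: "ip w' e' = (l2_norm e)\<^sup>2 / 8 + 2 * a + (l2_norm e')\<^sup>2" .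
  have "(LINT x|lborel. w x ^ 3 * e x) = (LINT x|lborel. eta x ^ 3 * e x + 3 * ((eta x * e x) * (eta x * e x)) + 3 * (eta x * e x ^ 3) + e x ^ 4)"
    by (intro lint_cong) (auto simp: e_add power3_eq_cube power4_eq_xxxx algebra_simps)
  also have "\<dots> = a + 3 * b + 3 * c + q" using i i4 by (simp add: a_def b_def c_def q_def)
  finally have 2: "(LINT x|lborel. w x ^ 3 * e x) = a + 3 * b + 3 * c + q" .
  have "ip w e = (LINT x|lborel. eta x * e x + (e x)\<^sup>2)"
    by (simp add: e_add power2_eq_square algebra_simps)
  also have "\<dots> = (l2_norm e)\<^sup>2 / 2" using i EX(2) by (simp add: l2_norm_sq)
  finally have 3: "ip w e = (l2_norm e)\<^sup>2 / 2" .
  have "(LINT x|lborel. 6 * (eta x)\<^sup>2 * (e x)\<^sup>2 + 4 * eta x * e x ^ 3 + e x ^ 4)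
      = (LINT x|lborel. 6 * ((eta x * e x) * (eta x * e x)) + 4 * (eta x * e x ^ 3) + e x ^ 4)"
    by (intro lint_cong) (auto simp: power2_eq_square algebra_simps)
  also have "\<dots> = 6 * b + 4 * c + q" using i i4 by (simp add: b_def c_def q_def)
  finally have 4: "energy_gap w w' = (l2_norm e')\<^sup>2 + (l2_norm e)\<^sup>2 / 4 - (6 * b + 4 * c + q)"
    using EX(1) by simp
  have 5: "(LINT x|lborel. 2 * (eta x * e x ^ 3) + e x ^ 4) = 2 * c + q"
    using i i4 by (simp add: c_def q_def)
  show ?thesis unfolding gradient_def 1 2 3 4 5 by (simp add: algebra_simps)
qed

text \<open>Testing the residual with \<open>eta\<close> and using the equation of
  \<open>eta\<close> leaves (\<Lambda> - 1/8) times the product of \<open>eta\<close> and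
  \<open>w\<close>, up to a term linear in \<open>e\<close>. That product is at least 1/2, whence
  the factor 2.\<close>

lemma abs_\<Lambda>: "\<bar>\<Lambda> - 1 / 8\<bar> \<le> 2 * (\<Gamma> + l2_norm e)"
proof -
  define Y where "Y x = w x * eta x * (eta x + w x)" for x
  have [measurable]: "w \<in> borel_measurable borel" "eta \<in> borel_measurable borel"
    using Lw eta_L2 by (auto dest: L2D)
  have Y_le: "\<bar>Y x\<bar> \<le> 1 * \<bar>w x\<bar>" for x
  proof -
    have "\<bar>eta x + w x\<bar> \<le> 2" using abs_eta_le[of x] w_le[of x] by linarith
    then have "\<bar>eta x\<bar> * \<bar>eta x + w x\<bar> \<le> 1 / 2 * 2" by (intro mult_mono abs_eta_le) auto
    then show ?thesis using mult_left_mono[of _ 1 "\<bar>w x\<bar>"] by (simp add: Y_def abs_mult mult.assoc)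
  qed
  have YL2: "Y \<in> L2" by (rule L2_dominated[OF Lw(1) _ Y_le]) (simp add: Y_def[abs_def])
  have nY: "l2_norm Y \<le> 1 * l2_norm w" by (rule l2_norm_mono[OF Lw(1) _ Y_le]) (simp_all add: Y_def[abs_def])
  have H3: "(\<lambda>x. eta x ^ 3) \<in> L2" using h1p_L2_power[OF h1p_eta, of 2] by simp
  have i: "integrable lborel (\<lambda>x. eta x * w x)" "integrable lborel (\<lambda>x. eta x ^ 3 * w x)" "integrable lborel (\<lambda>x. Y x * e x)"
    "integrable lborel (\<lambda>x. (eta x)\<^sup>2)" "integrable lborel (\<lambda>x. eta x * e x)"
    by (intro integrable_L2_mult L2D(2) eta_L2 H3 Lw YL2 Le)+
  have "ip w' deta = - (LINT x|lborel. w x * (eta x / 4 - 2 * eta x ^ 3))"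
    by (rule h1p_integration_by_parts[OF hw h1p_deta])
  also have "(LINT x|lborel. w x * (eta x / 4 - 2 * eta x ^ 3)) = (LINT x|lborel. 1/4 * (eta x * w x) - 2 * (eta x ^ 3 * w x))"
    by (intro lint_cong) (auto simp: algebra_simps)
  also have "\<dots> = ip eta w / 4 - 2 * (LINT x|lborel. eta x ^ 3 * w x)" using i by simp
  finally have 1: "ip w' deta = 2 * (LINT x|lborel. eta x ^ 3 * w x) - ip eta w / 4" by simp
  have "(LINT x|lborel. w x ^ 3 * eta x) = (LINT x|lborel. eta x ^ 3 * w x + Y x * e x)"
    by (intro lint_cong) (auto simp: Y_def e_def power3_eq_cube algebra_simps)
  also have "\<dots> = (LINT x|lborel. eta x ^ 3 * w x) + ip Y e" using i by simp
  finally have 2: "(LINT x|lborel. w x ^ 3 * eta x) = (LINT x|lborel. eta x ^ 3 * w x) + ip Y e" .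
  have "ip eta w = (LINT x|lborel. (eta x)\<^sup>2 + eta x * e x)"
    by (simp add: e_add power2_eq_square algebra_simps)
  also have "\<dots> = (l2_norm eta)\<^sup>2 + ip eta e" using i by (simp add: l2_norm_sq)
  also have "\<dots> = 1 - (l2_norm e)\<^sup>2 / 2" using energy_gap_expand(2)[OF hw nw he e_add] eta_norm by simp
  finally have 3: "ip eta w = 1 - (l2_norm e)\<^sup>2 / 2" .
  have "(l2_norm e)\<^sup>2 \<le> 1" using norm_e_le by (intro power_le_one) auto
  then have 4: "1 / 2 \<le> ip eta w" using 3 by simp
  have g: "gradient eta deta = (\<Lambda> - 1 / 8) * ip eta w - ip Y e"
    unfolding gradient_def 1 2 by (simp add: algebra_simps diff_divide_distrib)
  have "\<bar>\<Lambda> - 1 / 8\<bar> * (1 / 2) \<le> \<bar>\<Lambda> - 1 / 8\<bar> * ip eta w"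
    by (rule mult_left_mono[OF 4]) simp
  also have "\<dots> = \<bar>(\<Lambda> - 1 / 8) * ip eta w\<bar>" using 4 by (simp add: abs_mult)
  also have "\<dots> \<le> \<Gamma> + l2_norm e"
    using abs_gradient[OF h1p_eta] cauchy_schwarz[OF YL2 Le(1)] mult_right_mono[OF nY, of "l2_norm e"] g
    unfolding eta_norm nw by simp
  finally show ?thesis by simp
qed

text \<open>A Polyak-Lojasiewicz inequality.\<close>

lemma energy_gap_le: "energy_gap w w' \<le> 5120000 * \<Gamma>\<^sup>2"
proof -
  define E where "E = l2_norm e"
  define g where "g = energy_gap w w'"
  have E: "0 \<le> E" "E \<le> 1 / 640000" using norm_e_le by (auto simp: E_def)
  have coercive: "E\<^sup>2 \<le> 80000 * g"
  proof -
    have "(1 / 640000)\<^sup>2 \<le> (1 / 64 :: real)\<^sup>2" by (simp add: power2_eq_square)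
    then have "E\<^sup>2 + (l2_norm e')\<^sup>2 \<le> 80000 * g"
      using energy_gap_coercive[OF hw w_even nw] e_close unfolding E_def g_def e_def[abs_def] e'_def[abs_def] by linarith
    then show ?thesis using zero_le_power2[of "l2_norm e'"] by linarith
  qed
  have cubic: "(LINT x|lborel. 2 * (eta x * e x ^ 3) + e x ^ 4) \<le> 2 / 640000 * E\<^sup>2"
  proof -
    note P = h1p_L2_power[OF he, of 1, simplified] h1p_L2_power[OF he, of 2, simplified]
    have "(LINT x|lborel. 2 * (eta x * e x ^ 3) + e x ^ 4) \<le> (LINT x|lborel. 2 / 640000 * (e x)\<^sup>2)"
    proof (rule integral_mono)
      show "integrable lborel (\<lambda>x. 2 * (eta x * e x ^ 3) + e x ^ 4)"
      proof (intro Bochner_Integration.integrable_add integrable_mult_right integrable_L2_mult eta_L2 P)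
        show "integrable lborel (\<lambda>x. e x ^ 4)"
          using integrable_L2_mult[OF P(1,1)] by (simp add: eval_nat_numeral ac_simps)
      qed
      fix x
      have s: "\<bar>2 * eta x * e x + (e x)\<^sup>2\<bar> \<le> 2 / 640000"
      proof -
        have "\<bar>eta x * e x\<bar> \<le> 1 / 2 * (1 / 640000)"
          unfolding abs_mult by (intro mult_mono abs_eta_le e_le) auto
        moreover have "\<bar>e x * e x\<bar> \<le> 1 * (1 / 640000)"
          unfolding abs_mult using e_le[of x] by (intro mult_mono) auto
        ultimately show ?thesis unfolding power2_eq_square mult.assoc by linarith
      qed
      have "2 * (eta x * e x ^ 3) + e x ^ 4 = (2 * eta x * e x + (e x)\<^sup>2) * (e x)\<^sup>2"
        by (simp add: power2_eq_square power3_eq_cube power4_eq_xxxx algebra_simps)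
      also have "\<dots> \<le> 2 / 640000 * (e x)\<^sup>2" using abs_le_D1[OF s] by (rule mult_right_mono) simp
      finally show "2 * (eta x * e x ^ 3) + e x ^ 4 \<le> 2 / 640000 * (e x)\<^sup>2" .
    qed (use L2D(2)[OF Le(1)] in auto)
    also have "\<dots> = 2 / 640000 * E\<^sup>2" by (simp add: E_def l2_norm_sq)
    finally show ?thesis .
  qed
  have "\<bar>gradient e e'\<bar> \<le> \<Gamma> * E" using abs_gradient[OF he] by (simp add: E_def)
  moreover have "- ((\<Lambda> - 1 / 8) * E\<^sup>2) \<le> 2 * (\<Gamma> + E) * E\<^sup>2"
  proof -
    have "- ((\<Lambda> - 1 / 8) * E\<^sup>2) = (- (\<Lambda> - 1 / 8)) * E\<^sup>2" by (rule mult_minus_left[symmetric])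
    also have "\<dots> \<le> 2 * (\<Gamma> + E) * E\<^sup>2" using abs_\<Lambda> by (intro mult_right_mono) (auto simp: E_def)
    finally show ?thesis .
  qed
  ultimately have "g \<le> 2 * (\<Gamma> * E) + 2 * (\<Gamma> + E) * E\<^sup>2 + 2 / 640000 * E\<^sup>2"
    using gradient_e cubic unfolding g_def[symmetric] E_def[symmetric] by linarith
  also have "2 * (\<Gamma> + E) * E\<^sup>2 \<le> 2 * (\<Gamma> * E) + 2 / 640000 * E\<^sup>2"
  proof -
    have "\<Gamma> * E * E \<le> \<Gamma> * E * 1" using \<Gamma>_nonneg E by (intro mult_left_mono mult_nonneg_nonneg) auto
    moreover have "E * E\<^sup>2 \<le> 1 / 640000 * E\<^sup>2" using E by (intro mult_right_mono) auto
    ultimately show ?thesis by (simp add: algebra_simps power2_eq_square)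
  qed
  finally have "g \<le> 4 * (\<Gamma> * E) + 4 / 640000 * E\<^sup>2" by linarith
  \<comment> \<open>The radius is chosen for this line: by coercivity 4/640000 times E^2 is at most
    4 * 80000 / 640000 = 1/2 times the gap.\<close>
  then have half: "g \<le> 8 * (\<Gamma> * E)" using coercive by simp
  \<comment> \<open>Squaring allows one factor of the gap to be cancelled; 64 * 80000 =
    5120000.\<close>
  have "g\<^sup>2 \<le> 64 * \<Gamma>\<^sup>2 * (80000 * g)"
  proof -
    have g0: "0 \<le> g" using coercive zero_le_power2[of E] by linarith
    have "g\<^sup>2 \<le> (8 * (\<Gamma> * E))\<^sup>2" by (rule power_mono[OF half g0])
    also have "\<dots> = 64 * \<Gamma>\<^sup>2 * E\<^sup>2" by (simp add: power_mult_distrib)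
    also have "\<dots> \<le> 64 * \<Gamma>\<^sup>2 * (80000 * g)" using coercive by (intro mult_left_mono) auto
    finally show ?thesis .
  qed
  then have le: "g * g \<le> (5120000 * \<Gamma>\<^sup>2) * g" by (simp add: power2_eq_square algebra_simps)
  show ?thesis
  proof (cases "g > 0")
    case True
    then show ?thesis using mult_right_le_imp_le[OF le True] by (simp add: g_def)
  next
    case False
    then have "g \<le> 0" by simp
    also have "0 \<le> 5120000 * \<Gamma>\<^sup>2" by simp
    finally show ?thesis by (simp add: g_def)
  qed
qed

text \<open>Since \<Gamma>^2 is 36/\<tau>^2 times the squared norm of \<open>d\<close>, \<tau> times
  the gap is at most 36 * 5120000 = 184320000 times the dissipation, and the dissipation is bounded
  by the energy lost in the step.\<close>

lemma energy_contraction: "(1 + \<tau> / 200000000) * energy_gap w w' \<le> energy_gap u u'"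
proof -
  define g where "g = energy_gap w w'"
  have "\<tau> * g \<le> \<tau> * (5120000 * \<Gamma>\<^sup>2)" using energy_gap_le \<tau> by (intro mult_left_mono) (auto simp: g_def)
  also have "\<dots> = 184320000 * ((l2_norm d)\<^sup>2 / \<tau>)"
    using \<tau> by (simp add: \<Gamma>_def power_mult_distrib power_divide power2_eq_square)
  also have "\<dots> \<le> 200000000 * ((l2_norm d)\<^sup>2 / \<tau>)" using \<tau> by (intro mult_right_mono) auto
  also have "(l2_norm d)\<^sup>2 / \<tau> \<le> energy_gap u u' - g"
    using energy_decay zero_le_power2[of "l2_norm d'"] unfolding g_def by linarith
  finally have "\<tau> * g \<le> 200000000 * (energy_gap u u' - g)" by simp
  then show ?thesis by (simp add: g_def algebra_simps)
qed

end

section \<open>Well-posedness of the implicit step\<close>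

lemma weak_step_cmult: "weak_step \<tau> \<kappa> u w w' \<Longrightarrow> weak_step \<tau> (c * \<kappa>) u (\<lambda>x. c * w x) (\<lambda>x. c * w' x)"
proof -
  assume w: "weak_step \<tau> \<kappa> u w w'"
  show ?thesis
    unfolding weak_step_def
  proof (intro allI impI)
    fix \<phi> \<phi>' assume "h1p \<phi> \<phi>'"
    have "(LINT x|lborel. (u x)\<^sup>2 * (c * w x) * \<phi> x) = (LINT x|lborel. c * ((u x)\<^sup>2 * w x * \<phi> x))"
      by (intro lint_cong) auto
    then have u: "(LINT x|lborel. (u x)\<^sup>2 * (c * w x) * \<phi> x) = c * (LINT x|lborel. (u x)\<^sup>2 * w x * \<phi> x)"
      by simp
    show "(LINT x|lborel. c * w x * \<phi> x) + \<tau> * ((LINT x|lborel. c * w' x * \<phi>' x) / 2 - (LINT x|lborel. (u x)\<^sup>2 * (c * w x) * \<phi> x))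
        = c * \<kappa> * ip u \<phi>"
      using arg_cong[OF weak_stepD[OF w \<open>h1p \<phi> \<phi>'\<close>], of "\<lambda>t. c * t"]
      unfolding u by (simp add: mult.assoc algebra_simps)
  qed
qed

lemma sq_mult_L2:
  assumes "h1p u u'" "f \<in> L2"
  shows "(\<lambda>x. (u x)\<^sup>2 * f x) \<in> L2"
  using h1p_L2_mult[OF assms(1) h1p_L2_mult[OF assms]] by (simp add: power2_eq_square mult.assoc)

lemma weak_step_diff:
  assumes "h1p u u'" "weak_step \<tau> \<kappa> u w w'" "weak_step \<tau> \<kappa> u v v'" "h1p w w'" "h1p v v'"
  shows "weak_step \<tau> 0 u (\<lambda>x. w x - v x) (\<lambda>x. w' x - v' x)"
  unfolding weak_step_def
proof (intro allI impI)
  fix \<phi> \<phi>' assume \<phi>: "h1p \<phi> \<phi>'"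
  note L = h1pD[OF assms(4)] h1pD[OF assms(5)] h1pD[OF \<phi>]
  have i: "integrable lborel (\<lambda>x. w x * \<phi> x)" "integrable lborel (\<lambda>x. v x * \<phi> x)"
    "integrable lborel (\<lambda>x. w' x * \<phi>' x)" "integrable lborel (\<lambda>x. v' x * \<phi>' x)"
    "integrable lborel (\<lambda>x. (u x)\<^sup>2 * w x * \<phi> x)" "integrable lborel (\<lambda>x. (u x)\<^sup>2 * v x * \<phi> x)"
    by (intro integrable_L2_mult L sq_mult_L2[OF assms(1)])+
  show "(LINT x|lborel. (w x - v x) * \<phi> x) + \<tau> * ((LINT x|lborel. (w' x - v' x) * \<phi>' x) / 2 - (LINT x|lborel. (u x)\<^sup>2 * (w x - v x) * \<phi> x))
      = 0 * ip u \<phi>"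
    using weak_stepD[OF assms(2) \<phi>] weak_stepD[OF assms(3) \<phi>] i
    by (simp add: left_diff_distrib right_diff_distrib diff_divide_distrib)
qed

text \<open>The difference of two solutions, tested with itself, has a potential term of at most
  \<tau> <= 1/2 times its own squared norm.\<close>

lemma weak_step_unique:
  assumes hu: "h1p u u'" and u_le: "\<And>x. \<bar>u x\<bar> \<le> 1" and \<tau>: "0 < \<tau>" "\<tau> \<le> 1 / 2"
    and "weak_step \<tau> \<kappa> u w w'" "weak_step \<tau> \<kappa> u v v'" "h1p w w'" "h1p v v'"
  shows "w = v"
proof -
  define d d' where "d x = w x - v x" and "d' x = w' x - v' x" for x
  have hd: "h1p d d'" unfolding d_def[abs_def] d'_def[abs_def] by (rule h1p_diff[OF assms(7,8)])
  note L = h1pD[OF hd]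
  have "weak_step \<tau> 0 u d d'"
    unfolding d_def[abs_def] d'_def[abs_def] by (rule weak_step_diff[OF hu assms(5-8)])
  from weak_stepD[OF this hd]
  have eq: "(l2_norm d)\<^sup>2 + \<tau> * ((l2_norm d')\<^sup>2 / 2) = \<tau> * (LINT x|lborel. (u x)\<^sup>2 * d x * d x)"
    unfolding l2_norm_sq unfolding power2_eq_square by (simp add: algebra_simps)
  have "(LINT x|lborel. (u x)\<^sup>2 * d x * d x) \<le> (LINT x|lborel. (d x)\<^sup>2)"
  proof (rule integral_mono)
    show "(u x)\<^sup>2 * d x * d x \<le> (d x)\<^sup>2" for x
    proof -
      have "(u x)\<^sup>2 \<le> 1" using u_le[of x] by (simp add: abs_square_le_1)
      then have "(u x)\<^sup>2 * (d x)\<^sup>2 \<le> 1 * (d x)\<^sup>2" by (rule mult_right_mono) simp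
      then show ?thesis by (simp add: power2_eq_square mult.assoc)
    qed
  qed (intro integrable_L2_mult sq_mult_L2[OF hu] L L2D(2))+
  then have le: "(LINT x|lborel. (u x)\<^sup>2 * d x * d x) \<le> (l2_norm d)\<^sup>2" by (simp add: l2_norm_sq)
  have "\<tau> * (LINT x|lborel. (u x)\<^sup>2 * d x * d x) \<le> \<tau> * (l2_norm d)\<^sup>2"
    using \<tau> le by (intro mult_left_mono) auto
  also have "\<dots> \<le> 1 / 2 * (l2_norm d)\<^sup>2" using \<tau> by (intro mult_right_mono) auto
  finally have "(l2_norm d)\<^sup>2 + \<tau> * ((l2_norm d')\<^sup>2 / 2) \<le> 1 / 2 * (l2_norm d)\<^sup>2" using eq by simp
  moreover have "0 \<le> \<tau> * ((l2_norm d')\<^sup>2 / 2)" using \<tau> by simp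
  ultimately have "(l2_norm d)\<^sup>2 \<le> 0" by linarith
  then have "l2_norm d = 0" by simp
  then have "AE x in lborel. d x = 0" by (rule l2_norm_eq_0_AE[OF L(1)])
  then have "AE x in lborel. w x = v x" by (simp add: d_def)
  then show ?thesis
    by (rule AE_eq_continuous[OF ac_continuous[OF h1pD(3)[OF assms(7)]] ac_continuous[OF h1pD(3)[OF assms(8)]]])
qed

lemma lborel_integral_reflect: "(LINT x|lborel. f (- x)) = (LINT x|lborel. f x)" for f :: "real \<Rightarrow> real"
  using lborel_integral_real_affine[of "-1" f 0] by simp

text \<open>Together with uniqueness this makes the solution even whenever \<open>u\<close>
  is.\<close>

lemma weak_step_reflect:
  assumes "weak_step \<tau> \<kappa> u w w'" "\<And>x. u (- x) = u x"
  shows "weak_step \<tau> \<kappa> u (\<lambda>x. w (- x)) (\<lambda>x. - w' (- x))"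
  unfolding weak_step_def
proof (intro allI impI)
  fix \<phi> \<phi>' assume "h1p \<phi> \<phi>'"
  from weak_stepD[OF assms(1) h1p_reflect[OF this]]
  show "(LINT x|lborel. w (- x) * \<phi> x) + \<tau> * ((LINT x|lborel. - w' (- x) * \<phi>' x) / 2 - (LINT x|lborel. (u x)\<^sup>2 * w (- x) * \<phi> x))
      = \<kappa> * ip u \<phi>"
    using lborel_integral_reflect[of "\<lambda>x. w x * \<phi> (- x)"] lborel_integral_reflect[of "\<lambda>x. w' x * \<phi>' (- x)"]
      lborel_integral_reflect[of "\<lambda>x. (u x)\<^sup>2 * w x * \<phi> (- x)"] lborel_integral_reflect[of "\<lambda>x. u x * \<phi> (- x)"]
    by (simp add: assms(2))
qed

text \<open>The step provides only locally integrable weak derivatives, and test functions in H^1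
  require more. The equation itself supplies the missing regularity.\<close>

lemma implicit_step_weak:
  assumes hu: "h1p u u'" and \<psi>: "AE x in lborel. \<psi> x = u x" and \<tau>: "0 < \<tau>" and "implicit_step \<tau> \<psi> \<psi>s"
  obtains v v' where "h1p v v'" "AE x in lborel. \<psi>s x = v x" "weak_step \<tau> 1 u v v'"
proof -
  obtain g w where H: "\<psi>s \<in> H1" and g: "has_weak_deriv \<psi>s g" and w: "has_weak_deriv g w"
    and eq: "AE x in lborel. \<psi>s x = \<psi> x + \<tau> * (1 / 2 * w x + \<bar>\<psi> x\<bar>\<^sup>2 * \<psi>s x)"
    using assms(4) by (auto simp: implicit_step_def has_weak_laplacian_def)
  obtain v v1 where v: "h1p v v1" "AE x in lborel. \<psi>s x = v x" using H1_representative[OF H] by blast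
  have \<psi>s: "\<psi>s \<in> borel_measurable borel" using H by (auto simp: H1_def L2_def)
  have gv: "AE x in lborel. g x = v1 x"
    by (rule has_weak_deriv_unique[OF g ac_cong_has_weak_deriv[OF h1pD(3)[OF v(1)] \<psi>s v(2)]])
  obtain g0 where g0: "ac g0 w" "AE x in lborel. g x = g0 x" using has_weak_deriv_ac[OF w] by blast
  have v1: "AE x in lborel. v1 x = g0 x" using gv g0(2) by eventually_elim simp
  have hv: "h1p v g0"
    using v(1) v1 ac_borel[OF g0(1)] by (auto simp: h1p_def intro: ac_cong_AE L2_cong_AE)
  \<comment> \<open>The equation solved for the Laplacian. The right side is square integrable, so
    the derivative \<open>g0\<close> is in H^1 and integration by parts against any H^1 function is
    legitimate.\<close>
  define W where "W x = 2 / \<tau> * (v x - u x) - 2 * ((u x)\<^sup>2 * v x)" for x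
  have W: "W \<in> L2"
    unfolding W_def[abs_def] by (intro L2_diff L2_cmult sq_mult_L2[OF hu] h1pD[OF hv] h1pD[OF hu])
  have Ww: "AE x in lborel. W x = w x"
    using eq v(2) \<psi> by eventually_elim (use \<tau> in \<open>simp add: W_def field_simps\<close>)
  have hw: "h1p g0 w"
    using W Ww g0(1) hv by (auto simp: h1p_def intro: L2_cong_AE ac_deriv_borel)
  have "weak_step \<tau> 1 u v g0"
    unfolding weak_step_def
  proof (intro allI impI)
    fix \<phi> \<phi>' assume \<phi>: "h1p \<phi> \<phi>'"
    note L = h1pD[OF hv] h1pD[OF hu] h1pD[OF \<phi>]
    have i: "integrable lborel (\<lambda>x. v x * \<phi> x)" "integrable lborel (\<lambda>x. u x * \<phi> x)" "integrable lborel (\<lambda>x. (u x)\<^sup>2 * v x * \<phi> x)"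
      by (intro integrable_L2_mult L sq_mult_L2[OF hu])+
    have "ip g0 \<phi>' = - ip w \<phi>"
      using h1p_integration_by_parts[OF hw \<phi>] by simp
    also have "ip w \<phi> = ip W \<phi>"
    proof (rule integral_cong_AE)
      show "AE x in lborel. w x * \<phi> x = W x * \<phi> x" using Ww by eventually_elim simp
    qed (use L2D(1)[OF W] L2D(1)[OF L(7)] ac_deriv_borel[OF g0(1)] in measurable)
    also have "\<dots> = (LINT x|lborel. 2 / \<tau> * (v x * \<phi> x) - 2 / \<tau> * (u x * \<phi> x) - 2 * ((u x)\<^sup>2 * v x * \<phi> x))"
      by (intro lint_cong) (auto simp: W_def algebra_simps diff_divide_distrib)
    also have "\<dots> = 2 / \<tau> * ip v \<phi> - 2 / \<tau> * ip u \<phi> - 2 * (LINT x|lborel. (u x)\<^sup>2 * v x * \<phi> x)"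
      using i by simp
    finally show "ip v \<phi> + \<tau> * (ip g0 \<phi>' / 2 - (LINT x|lborel. (u x)\<^sup>2 * v x * \<phi> x))
      = 1 * ip u \<phi>"
      using \<tau> by (simp add: field_simps)
  qed
  with hv v(2) that show ?thesis by blast
qed

section \<open>Bounded solutions of w' = h - a w on the whole line\<close>

lemma bounded_solution_le:
  fixes w h :: "real \<Rightarrow> real"
  assumes a: "a > 0" and w: "\<And>x. (w has_real_derivative (h x - a * w x)) (at x)"
    and M: "\<And>x. \<bar>w x\<bar> \<le> M" and h: "\<And>x. h x \<le> B"
  shows "w x \<le> B / a"
proof (rule tendsto_lowerbound)
  \<comment> \<open>Integrating factor. Sending y to minus infinity removes the starting value,
    because \<open>w\<close> is bounded and exp(a y) tends to 0.\<close>
  have anti: "exp (a * x) * (w x - B / a) \<le> exp (a * y) * (w y - B / a)" if "y \<le> x" for x y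
  proof (rule DERIV_nonpos_imp_nonincreasing[OF that])
    fix t
    have "((\<lambda>t. exp (a * t) * (w t - B / a)) has_real_derivative exp (a * t) * (h t - B)) (at t)"
      using a by (auto intro!: derivative_eq_intros w simp: field_simps)
    moreover have "exp (a * t) * (h t - B) \<le> 0" using h[of t] by (simp add: mult_le_0_iff)
    ultimately show "\<exists>z. ((\<lambda>t. exp (a * t) * (w t - B / a)) has_real_derivative z) (at t) \<and> z \<le> 0" by blast
  qed
  show "\<forall>\<^sub>F y in at_bot. w x \<le> B / a + exp (a * y) * (exp (- (a * x)) * (M + \<bar>B / a\<bar>))"
  proof (rule eventually_at_bot_linorderI[of x])
    fix y assume "y \<le> x"
    have "w x - B / a = exp (- (a * x)) * (exp (a * x) * (w x - B / a))" by (simp flip: exp_add mult.assoc)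
    also have "\<dots> \<le> exp (- (a * x)) * (exp (a * y) * (w y - B / a))"
      using anti[OF \<open>y \<le> x\<close>] by (rule mult_left_mono) simp
    also have "\<dots> \<le> exp (- (a * x)) * (exp (a * y) * (M + \<bar>B / a\<bar>))"
      using M[of y] by (intro mult_left_mono) (auto simp: abs_if split: if_splits)
    finally show "w x \<le> B / a + exp (a * y) * (exp (- (a * x)) * (M + \<bar>B / a\<bar>))" by (simp add: mult_ac)
  qed
  have "((\<lambda>y. exp (a * y)) \<longlongrightarrow> 0) at_bot"
    using a by (intro filterlim_compose[OF exp_at_bot] filterlim_tendsto_pos_mult_at_bot[OF tendsto_const _ filterlim_ident]) auto
  then have "((\<lambda>y. B / a + exp (a * y) * (exp (- (a * x)) * (M + \<bar>B / a\<bar>))) \<longlongrightarrow> B / a + 0 * (exp (- (a * x)) * (M + \<bar>B / a\<bar>))) at_bot"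
    by (intro tendsto_intros)
  then show "((\<lambda>y. B / a + exp (a * y) * (exp (- (a * x)) * (M + \<bar>B / a\<bar>))) \<longlongrightarrow> B / a) at_bot" by simp
qed simp

lemma bounded_solution_bound:
  fixes w h :: "real \<Rightarrow> real"
  assumes a: "a > 0" and w: "\<And>x. (w has_real_derivative (h x - a * w x)) (at x)"
    and M: "\<And>x. \<bar>w x\<bar> \<le> M" and h: "\<And>x. \<bar>h x\<bar> \<le> B"
  shows "\<bar>w x\<bar> \<le> B / a"
proof -
  have "w x \<le> B / a" by (rule bounded_solution_le[OF a w M]) (use h abs_le_D1 in blast)
  moreover have "- w x \<le> B / a"
  proof (rule bounded_solution_le[OF a, of "\<lambda>x. - w x" "\<lambda>x. - h x" M])
    show "((\<lambda>x. - w x) has_real_derivative (- h x - a * - w x)) (at x)" for x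
      by (auto intro!: derivative_eq_intros w)
  qed (use M h abs_le_D2 in auto)
  ultimately show ?thesis by (simp add: abs_le_iff)
qed

text \<open>Variation of constants started at minus infinity: w = exp(-a x) (Q - l), where Q is a
  primitive of exp(a x) h and l is its limit at minus infinity.\<close>

lemma bounded_solution_exists:
  fixes h :: "real \<Rightarrow> real"
  assumes a: "a > 0" and cont: "continuous_on UNIV h" and h: "\<And>x. \<bar>h x\<bar> \<le> B"
  obtains w where "\<And>x. (w has_real_derivative (h x - a * w x)) (at x)" "\<And>x. \<bar>w x\<bar> \<le> B / a"
proof -
  have "isCont (\<lambda>x. exp (a * x) * h x) x" for x
    using cont by (auto intro!: continuous_intros simp: continuous_on_eq_continuous_at)
  then obtain Q where "\<And>x. (Q has_vector_derivative (exp (a * x) * h x)) (at x)"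
    using einterval_antiderivative[of "-\<infinity>" "\<infinity>" "\<lambda>x. exp (a * x) * h x"] by auto
  then have Q: "(Q has_real_derivative (exp (a * x) * h x)) (at x)" for x
    by (simp add: has_real_derivative_iff_has_vector_derivative)
  have hB: "h x \<le> B" "- B \<le> h x" for x using h[of x] by (auto simp: abs_le_iff)
  have up: "Q y + B / a * exp (a * y) \<le> Q x + B / a * exp (a * x)" if "y \<le> x" for x y
  proof (rule DERIV_nonneg_imp_nondecreasing[OF that])
    fix t
    have "((\<lambda>t. Q t + B / a * exp (a * t)) has_real_derivative exp (a * t) * (h t + B)) (at t)"
      using a by (auto intro!: derivative_eq_intros Q simp: field_simps)
    moreover have "0 \<le> exp (a * t) * (h t + B)" using hB(2)[of t] by simp
    ultimately show "\<exists>z. ((\<lambda>t. Q t + B / a * exp (a * t)) has_real_derivative z) (at t) \<and> 0 \<le> z" by blast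
  qed
  have down: "Q x - B / a * exp (a * x) \<le> Q y - B / a * exp (a * y)" if "y \<le> x" for x y
  proof (rule DERIV_nonpos_imp_nonincreasing[OF that])
    fix t
    have "((\<lambda>t. Q t - B / a * exp (a * t)) has_real_derivative exp (a * t) * (h t - B)) (at t)"
      using a by (auto intro!: derivative_eq_intros Q simp: field_simps)
    moreover have "exp (a * t) * (h t - B) \<le> 0" using hB(1)[of t] by (simp add: mult_le_0_iff)
    ultimately show "\<exists>z. ((\<lambda>t. Q t - B / a * exp (a * t)) has_real_derivative z) (at t) \<and> z \<le> 0" by blast
  qed
  have B: "0 \<le> B / a" using h[of 0] a by (simp add: order_trans[OF abs_ge_zero])
  have cross: "Q x - B / a * exp (a * x) \<le> Q y + B / a * exp (a * y)" for x y
  proof (cases "y \<le> x")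
    case True
    have "0 \<le> B / a * exp (a * y)" using B by (intro mult_nonneg_nonneg) auto
    then show ?thesis using down[OF True] by linarith
  next
    case False
    have "0 \<le> B / a * exp (a * x)" using B by (intro mult_nonneg_nonneg) auto
    then show ?thesis using up[of x y] False by linarith
  qed
  \<comment> \<open>Q + (B/a) exp(a y) is increasing and Q - (B/a) exp(a y) is decreasing, so this
    infimum is the limit of Q and comes with the error bound (B/a) exp(a x).\<close>
  define l where "l = (INF y. Q y + B / a * exp (a * y))"
  have l1: "l \<le> Q x + B / a * exp (a * x)" for x
    unfolding l_def by (rule cINF_lower) (use cross[of 0] in \<open>auto simp: bdd_below_def\<close>)
  have l2: "Q x - B / a * exp (a * x) \<le> l" for x
    unfolding l_def by (rule cINF_greatest) (use cross in auto)
  show ?thesis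
  proof
    show "((\<lambda>x. exp (- (a * x)) * (Q x - l)) has_real_derivative (h x - a * (exp (- (a * x)) * (Q x - l)))) (at x)" for x
    proof -
      have "exp (- (a * x)) * (exp (a * x) * h x) = h x" by (simp flip: exp_add mult.assoc)
      then show ?thesis by (auto intro!: derivative_eq_intros Q simp: algebra_simps)
    qed
    show "\<bar>exp (- (a * x)) * (Q x - l)\<bar> \<le> B / a" for x
    proof -
      have "\<bar>Q x - l\<bar> \<le> B / a * exp (a * x)" using l1[of x] l2[of x] by (simp add: abs_le_iff)
      then have "exp (- (a * x)) * \<bar>Q x - l\<bar> \<le> exp (- (a * x)) * (B / a * exp (a * x))" by (rule mult_left_mono) simp
      also have "\<dots> = B / a * (exp (- (a * x)) * exp (a * x))" by (simp only: mult_ac)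
      also have "\<dots> = B / a" by (simp flip: exp_add)
      finally show ?thesis by (simp add: abs_mult)
    qed
  qed
qed

text \<open>Energy estimate: (w^2)' <= h^2 / a - a w^2 pointwise, by completing a square. Integrated
  over [-n, n], the boundedness of \<open>w\<close> controls the boundary term uniformly in
  n.\<close>

lemma bounded_solution_L2:
  fixes w h :: "real \<Rightarrow> real"
  assumes a: "a > 0" and w: "\<And>x. (w has_real_derivative (h x - a * w x)) (at x)"
    and M: "\<And>x. \<bar>w x\<bar> \<le> M" and cont: "continuous_on UNIV h" and h: "h \<in> L2"
  shows "w \<in> L2"
proof -
  have cw: "continuous_on UNIV w" using w by (auto intro!: continuous_at_imp_continuous_on DERIV_isCont)
  define q' where "q' x = 2 * (w x * (h x - a * w x))" for x
  have acq: "ac (\<lambda>x. (w x)\<^sup>2) q'"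
  proof (rule ac_of_deriv)
    show "((\<lambda>x. (w x)\<^sup>2) has_real_derivative q' x) (at x)" for x
      unfolding q'_def by (auto intro!: derivative_eq_intros w)
    show "continuous_on UNIV q'" unfolding q'_def[abs_def] by (intro continuous_intros cw cont)
  qed
  have lw: "locally_integrable (\<lambda>x. (w x)\<^sup>2)" by (intro locally_integrable_continuous continuous_intros cw)
  have lh: "locally_integrable (\<lambda>x. (h x)\<^sup>2)" by (intro locally_integrable_continuous continuous_intros cont)
  have "integrable lborel (\<lambda>x. (w x)\<^sup>2)"
  proof (rule integrable_if_bounded_integrals[OF lw])
    fix n :: nat
    let ?I = "{- real n..real n}"
    have "(w (real n))\<^sup>2 - (w (- real n))\<^sup>2 = (LINT x:?I|lborel. q' x)"
      using acD(2)[OF acq, of "- real n" "real n"] by simp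
    also have "\<dots> \<le> (LINT x:?I|lborel. 1 / a * (h x)\<^sup>2 - a * (w x)\<^sup>2)"
    proof (rule set_integral_mono)
      show "set_integrable lborel ?I q'" by (intro locally_integrableD acD[OF acq])
      show "set_integrable lborel ?I (\<lambda>x. 1 / a * (h x)\<^sup>2 - a * (w x)\<^sup>2)"
        by (intro locally_integrableD locally_integrable_diff locally_integrable_cmult lw lh)
      fix x
      have "0 \<le> (h x - a * w x)\<^sup>2 / a" using a by simp
      also have "\<dots> = 1 / a * (h x)\<^sup>2 - a * (w x)\<^sup>2 - q' x"
        using a by (simp add: q'_def power2_eq_square field_simps)
      finally show "q' x \<le> 1 / a * (h x)\<^sup>2 - a * (w x)\<^sup>2" by simp
    qed
    also have "\<dots> = 1 / a * (LINT x:?I|lborel. (h x)\<^sup>2) - a * (LINT x:?I|lborel. (w x)\<^sup>2)"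
      using set_integral_diff(2)[OF locally_integrableD[OF locally_integrable_cmult[OF lh, of "1/a"]] locally_integrableD[OF locally_integrable_cmult[OF lw, of a]], of "- real n" "real n"]
      by (simp only: set_integral_mult_right)
    finally have "a * (LINT x:?I|lborel. (w x)\<^sup>2) \<le> 1 / a * (LINT x:?I|lborel. (h x)\<^sup>2) + (w (- real n))\<^sup>2"
      using zero_le_power2[of "w (real n)"] by linarith
    also have "(LINT x:?I|lborel. (h x)\<^sup>2) \<le> (l2_norm h)\<^sup>2"
      unfolding l2_norm_sq set_lebesgue_integral_def using locally_integrableD[OF lh, of "- real n" "real n"] L2D(2)[OF h]
      by (intro integral_mono) (auto simp: set_integrable_def split: split_indicator)
    also have "(w (- real n))\<^sup>2 \<le> M\<^sup>2" using power_mono[OF M[of "- real n"], of 2] by simp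
    finally show "(LINT x:?I|lborel. (w x)\<^sup>2) \<le> (1 / a * (l2_norm h)\<^sup>2 + M\<^sup>2) / a"
      using a by (simp add: field_simps)
  qed simp
  then show ?thesis by (intro L2I borel_measurable_continuous_onI cw)
qed

text \<open>
  The resolvent \<open>v = (1 - a\<^sup>-\<^sup>2 \<partial>\<^sub>x\<^sub>x)\<^sup>-\<^sup>1 h\<close> and its derivative \<open>z\<close>. The combinations
  \<open>v/a - z/a\<^sup>2\<close> and \<open>v/a + z/a\<^sup>2\<close> solve the first order equations \<open>w' = h - a w\<close> and \<open>w' = a w - h\<close>.
\<close>

definition resolvent :: "real \<Rightarrow> (real \<Rightarrow> real) \<Rightarrow> (real \<Rightarrow> real) \<Rightarrow> (real \<Rightarrow> real) \<Rightarrow> bool" where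
  "resolvent a h v z \<longleftrightarrow> (\<forall>x. (v has_real_derivative z x) (at x)) \<and>
     (\<forall>x. (z has_real_derivative a\<^sup>2 * (v x - h x)) (at x)) \<and> (\<exists>M. \<forall>x. \<bar>v x\<bar> \<le> M \<and> \<bar>z x\<bar> \<le> M)"

lemma has_deriv_reflect:
  fixes f f' :: "real \<Rightarrow> real"
  assumes "\<And>x. (f has_real_derivative f' x) (at x)"
  shows "((\<lambda>x. f (- x)) has_real_derivative - f' (- x)) (at x)"
proof -
  have "((\<lambda>x. f (- x)) has_real_derivative f' (- x) * - 1) (at x)"
    by (rule DERIV_chain2[OF assms]) (auto intro!: derivative_eq_intros)
  then show ?thesis by simp
qed

lemma resolvent_first_order:
  assumes "resolvent a h v z" "a > 0"
  obtains M where
    "\<And>x. ((\<lambda>x. v x / a - z x / a\<^sup>2) has_real_derivative (h x - a * (v x / a - z x / a\<^sup>2))) (at x)"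
    "\<And>x. ((\<lambda>x. v (- x) / a + z (- x) / a\<^sup>2) has_real_derivative (h (- x) - a * (v (- x) / a + z (- x) / a\<^sup>2))) (at x)"
    "\<And>x. \<bar>v x / a - z x / a\<^sup>2\<bar> \<le> M" "\<And>x. \<bar>v (- x) / a + z (- x) / a\<^sup>2\<bar> \<le> M"
proof -
  have v: "\<And>x. (v has_real_derivative z x) (at x)" and z: "\<And>x. (z has_real_derivative a\<^sup>2 * (v x - h x)) (at x)"
    using assms(1) by (auto simp: resolvent_def)
  obtain M where M: "\<And>x. \<bar>v x\<bar> \<le> M" "\<And>x. \<bar>z x\<bar> \<le> M" using assms(1) by (auto simp: resolvent_def)
  have abs: "\<bar>v x / a\<bar> \<le> M / a" "\<bar>z x / a\<^sup>2\<bar> \<le> M / a\<^sup>2" for x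
    using M assms(2) by (auto simp: divide_right_mono)
  show thesis
  proof
    show "((\<lambda>x. v x / a - z x / a\<^sup>2) has_real_derivative (h x - a * (v x / a - z x / a\<^sup>2))) (at x)" for x
      using assms(2) by (auto intro!: derivative_eq_intros v z simp: field_simps power2_eq_square)
    show "((\<lambda>x. v (- x) / a + z (- x) / a\<^sup>2) has_real_derivative (h (- x) - a * (v (- x) / a + z (- x) / a\<^sup>2))) (at x)" for x
      using assms(2) by (auto intro!: derivative_eq_intros has_deriv_reflect[OF v] has_deriv_reflect[OF z] simp: field_simps power2_eq_square)
    show "\<bar>v x / a - z x / a\<^sup>2\<bar> \<le> M / a + M / a\<^sup>2" for x using abs[of x] by linarith
    show "\<bar>v (- x) / a + z (- x) / a\<^sup>2\<bar> \<le> M / a + M / a\<^sup>2" for x using abs[of "- x"] by linarith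
  qed
qed

text \<open>A maximum principle without loss of constant: v/a is the mean of the two first order
  solutions, each bounded by B/a.\<close>

lemma resolvent_bound:
  assumes "resolvent a h v z" "a > 0" "\<And>x. \<bar>h x\<bar> \<le> B"
  shows "\<bar>v x\<bar> \<le> B"
proof -
  obtain M where M:
    "\<And>x. ((\<lambda>x. v x / a - z x / a\<^sup>2) has_real_derivative (h x - a * (v x / a - z x / a\<^sup>2))) (at x)"
    "\<And>x. ((\<lambda>x. v (- x) / a + z (- x) / a\<^sup>2) has_real_derivative (h (- x) - a * (v (- x) / a + z (- x) / a\<^sup>2))) (at x)"
    "\<And>x. \<bar>v x / a - z x / a\<^sup>2\<bar> \<le> M" "\<And>x. \<bar>v (- x) / a + z (- x) / a\<^sup>2\<bar> \<le> M"
    using resolvent_first_order[OF assms(1,2)] by blast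
  have 1: "\<bar>v x / a - z x / a\<^sup>2\<bar> \<le> B / a" by (rule bounded_solution_bound[OF assms(2) M(1,3) assms(3)])
  have "\<bar>v (- (- x)) / a + z (- (- x)) / a\<^sup>2\<bar> \<le> B / a" by (rule bounded_solution_bound[OF assms(2) M(2,4) assms(3)])
  then have "\<bar>v x / a + z x / a\<^sup>2\<bar> \<le> B / a" by simp
  with 1 have "\<bar>v x / a\<bar> \<le> B / a" by linarith
  then show ?thesis using assms(2) by (simp add: divide_le_cancel)
qed

lemma resolvent_L2:
  assumes "resolvent a h v z" "a > 0" "continuous_on UNIV h" "h \<in> L2"
  shows "v \<in> L2" "z \<in> L2"
proof -
  obtain M where M:
    "\<And>x. ((\<lambda>x. v x / a - z x / a\<^sup>2) has_real_derivative (h x - a * (v x / a - z x / a\<^sup>2))) (at x)"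
    "\<And>x. ((\<lambda>x. v (- x) / a + z (- x) / a\<^sup>2) has_real_derivative (h (- x) - a * (v (- x) / a + z (- x) / a\<^sup>2))) (at x)"
    "\<And>x. \<bar>v x / a - z x / a\<^sup>2\<bar> \<le> M" "\<And>x. \<bar>v (- x) / a + z (- x) / a\<^sup>2\<bar> \<le> M"
    using resolvent_first_order[OF assms(1,2)] by blast
  have 1: "(\<lambda>x. v x / a - z x / a\<^sup>2) \<in> L2" by (rule bounded_solution_L2[OF assms(2) M(1,3) assms(3,4)])
  have "continuous_on UNIV (\<lambda>x. h (- x))"
    by (rule continuous_on_compose2[OF assms(3)]) (auto intro!: continuous_intros)
  then have "(\<lambda>x. v (- x) / a + z (- x) / a\<^sup>2) \<in> L2"
    by (rule bounded_solution_L2[OF assms(2) M(2,4) _ L2_reflect[OF assms(4)]])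
  from L2_reflect[OF this] have 2: "(\<lambda>x. v x / a + z x / a\<^sup>2) \<in> L2" by simp
  have "v = (\<lambda>x. a / 2 * ((v x / a - z x / a\<^sup>2) + (v x / a + z x / a\<^sup>2)))" using assms(2) by (auto simp: field_simps)
  also have "\<dots> \<in> L2" by (intro L2_cmult L2_add 1 2)
  finally show "v \<in> L2" .
  have "z = (\<lambda>x. a\<^sup>2 / 2 * ((v x / a + z x / a\<^sup>2) - (v x / a - z x / a\<^sup>2)))" using assms(2) by (auto simp: field_simps)
  also have "\<dots> \<in> L2" by (intro L2_cmult L2_diff 1 2)
  finally show "z \<in> L2" .
qed

lemma resolvent_diff:
  assumes "resolvent a h1 v1 z1" "resolvent a h2 v2 z2"
  shows "resolvent a (\<lambda>x. h1 x - h2 x) (\<lambda>x. v1 x - v2 x) (\<lambda>x. z1 x - z2 x)"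
proof -
  obtain M1 M2 where M: "\<And>x. \<bar>v1 x\<bar> \<le> M1" "\<And>x. \<bar>z1 x\<bar> \<le> M1" "\<And>x. \<bar>v2 x\<bar> \<le> M2" "\<And>x. \<bar>z2 x\<bar> \<le> M2"
    using assms unfolding resolvent_def by blast
  have "\<bar>v1 x - v2 x\<bar> \<le> M1 + M2 \<and> \<bar>z1 x - z2 x\<bar> \<le> M1 + M2" for x
    using M(1)[of x] M(2)[of x] M(3)[of x] M(4)[of x] by linarith
  moreover have "((\<lambda>x. z1 x - z2 x) has_real_derivative a\<^sup>2 * (v1 x - v2 x - (h1 x - h2 x))) (at x)" for x
    using assms by (auto simp: resolvent_def algebra_simps intro!: derivative_eq_intros)
  moreover have "((\<lambda>x. v1 x - v2 x) has_real_derivative z1 x - z2 x) (at x)" for x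
    using assms by (auto simp: resolvent_def intro!: derivative_intros)
  ultimately show ?thesis unfolding resolvent_def by blast
qed

lemma resolvent_exists:
  assumes a: "a > 0" and cont: "continuous_on UNIV h" and h: "\<And>x. \<bar>h x\<bar> \<le> B"
  shows "\<exists>v z. resolvent a h v z"
proof -
  obtain w1 where w1: "\<And>x. (w1 has_real_derivative (h x - a * w1 x)) (at x)" "\<And>x. \<bar>w1 x\<bar> \<le> B / a"
    using bounded_solution_exists[OF a cont h] by blast
  have cont': "continuous_on UNIV (\<lambda>x. h (- x))"
    by (rule continuous_on_compose2[OF cont]) (auto intro!: continuous_intros)
  obtain w2 where w2: "\<And>x. (w2 has_real_derivative (h (- x) - a * w2 x)) (at x)" "\<And>x. \<bar>w2 x\<bar> \<le> B / a"
    using bounded_solution_exists[OF a cont', of B] h by blast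
  have w2': "((\<lambda>x. w2 (- x)) has_real_derivative (a * w2 (- x) - h x)) (at x)" for x
    using has_deriv_reflect[OF w2(1), of x] by simp
  define v where "v x = a / 2 * (w1 x + w2 (- x))" for x
  define z where "z x = a\<^sup>2 / 2 * (w2 (- x) - w1 x)" for x
  have "(v has_real_derivative z x) (at x)" for x
  proof -
    have "(v has_real_derivative a / 2 * ((h x - a * w1 x) + (a * w2 (- x) - h x))) (at x)"
      unfolding v_def[abs_def] by (intro DERIV_cmult DERIV_add w1(1) w2')
    also have "a / 2 * ((h x - a * w1 x) + (a * w2 (- x) - h x)) = z x"
      by (simp add: z_def power2_eq_square right_diff_distrib)
    finally show ?thesis .
  qed
  moreover have "(z has_real_derivative a\<^sup>2 * (v x - h x)) (at x)" for x
  proof -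
    have "(z has_real_derivative a\<^sup>2 / 2 * ((a * w2 (- x) - h x) - (h x - a * w1 x))) (at x)"
      unfolding z_def[abs_def] by (intro DERIV_cmult DERIV_diff w1(1) w2')
    also have "(a * w2 (- x) - h x) - (h x - a * w1 x) = 2 * (v x - h x)"
      by (simp add: v_def distrib_left)
    also have "a\<^sup>2 / 2 * (2 * (v x - h x)) = a\<^sup>2 * (v x - h x)" by simp
    finally show ?thesis .
  qed
  moreover have "\<bar>v x\<bar> \<le> B + a * B \<and> \<bar>z x\<bar> \<le> B + a * B" for x
  proof -
    have B: "0 \<le> B" using h[of 0] by linarith
    have "\<bar>w1 x + w2 (- x)\<bar> \<le> 2 * (B / a)" "\<bar>w2 (- x) - w1 x\<bar> \<le> 2 * (B / a)"
      using w1(2)[of x] w2(2)[of "- x"] by linarith+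
    then have "a / 2 * \<bar>w1 x + w2 (- x)\<bar> \<le> a / 2 * (2 * (B / a))" "a\<^sup>2 / 2 * \<bar>w2 (- x) - w1 x\<bar> \<le> a\<^sup>2 / 2 * (2 * (B / a))"
      using a by (intro mult_left_mono; simp)+
    then have "\<bar>v x\<bar> \<le> a / 2 * (2 * (B / a))" "\<bar>z x\<bar> \<le> a\<^sup>2 / 2 * (2 * (B / a))"
      using a by (simp_all add: v_def z_def abs_mult)
    then show ?thesis using a B by (simp add: power2_eq_square field_simps)
  qed
  ultimately show ?thesis unfolding resolvent_def by blast
qed

text \<open>Banach's fixed point theorem in the bounded continuous functions. The potential term is
  moved into the source; as \<tau> u^2 <= 1/2 and the resolvent does not increase the sup norm, the
  resulting map contracts by 1/2.\<close>

lemma implicit_step_exists: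
  assumes hu: "h1p u u'" and u_le: "\<And>x. \<bar>u x\<bar> \<le> 1" and \<tau>: "0 < \<tau>" "\<tau> \<le> 1 / 2"
    and \<psi>: "AE x in lborel. \<psi> x = u x"
  shows "\<exists>v. implicit_step \<tau> \<psi> v"
proof -
  \<comment> \<open>Chosen so that a^(-2) = \<tau>/2 is the coefficient of the second derivative in
    the scheme.\<close>
  define a where "a = sqrt (2 / \<tau>)"
  have a: "a > 0" "a\<^sup>2 = 2 / \<tau>" using \<tau> by (auto simp: a_def)
  have cu: "continuous_on UNIV u" by (rule ac_continuous[OF h1pD(3)[OF hu]])
  have u2: "(u x)\<^sup>2 \<le> 1" for x using u_le[of x] by (simp add: abs_square_le_1)
  define src where "src v x = u x + \<tau> * ((u x)\<^sup>2 * v x)" for v :: "real \<Rightarrow> real" and x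
  have src_diff: "\<bar>src v x - src w x\<bar> \<le> 1 / 2 * D" if "\<bar>v x - w x\<bar> \<le> D" for v w x D
  proof -
    have "src v x - src w x = \<tau> * ((u x)\<^sup>2 * (v x - w x))" by (simp add: src_def algebra_simps)
    then have "\<bar>src v x - src w x\<bar> = \<tau> * ((u x)\<^sup>2 * \<bar>v x - w x\<bar>)" using \<tau> by (simp add: abs_mult)
    also have "\<dots> \<le> 1 / 2 * (1 * D)" using \<tau> u2[of x] that by (intro mult_mono) auto
    finally show ?thesis by simp
  qed
  have "\<exists>T z. resolvent a (src (apply_bcontfun v)) (apply_bcontfun T) z" for v :: "real \<Rightarrow>\<^sub>C real"
  proof -
    have cs: "continuous_on UNIV (src (apply_bcontfun v))"
      unfolding src_def[abs_def] by (intro continuous_intros cu) auto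
    have "\<bar>src (apply_bcontfun v) x\<bar> \<le> 1 + 1 / 2 * norm v" for x
      using src_diff[of "apply_bcontfun v" x "\<lambda>_. 0" "norm v"] norm_bounded[of v x] u_le[of x]
      by (auto simp: src_def)
    from resolvent_exists[OF a(1) cs this]
    obtain w z where wz: "resolvent a (src (apply_bcontfun v)) w z" by blast
    then obtain M where M: "\<And>x. \<bar>w x\<bar> \<le> M" and der: "\<And>x. (w has_real_derivative z x) (at x)"
      by (auto simp: resolvent_def)
    have "w \<in> bcontfun"
      by (rule bcontfun_normI[of _ M]) (use M der in \<open>auto intro!: continuous_at_imp_continuous_on DERIV_isCont\<close>)
    then have "apply_bcontfun (Bcontfun w) = w" by (rule Bcontfun_inverse)
    with wz show ?thesis by metis
  qed
  then obtain T Z where T: "\<And>v. resolvent a (src (apply_bcontfun v)) (apply_bcontfun (T v)) (Z v)" by metis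
  have "dist (T v) (T w) \<le> 1 / 2 * dist v w" for v w
  proof (rule dist_bound)
    fix x
    have "\<bar>apply_bcontfun (T v) x - apply_bcontfun (T w) x\<bar> \<le> 1 / 2 * dist v w"
    proof (rule resolvent_bound[OF resolvent_diff[OF T T] a(1)])
      show "\<bar>src (apply_bcontfun v) x - src (apply_bcontfun w) x\<bar> \<le> 1 / 2 * dist v w" for x
        using dist_bounded[of v x w] by (intro src_diff) (simp add: dist_real_def)
    qed
    then show "dist (apply_bcontfun (T v) x) (apply_bcontfun (T w) x) \<le> 1 / 2 * dist v w"
      by (simp add: dist_real_def)
  qed
  then have "\<exists>!v. T v = v" by (intro banach_fix_type[of "1/2"]) auto
  then obtain v0 where v0: "T v0 = v0" by blast
  define v z where "v = apply_bcontfun v0" and "z = Z v0"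
  have R: "resolvent a (src v) v z" using T[of v0] v0 by (simp add: v_def z_def)
  have vb: "\<bar>v x\<bar> \<le> norm v0" for x using norm_bounded[of v0 x] by (simp add: v_def)
  have cv: "continuous_on UNIV v" by (simp add: v_def)
  have csv: "continuous_on UNIV (src v)" unfolding src_def[abs_def] by (intro continuous_intros cu cv)
  \<comment> \<open>The fixed point is so far only bounded, but \<open>v\<close> enters the source
    multiplied by u^2, which restores square integrability.\<close>
  have srcL2: "src v \<in> L2"
  proof -
    have "(\<lambda>x. v x * u x) \<in> L2"
      by (rule L2_bounded_mult[OF h1pD(1)[OF hu] _ vb]) (intro borel_measurable_continuous_onI cv)
    from h1p_L2_mult[OF hu this] have "(\<lambda>x. (u x)\<^sup>2 * v x) \<in> L2" by (simp add: power2_eq_square ac_simps)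
    then show ?thesis unfolding src_def[abs_def] by (intro L2_add L2_cmult h1pD(1)[OF hu])
  qed
  note L2 = resolvent_L2[OF R a(1) csv srcL2]
  have der: "\<And>x. (v has_real_derivative z x) (at x)" "\<And>x. (z has_real_derivative a\<^sup>2 * (v x - src v x)) (at x)"
    using R by (auto simp: resolvent_def)
  have cz: "continuous_on UNIV z" using der(2) by (auto intro!: continuous_at_imp_continuous_on DERIV_isCont)
  have acv: "ac v z" by (rule ac_of_deriv[OF der(1) cz])
  have acz: "ac z (\<lambda>x. a\<^sup>2 * (v x - src v x))" by (rule ac_of_deriv[OF der(2)]) (intro continuous_intros cv csv)
  have "h1p v z" using L2 acv by (simp add: h1p_def)
  then have "v \<in> H1" by (rule h1p_imp_H1(1)) (use ac_borel[OF acv] in auto)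
  moreover have "has_weak_laplacian v (\<lambda>x. a\<^sup>2 * (v x - src v x))"
    unfolding has_weak_laplacian_def using ac_has_weak_deriv[OF acv] ac_has_weak_deriv[OF acz] by blast
  moreover have "AE x in lborel. v x = \<psi> x + \<tau> * (1 / 2 * (a\<^sup>2 * (v x - src v x)) + \<bar>\<psi> x\<bar>\<^sup>2 * v x)"
    using \<psi> by eventually_elim (use \<tau> in \<open>simp add: a(2) src_def field_simps\<close>)
  ultimately show ?thesis unfolding implicit_step_def by blast
qed

section \<open>Convergence\<close>

lemma energy_gap_nonneg:
  assumes "h1p f f'" "\<And>x. f (- x) = f x" "l2_norm f = 1"
  shows "0 \<le> energy_gap f f'"
proof -
  obtain F where F: "mass_function f f' F" using even_mass_function[OF assms] by blast
  interpret mass_function f f' F by (rule F)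
  show ?thesis by (simp add: energy_gap_eq)
qed

section \<open>An invariant neighbourhood of the ground state\<close>

definition close_state :: "real \<Rightarrow> (real \<Rightarrow> real) \<Rightarrow> (real \<Rightarrow> real) \<Rightarrow> bool" where
  "close_state \<delta> u u' \<longleftrightarrow> h1p u u' \<and> (\<forall>x. u (- x) = u x) \<and> l2_norm u = 1 \<and>
     eta_dist_sq u u' \<le> \<delta>\<^sup>2"

lemma close_state_bounds:
  assumes "close_state \<delta> u u'" "0 \<le> \<delta>" "\<delta> \<le> 1 / 2"
  shows "\<bar>u x\<bar> \<le> 1" "l2_norm u' \<le> 2"
proof -
  have hu: "h1p u u'"
    and c: "eta_dist_sq u u' \<le> \<delta>\<^sup>2"
    using assms(1) by (auto simp: close_state_def)
  note he = h1p_diff[OF hu h1p_eta]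
  have "(u x - eta x)\<^sup>2 \<le> \<delta>\<^sup>2" using h1p_sup[OF he, of x] c by linarith
  then have "\<bar>u x - eta x\<bar> \<le> \<delta>" using abs_le_square_iff[of "u x - eta x" \<delta>] assms(2) by simp
  then show "\<bar>u x\<bar> \<le> 1" using abs_eta_le[of x] assms(3) by linarith
  have "(l2_norm (\<lambda>x. u' x - deta x))\<^sup>2 \<le> \<delta>\<^sup>2"
    using c zero_le_power2[of "l2_norm (\<lambda>x. u x - eta x)"] by linarith
  then have "l2_norm (\<lambda>x. u' x - deta x) \<le> \<delta>" by (rule power2_le_imp_le[OF _ assms(2)])
  moreover have "l2_norm deta \<le> 1 / 2 * l2_norm eta"
  proof (rule l2_norm_mono[OF eta_L2 L2D(1)[OF deta_L2]])
    show "\<bar>deta y\<bar> \<le> 1 / 2 * \<bar>eta y\<bar>" for y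
      using mult_right_mono[OF abs_mass_eta[of y], of "\<bar>eta y\<bar>"] by (simp add: deta_def abs_mult)
  qed simp
  moreover have "l2_norm u' \<le> l2_norm (\<lambda>x. u' x - deta x) + l2_norm deta"
    using l2_norm_triangle[OF h1pD(2)[OF he] deta_L2] by simp
  ultimately show "l2_norm u' \<le> 2" using eta_norm assms(3) by simp
qed

lemma l2_norm_sum_sq_le:
  assumes "f \<in> L2" "g \<in> L2"
  shows "(l2_norm (\<lambda>x. f x + g x))\<^sup>2 \<le> 2 * (l2_norm f)\<^sup>2 + 2 * (l2_norm g)\<^sup>2"
proof -
  have "(l2_norm (\<lambda>x. f x + g x))\<^sup>2 \<le> (l2_norm f + l2_norm g)\<^sup>2"
    by (rule power_mono[OF l2_norm_triangle[OF assms]]) simp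
  also have "\<dots> \<le> 2 * (l2_norm f)\<^sup>2 + 2 * (l2_norm g)\<^sup>2"
    using zero_le_power2[of "l2_norm f - l2_norm g"] by (simp add: power2_sum power2_diff)
  finally show ?thesis .
qed

text \<open>
  The bound on the energy gap is what makes the neighbourhood invariant: by coercivity it controls
  the distance to \<open>eta\<close> far better than the radius does, and it decreases along the iteration.
\<close>

definition basin :: "real \<Rightarrow> (real \<Rightarrow> real) \<Rightarrow> bool" where
  "basin g f \<longleftrightarrow> f \<in> borel_measurable borel \<and> (\<exists>u u'. close_state (1 / 640000) u u' \<and>
     (AE x in lborel. f x = u x) \<and> energy_gap u u' \<le> g)"

text \<open>Small enough that 160002 \<open>gap0\<close>, the bound on the squared distance to
  \<open>eta\<close> after one step, stays below the squared radius.\<close>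

definition gap0 :: real where "gap0 = (1 / 640000)\<^sup>2 / 200000"

lemma basin_step_exists:
  assumes "basin g f" "0 < \<tau>" "\<tau> \<le> 1 / 2"
  shows "\<exists>s. implicit_step \<tau> f s"
proof -
  obtain u u' where u: "close_state (1 / 640000) u u'" "AE x in lborel. f x = u x"
    using assms(1) by (auto simp: basin_def)
  from close_state_bounds(1)[OF u(1)] have "\<bar>u x\<bar> \<le> 1" for x by simp
  then show ?thesis
    using u(1) assms(2,3) u(2) by (intro implicit_step_exists[of u u']) (auto simp: close_state_def)
qed

lemma basin_step_unique:
  assumes "basin g f" "0 < \<tau>" "\<tau> \<le> 1 / 2" "AE x in lborel. f x = f1 x" "implicit_step \<tau> f s" "implicit_step \<tau> f1 s1"
  shows "AE x in lborel. s x = s1 x"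
proof -
  obtain u u' where u: "close_state (1 / 640000) u u'" "AE x in lborel. f x = u x"
    using assms(1) by (auto simp: basin_def)
  have u1: "AE x in lborel. f1 x = u x" using u(2) assms(4) by eventually_elim simp
  have hu: "h1p u u'" using u(1) by (simp add: close_state_def)
  have u_le: "\<bar>u x\<bar> \<le> 1" for x using close_state_bounds(1)[OF u(1)] by simp
  obtain v v' where v: "h1p v v'" "AE x in lborel. s x = v x" "weak_step \<tau> 1 u v v'"
    using implicit_step_weak[OF hu u(2) assms(2,5)] by blast
  obtain w w' where w: "h1p w w'" "AE x in lborel. s1 x = w x" "weak_step \<tau> 1 u w w'"
    using implicit_step_weak[OF hu u1 assms(2,6)] by blast
  have "v = w" by (rule weak_step_unique[OF hu u_le assms(2,3) v(3) w(3) v(1) w(1)])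
  show ?thesis using v(2) w(2) by eventually_elim (simp add: \<open>v = w\<close>)
qed

text \<open>A bootstrap in two stages: energy decay needs no closeness of the new iterate and yields
  that closeness; only then does the contraction estimate become available.\<close>

lemma basin_step:
  assumes f: "basin g f" and g: "g \<le> gap0" and \<tau>: "0 < \<tau>" "\<tau> \<le> 1 / 2" and s: "implicit_step \<tau> f s"
  shows "l2_norm s \<noteq> 0" "basin (g / (1 + \<tau> / 200000000)) (\<lambda>x. s x / l2_norm s)"
proof -
  obtain u u' where u: "close_state (1 / 640000) u u'" "AE x in lborel. f x = u x" "energy_gap u u' \<le> g"
    using f by (auto simp: basin_def)
  have hu: "h1p u u'" and u_even: "\<And>x. u (- x) = u x" and nu: "l2_norm u = 1"
    and cu: "eta_dist_sq u u' \<le> (1 / 640000)\<^sup>2"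
    using u(1) by (auto simp: close_state_def)
  have u_le: "\<bar>u x\<bar> \<le> 1" for x using close_state_bounds(1)[OF u(1)] by simp
  have nu': "l2_norm u' \<le> 2" using close_state_bounds(2)[OF u(1)] by simp
  obtain v v' where v: "h1p v v'" "AE x in lborel. s x = v x" "weak_step \<tau> 1 u v v'"
    using implicit_step_weak[OF hu u(2) \<tau>(1) s] by blast
  have sb: "s \<in> borel_measurable borel" using s by (auto simp: implicit_step_def H1_def L2_def)
  define m where "m = l2_norm v"
  have sm: "l2_norm s = m"
    unfolding m_def by (rule l2_norm_cong_AE[OF sb ac_borel[OF h1pD(3)[OF v(1)]] v(2)])
  \<comment> \<open>For v = 0 the weak equation tested with \<open>u\<close> would give u norm
    zero.\<close>
  have "m \<noteq> 0"
  proof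
    assume "m = 0"
    then have "AE x in lborel. v x = 0" using l2_norm_eq_0_AE[OF h1pD(1)[OF v(1)]] by (simp add: m_def)
    then have v0: "v = (\<lambda>_. 0)" by (intro AE_eq_continuous ac_continuous[OF h1pD(3)[OF v(1)]]) auto
    have "AE x in lborel. v' x = 0"
      using ac_unique[OF h1pD(3)[OF v(1)]] ac_const[of 0] unfolding v0 by blast
    then have "AE x in lborel. v' x * u' x = 0" by eventually_elim simp
    then have "ip v' u' = 0" by (rule integral_eq_zero_AE)
    then have "ip u u = 0" using weak_stepD[OF v(3) hu] by (simp add: v0)
    then show False using nu by (simp add: l2_norm_def power2_eq_square)
  qed
  then show "l2_norm s \<noteq> 0" by (simp add: sm)
  have m: "m > 0" using \<open>m \<noteq> 0\<close> by (simp add: m_def less_le)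
  define w w' where "w x = 1 / m * v x" and "w' x = 1 / m * v' x" for x
  have hw: "h1p w w'" unfolding w_def[abs_def] w'_def[abs_def] by (rule h1p_cmult[OF v(1)])
  have nw: "l2_norm w = 1" unfolding w_def[abs_def] l2_norm_cmult using m by (simp add: m_def)
  have weak: "weak_step \<tau> (1 / m) u w w'"
    using weak_step_cmult[OF v(3), of "1 / m"] by (simp add: w_def[abs_def] w'_def[abs_def])
  have w_even: "w (- x) = w x" for x
  proof -
    have "(\<lambda>x. w (- x)) = w"
      by (rule weak_step_unique[OF hu u_le \<tau> weak_step_reflect[OF weak u_even] weak h1p_reflect[OF hw] hw])
    then show ?thesis by metis
  qed
  interpret st: scheme_step u u' w w' \<tau> "1 / m"
    by unfold_locales (use hu hw nu nw \<tau> m weak u_le in auto)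
  have gap_u: "energy_gap u u' \<le> gap0" using u(3) g by simp
  have gap_w: "0 \<le> energy_gap w w'" by (rule energy_gap_nonneg[OF hw w_even nw])
  \<comment> \<open>The new gap is nonnegative, so the whole dissipation is bounded by the old gap;
    \<tau> <= 1 allows the factor 1/\<tau> to be dropped.\<close>
  have dist_d: "(l2_norm st.d)\<^sup>2 + (l2_norm st.d')\<^sup>2 \<le> gap0"
  proof -
    have "(l2_norm st.d)\<^sup>2 \<le> (l2_norm st.d)\<^sup>2 / \<tau>"
      using \<tau> mult_right_mono[of \<tau> 1 "(l2_norm st.d)\<^sup>2"] by (simp add: field_simps)
    then show ?thesis using st.energy_decay gap_w gap_u by linarith
  qed
  have "(1 / 640000)\<^sup>2 \<le> (1 / 64 :: real)\<^sup>2" by (simp add: power2_eq_square)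
  then have dist_u: "eta_dist_sq u u' \<le> 80000 * gap0"
    using energy_gap_coercive[OF hu u_even nu] cu gap_u by linarith
  note Lu = h1pD[OF h1p_diff[OF hu h1p_eta]] and Ld = h1pD[OF st.hd]
  have w_eq: "(\<lambda>x. w x - eta x) = (\<lambda>x. (u x - eta x) + st.d x)" "(\<lambda>x. w' x - deta x) = (\<lambda>x. (u' x - deta x) + st.d' x)"
    by (auto simp: st.d_def st.d'_def)
  \<comment> \<open>160002 = 2 * 80000 + 2: coercivity at \<open>u\<close> plus the displacement,
    each doubled by squaring the triangle inequality.\<close>
  have "eta_dist_sq w w' \<le> 160002 * gap0"
    unfolding w_eq using l2_norm_sum_sq_le[OF Lu(1) Ld(1)] l2_norm_sum_sq_le[OF Lu(2) Ld(2)] dist_u dist_d by linarith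
  also have "\<dots> \<le> (1 / 640000)\<^sup>2" by (simp add: gap0_def power2_eq_square)
  finally have close_w: "close_state (1 / 640000) w w'"
    using hw w_even nw by (simp add: close_state_def)
  interpret near: near_step u u' w w' \<tau> "1 / m"
    using close_w close_state_bounds[OF close_w] nu' by unfold_locales (auto simp: close_state_def)
  have "energy_gap w w' \<le> g / (1 + \<tau> / 200000000)"
    using near.energy_contraction u(3) \<tau> by (simp add: pos_le_divide_eq mult.commute)
  moreover have "AE x in lborel. s x / l2_norm s = w x"
    using v(2) by eventually_elim (simp add: sm w_def)
  ultimately show "basin (g / (1 + \<tau> / 200000000)) (\<lambda>x. s x / l2_norm s)"
    unfolding basin_def using close_w sb by (auto intro!: borel_measurable_divide)
qed

lemma AE_lborel_reflect:
  fixes P :: "real \<Rightarrow> bool"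
  assumes "AE x in lborel. P x" "{x. P x} \<in> sets borel"
  shows "AE x in lborel. P (- x)"
proof -
  have "AE x in distr lborel borel uminus. P x" unfolding lborel_distr_uminus by (rule assms(1))
  then show ?thesis using assms(2) by (subst (asm) AE_distr_iff) auto
qed

text \<open>The initial radius is a thousandth of the working radius, so that three times its
  square, the bound on the gap from above, is below \<open>gap0\<close>. The almost everywhere
  evenness becomes pointwise on the continuous representative.\<close>

lemma initial_basin:
  assumes "f \<in> S \<inter> U (1 / 640000000)"
  shows "basin gap0 f"
proof -
  have H: "f \<in> H1" and even: "AE x in lborel. f (- x) = f x" and nf: "l2_norm f = 1"
    and R: "h1_norm (\<lambda>x. f x - eta x) < 1 / 640000000"
    using assms by (auto simp: S_def U_def V_def)
  obtain u u' where u: "h1p u u'" "AE x in lborel. f x = u x" using H1_representative[OF H] by blast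
  have f_L2: "f \<in> L2" using H by (simp add: H1_def)
  have f_borel: "f \<in> borel_measurable borel" and u_borel: "u \<in> borel_measurable borel"
    by (fact L2D(1)[OF f_L2] L2D(1)[OF h1pD(1)[OF u(1)]])+
  have "l2_norm f = l2_norm u" by (rule l2_norm_cong_AE[OF f_borel u_borel u(2)])
  then have nu: "l2_norm u = 1" using nf by simp
  have "AE x in lborel. f (- x) = u (- x)" 
  proof (rule AE_lborel_reflect[OF u(2)])
    have "{x \<in> space borel. f x = u x} \<in> sets borel" by (rule borel_measurable_eq[OF f_borel u_borel])
    then show "{x. f x = u x} \<in> sets borel" by simp
  qed
  with even u(2) have "AE x in lborel. u (- x) = u x" by eventually_elim simp
  then have "(\<lambda>x. u (- x)) = u"
    by (intro AE_eq_continuous ac_continuous[OF h1pD(3)[OF u(1)]] ac_continuous[OF ac_reflect[OF h1pD(3)[OF u(1)]]])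
  then have u_even: "u (- x) = u x" for x by metis
  have "(h1_norm (\<lambda>x. f x - eta x))\<^sup>2 = eta_dist_sq u u'"
  proof (rule h1p_imp_H1(2)[OF h1p_diff[OF u(1) h1p_eta]])
    show "AE x in lborel. f x - eta x = u x - eta x" using u(2) by eventually_elim simp
  qed (intro borel_measurable_diff f_borel L2D(1)[OF eta_L2])
  moreover have "(h1_norm (\<lambda>x. f x - eta x))\<^sup>2 \<le> (1 / 640000000)\<^sup>2"
    using R by (intro power_mono) (auto simp: h1_norm_def)
  ultimately have c: "eta_dist_sq u u' \<le> (1 / 640000000)\<^sup>2" by simp
  have "energy_gap u u' \<le> 3 * (1 / 640000000)\<^sup>2"
    using energy_gap_upper[OF u(1) nu] c by (simp add: power2_eq_square)
  also have "\<dots> \<le> gap0" by (simp add: gap0_def power2_eq_square)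
  finally have "energy_gap u u' \<le> gap0" .
  moreover have "close_state (1 / 640000) u u'"
    using u(1) u_even nu c by (simp add: close_state_def power2_eq_square)
  ultimately show ?thesis unfolding basin_def using u(2) f_borel by blast
qed

lemma basin_h1_norm:
  assumes "basin g f"
  shows "(h1_norm (\<lambda>x. f x - eta x))\<^sup>2 \<le> 80000 * g"
proof -
  obtain u u' where u: "close_state (1 / 640000) u u'" "AE x in lborel. f x = u x" "energy_gap u u' \<le> g"
    and [measurable]: "f \<in> borel_measurable borel"
    using assms by (auto simp: basin_def)
  have hu: "h1p u u'" and u_even: "\<And>x. u (- x) = u x" and nu: "l2_norm u = 1"
    and cu: "eta_dist_sq u u' \<le> (1 / 640000)\<^sup>2"
    using u(1) by (auto simp: close_state_def)
  have [measurable]: "eta \<in> borel_measurable borel" using L2D(1)[OF eta_L2] .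
  have "(h1_norm (\<lambda>x. f x - eta x))\<^sup>2 = eta_dist_sq u u'"
  proof (rule h1p_imp_H1(2)[OF h1p_diff[OF hu h1p_eta]])
    show "AE x in lborel. f x - eta x = u x - eta x" using u(2) by eventually_elim simp
  qed measurable
  moreover have "(1 / 640000)\<^sup>2 \<le> (1 / 64 :: real)\<^sup>2" by (simp add: power2_eq_square)
  ultimately show ?thesis
    using energy_gap_coercive[OF hu u_even nu] cu u(3) by linarith
qed

lemma basin_mono: "basin g f \<Longrightarrow> g \<le> g' \<Longrightarrow> basin g' f"
  unfolding basin_def by (meson order_trans)

lemma gradient_scheme_basin:
  assumes "gradient_scheme \<tau> f \<psi>" "basin gap0 f" "0 < \<tau>" "\<tau> \<le> 1 / 2"
  shows "basin (gap0 / (1 + \<tau> / 200000000) ^ n) (\<psi> n)"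
proof (induction n)
  case 0
  then show ?case using assms by (simp add: gradient_scheme_def)
next
  case (Suc n)
  obtain s where s: "implicit_step \<tau> (\<psi> n) s" "\<psi> (Suc n) = (\<lambda>x. s x / l2_norm s)"
    using assms(1) by (auto simp: gradient_scheme_def)
  have "1 \<le> (1 + \<tau> / 200000000) ^ n" using assms(3) by (intro one_le_power) simp
  then have "gap0 / (1 + \<tau> / 200000000) ^ n \<le> gap0" using assms(3) by (simp add: divide_le_eq gap0_def)
  from basin_step(2)[OF Suc this assms(3,4) s(1)]
  show ?case by (simp add: s(2) mult.commute)
qed

text \<open>Speaking of the sequence defined by the scheme presupposes that it exists and is unique
  up to null sets; both are included, so the decay estimate is not vacuous.\<close>

theorem theorem4p3:
  "\<exists>R \<tau>0 r C :: real. R > 0 \<and> \<tau>0 > 0 \<and> r > 0 \<and> C > 0 \<and>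
     (\<forall>\<psi>0 \<in> S \<inter> U R. \<forall>\<tau>. 0 < \<tau> \<and> \<tau> \<le> \<tau>0 \<longrightarrow>
        (\<exists>\<psi>. gradient_scheme \<tau> \<psi>0 \<psi>) \<and>
        (\<forall>\<psi> \<phi>. gradient_scheme \<tau> \<psi>0 \<psi> \<and> gradient_scheme \<tau> \<psi>0 \<phi> \<longrightarrow>
           (\<forall>n. AE x in lborel. \<psi> n x = \<phi> n x)) \<and>
        (\<forall>\<psi>. gradient_scheme \<tau> \<psi>0 \<psi> \<longrightarrow>
           (\<forall>n. h1_norm (\<lambda>x. \<psi> n x - eta x) \<le> C * exp (- r * real n * \<tau>))))"
proof (rule exI[of _ "1 / 640000000"], rule exI[of _ "1 / 2"], rule exI[of _ "1 / 800000000"], rule exI[of _ 1],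
    intro conjI ballI allI impI)
  fix f \<tau> assume "f \<in> S \<inter> U (1 / 640000000)" and "0 < \<tau> \<and> \<tau> \<le> (1 / 2 :: real)"
  then have f: "basin gap0 f" and \<tau>: "0 < \<tau>" "\<tau> \<le> 1 / 2" by (auto intro: initial_basin)
  define q where "q = 1 + \<tau> / 200000000"
  have q: "q \<ge> 1" using \<tau> by (simp add: q_def)
  have step_mono: "g / q \<le> gap0" if "g \<le> gap0" for g
  proof (cases "g \<ge> 0")
    case True
    then have "g / q \<le> g / 1" using q by (intro divide_left_mono) auto
    with that show ?thesis by simp
  next
    case False
    then have "g / q \<le> 0" using q by (simp add: divide_nonpos_nonneg)
    also have "0 \<le> gap0" by (simp add: gap0_def)
    finally show ?thesis .
  qed
  \<comment> \<open>Dependent choice, as each step has many representatives. The clause for n = 0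
    pins the initial value, and membership in the basin guarantees that the next step is
    solvable.\<close>
  have "\<exists>\<psi>. \<forall>n. (basin gap0 (\<psi> n) \<and> (n = 0 \<longrightarrow> \<psi> n = f)) \<and>
    (\<exists>s. implicit_step \<tau> (\<psi> n) s \<and> l2_norm s \<noteq> 0 \<and> \<psi> (Suc n) = (\<lambda>x. s x / l2_norm s))"
  proof (rule dependent_nat_choice)
    show "\<exists>x. basin gap0 x \<and> (0 = (0::nat) \<longrightarrow> x = f)" using f by blast
    fix h n assume h: "basin gap0 h \<and> (n = (0::nat) \<longrightarrow> h = f)"
    obtain s where s: "implicit_step \<tau> h s" using basin_step_exists[of gap0 h \<tau>] h \<tau> by blast
    note st = basin_step[OF conjunct1[OF h] order_refl \<tau> s]
    have "basin gap0 (\<lambda>x. s x / l2_norm s)"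
      using basin_mono[OF st(2)] step_mono[of gap0] by (simp add: q_def)
    then show "\<exists>y. (basin gap0 y \<and> (Suc n = 0 \<longrightarrow> y = f)) \<and> (\<exists>s. implicit_step \<tau> h s \<and> l2_norm s \<noteq> 0 \<and> y = (\<lambda>x. s x / l2_norm s))"
      using s st(1) by blast
  qed
  then show "\<exists>\<psi>. gradient_scheme \<tau> f \<psi>" unfolding gradient_scheme_def by blast
  have bas: "basin gap0 (\<psi> n)" if "gradient_scheme \<tau> f \<psi>" for \<psi> n
  proof (rule basin_mono[OF gradient_scheme_basin[OF that f \<tau>]])
    have "1 \<le> (1 + \<tau> / 200000000) ^ n" using \<tau> by (intro one_le_power) simp
    then show "gap0 / (1 + \<tau> / 200000000) ^ n \<le> gap0" by (simp add: divide_le_eq gap0_def)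
  qed
  {
    fix \<psi> \<phi> n assume "gradient_scheme \<tau> f \<psi> \<and> gradient_scheme \<tau> f \<phi>"
    then have \<psi>: "gradient_scheme \<tau> f \<psi>" and \<phi>: "gradient_scheme \<tau> f \<phi>" by auto
    show "AE x in lborel. \<psi> n x = \<phi> n x"
    proof (induction n)
      case 0
      then show ?case using \<psi> \<phi> by (simp add: gradient_scheme_def)
    next
      case (Suc n)
      obtain s where s: "implicit_step \<tau> (\<psi> n) s" "\<psi> (Suc n) = (\<lambda>x. s x / l2_norm s)"
        using \<psi> by (auto simp: gradient_scheme_def)
      obtain t where t: "implicit_step \<tau> (\<phi> n) t" "\<phi> (Suc n) = (\<lambda>x. t x / l2_norm t)"
        using \<phi> by (auto simp: gradient_scheme_def)
      have eq: "AE x in lborel. s x = t x" by (rule basin_step_unique[OF bas[OF \<psi>] \<tau> Suc s(1) t(1)])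
      have norms: "l2_norm s = l2_norm t"
        by (rule l2_norm_cong_AE[OF _ _ eq]) (use s(1) t(1) in \<open>auto simp: implicit_step_def H1_def L2_def\<close>)
      show ?case using eq by eventually_elim (simp add: s(2) t(2) norms)
    qed
  }
  fix \<psi> n assume \<psi>: "gradient_scheme \<tau> f \<psi>"
  \<comment> \<open>Half of q - 1, because exp y <= 1 + 2 y is used. The square root from gap to
    norm halves the exponent once more, which gives the rate 1/800000000.\<close>
  define y where "y = \<tau> / 400000000"
  have y: "0 \<le> y" "y \<le> 1" using \<tau> by (auto simp: y_def)
  have "exp y \<le> 1 + y + y\<^sup>2" by (rule exp_bound[OF y])
  also have "\<dots> \<le> 1 + 2 * y" using mult_left_le[of y y] y by (simp add: power2_eq_square)
  also have "\<dots> = q" by (simp add: q_def y_def)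
  finally have "exp y ^ n \<le> q ^ n" by (intro power_mono) auto
  then have "exp (real n * y) \<le> q ^ n" by (simp add: exp_of_nat_mult)
  \<comment> \<open>80000 \<open>gap0\<close> is below 1, so C = 1 suffices.\<close>
  then have "80000 * (gap0 / q ^ n) \<le> 1 / exp (real n * y)"
    using q by (intro order_trans[OF _ divide_left_mono[of "exp (real n * y)" "q ^ n" 1]])
      (auto simp: gap0_def power2_eq_square divide_le_eq intro!: mult_pos_pos)
  also have "\<dots> = (exp (- (1 / 800000000) * real n * \<tau>))\<^sup>2"
  proof -
    have "exp (real n * y) = (exp (1 / 800000000 * real n * \<tau>))\<^sup>2"
      by (simp add: y_def flip: exp_double)
    then show ?thesis by (simp add: exp_minus inverse_eq_divide power_divide)
  qed
  finally have "(h1_norm (\<lambda>x. \<psi> n x - eta x))\<^sup>2 \<le> (exp (- (1 / 800000000) * real n * \<tau>))\<^sup>2"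
    using basin_h1_norm[OF gradient_scheme_basin[OF \<psi> f \<tau>, of n]] by (simp add: q_def)
  then have "h1_norm (\<lambda>x. \<psi> n x - eta x) \<le> exp (- (1 / 800000000) * real n * \<tau>)"
    by (rule power2_le_imp_le) simp
  then show "h1_norm (\<lambda>x. \<psi> n x - eta x) \<le> 1 * exp (- (1 / 800000000) * real n * \<tau>)" by simp
qed simp_all

end
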